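(* Let $\mathcal{H}$ be the ring of Hurwitz integers. For any $0<\varepsilon<1$ there exists a lattice $\Lambda$ in $\mathbb{H}^t$ which is a free rank $t$ module over $\mathcal{H}$, the geometric mean of whose quaternionic minima satisfies $$\left(\prod_{j=1}^t\min{}_j(\Lambda)\right)^{1/t}>r,$$ where $r$ is defined by $$\mathrm{Vol}(\mathbb{B}(r))=(1-\varepsilon)\,\frac{24t\,\mathrm{Vol}(\mathcal{H}^t)\cdot\zeta(4t)}{e(1-e^{-t})},$$ and which, provided the odd prime $p=p(t)$ satisfies $t^2=o(p)$ (as $t\to\infty$) and $t$ is large enough, lies in the set of (rescaled) lifts $$\mathbb{L}_p=\{p^{\frac{1-t}{2t}}\phi_p^{-1}(C):C\in\mathcal{C}_{t+1}\},$$ where $\phi_p:\mathcal{H}^t\to(\mathcal{H}/p\mathcal{H})^t\cong M_2(\mathbb{F}_p)^t$ is the reduction map and $\mathcal{C}_{t+1}$ is the set of left $M_2(\mathbb{F}_p)$-submodules of $M_2(\mathbb{F}_p)^t$ isomorphic to $t+1$ copies of the simple left module $\mathbb{F}_p^2$.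
   Context: $\mathbb{H}$ is the algebra of real Hamilton quaternions and $\mathcal{H}$ is the Hurwitz order, the maximal order of $\left(\frac{-1,-1}{\mathbb{Q}}\right)$ generated over $\mathbb{Z}$ by $1,i,j,k$ and $\frac{1+i+j+k}{2}$; its unit group has order 24. The space $\mathbb{H}^t\cong\mathbb{R}^{4t}$ carries the Euclidean norm $\|x\|^2=\sum_{i=1}^t \mathrm{T}(\bar{x_i}x_i)$, with $\mathrm{T}$ the trace of left multiplication on $\mathbb{H}$ (a fixed scalar multiple of the standard norm); $\mathrm{Vol}(\mathcal{H}^t)$ is the covolume of $\mathcal{H}^t$ in $\mathbb{H}^t$ and $\mathbb{B}(r)$ is the ball of radius $r$ in $\mathbb{H}^t$, with volumes computed for the same Euclidean structure. For a lattice $\Lambda\subset\mathbb{H}^t$ stable under left multiplication by $\mathcal{H}$, the $j$-th quaternionic minimum $\min_j(\Lambda)$ is the smallest $\rho$ such that the closed ball of radius $\rho$ contains $j$ vectors of $\Lambda$ that are linearly independent for the left action of $\mathbb{H}$. *)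

theory Defs
  imports
    "HOL-Analysis.Analysis"
    "HOL-Library.Landau_Symbols"
    "HOL-Algebra.QuotRing"
    "HOL-Algebra.Module"
    "HOL-Number_Theory.Residues"
begin

datatype quat = Quat (quat_re: real) (quat_i: real) (quat_j: real) (quat_k: real)

lemma quat_eq_iff:
  "x = y \<longleftrightarrow> quat_re x = quat_re y \<and> quat_i x = quat_i y \<and> quat_j x = quat_j y \<and> quat_k x = quat_k y"
  by (metis quat.expand)

instantiation quat :: real_algebra_1
begin

definition "0 = Quat 0 0 0 0"
definition "1 = Quat 1 0 0 0"
definition "x + y =
  Quat (quat_re x + quat_re y) (quat_i x + quat_i y) (quat_j x + quat_j y) (quat_k x + quat_k y)"
definition "- x = Quat (- quat_re x) (- quat_i x) (- quat_j x) (- quat_k x)"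
definition "x - y =
  Quat (quat_re x - quat_re y) (quat_i x - quat_i y) (quat_j x - quat_j y) (quat_k x - quat_k y)"
definition "x * y = Quat
  (quat_re x * quat_re y - quat_i x * quat_i y - quat_j x * quat_j y - quat_k x * quat_k y)
  (quat_re x * quat_i y + quat_i x * quat_re y + quat_j x * quat_k y - quat_k x * quat_j y)
  (quat_re x * quat_j y - quat_i x * quat_k y + quat_j x * quat_re y + quat_k x * quat_i y)
  (quat_re x * quat_k y + quat_i x * quat_j y - quat_j x * quat_i y + quat_k x * quat_re y)"
definition "scaleR r x = Quat (r * quat_re x) (r * quat_i x) (r * quat_j x) (r * quat_k x)"

instance
  by standard
    (simp_all add: quat_eq_iff zero_quat_def one_quat_def plus_quat_def uminus_quat_def
      minus_quat_def times_quat_def scaleR_quat_def algebra_simps)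

end

instantiation quat :: real_inner
begin

definition "inner x y =
  quat_re x * quat_re y + quat_i x * quat_i y + quat_j x * quat_j y + quat_k x * quat_k y"
definition "norm x = sqrt (inner x (x :: quat))"
definition "sgn (x :: quat) = x /\<^sub>R norm x"
definition "dist x y = norm (x - y :: quat)"
definition "uniformity = (INF e\<in>{0 <..}. principal {(x, y :: quat). dist x y < e})"
definition "open (U :: quat set) \<longleftrightarrow>
  (\<forall>x\<in>U. eventually (\<lambda>(x', y). x' = x \<longrightarrow> y \<in> U) uniformity)"

instance
proof
  fix x y z :: quat and r :: real
  show "inner x y = inner y x" "inner (x + y) z = inner x z + inner y z"
    "inner (scaleR r x) y = r * inner x y" "0 \<le> inner x x"
    by (simp_all add: inner_quat_def plus_quat_def scaleR_quat_def algebra_simps)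
  show "inner x x = 0 \<longleftrightarrow> x = 0"
    by (cases x) (simp add: inner_quat_def zero_quat_def add_nonneg_eq_0_iff)
qed (rule norm_quat_def sgn_quat_def dist_quat_def uniformity_quat_def open_quat_def)+

end

instantiation quat :: euclidean_space
begin

definition "Basis = {Quat 1 0 0 0, Quat 0 1 0 0, Quat 0 0 1 0, Quat 0 0 0 1}"

instance
proof
  fix x u v :: quat
  show "(Basis :: quat set) \<noteq> {}" "finite (Basis :: quat set)"
    by (simp_all add: Basis_quat_def)
  show "u \<in> Basis \<Longrightarrow> v \<in> Basis \<Longrightarrow> inner u v = (if u = v then 1 else 0)"
    unfolding Basis_quat_def by (elim insertE emptyE; simp add: inner_quat_def)
  show "(\<forall>u\<in>Basis. inner x u = 0) \<longleftrightarrow> x = 0"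
    by (cases x) (simp add: Basis_quat_def inner_quat_def zero_quat_def)
qed

end

definition quat_cnj :: "quat \<Rightarrow> quat" where
  "quat_cnj x = Quat (quat_re x) (- quat_i x) (- quat_j x) (- quat_k x)"

definition quat_trace :: "quat \<Rightarrow> real"
  \<comment> \<open>trace of the real-linear map \<open>y \<mapsto> x * y\<close>\<close>
  where "quat_trace x = (\<Sum>b\<in>Basis. inner (x * b) b)"

definition hurwitz :: "quat set" where
  "hurwitz = {of_int a * Quat 1 0 0 0 + of_int b * Quat 0 1 0 0 + of_int c * Quat 0 0 1 0
    + of_int d * Quat 0 0 0 1 + of_int e * Quat (1/2) (1/2) (1/2) (1/2) | a b c d e :: int. True}"

text \<open>Left modules are carried by the \<open>module\<close> record type of HOL-Algebra; its locale of the same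
  name, which asks for commutative scalars, is not used. The fields \<open>mult\<close> and \<open>one\<close> of
  the record play no role in a module.\<close>

definition left_regular :: "'a ring \<Rightarrow> ('a, 'a) module" where
  "left_regular R = \<lparr>carrier = carrier R, mult = mult R, one = \<one>\<^bsub>R\<^esub>,
     zero = \<zero>\<^bsub>R\<^esub>, add = add R, smult = mult R\<rparr>"

definition power_module :: "('a, 'b) module \<Rightarrow> nat \<Rightarrow> ('a, nat \<Rightarrow> 'b) module" where
  "power_module M n = \<lparr>carrier = {..<n} \<rightarrow>\<^sub>E carrier M, mult = undefined, one = undefined,
     zero = (\<lambda>i\<in>{..<n}. \<zero>\<^bsub>M\<^esub>),
     add = (\<lambda>x y. \<lambda>i\<in>{..<n}. x i \<oplus>\<^bsub>M\<^esub> y i),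
     smult = (\<lambda>a x. \<lambda>i\<in>{..<n}. a \<odot>\<^bsub>M\<^esub> x i)\<rparr>"

definition left_module_iso :: "'a ring \<Rightarrow> ('a, 'b) module \<Rightarrow> ('a, 'c) module \<Rightarrow> ('b \<Rightarrow> 'c) set" where
  "left_module_iso R M N = {f \<in> iso (add_monoid M) (add_monoid N).
     \<forall>a\<in>carrier R. \<forall>x\<in>carrier M. f (a \<odot>\<^bsub>M\<^esub> x) = a \<odot>\<^bsub>N\<^esub> f x}"

definition matrix_ring :: "'a ring \<Rightarrow> ('n::finite \<Rightarrow> 'n \<Rightarrow> 'a) ring" where
  "matrix_ring R = \<lparr>carrier = {A. \<forall>i j. A i j \<in> carrier R},
     mult = (\<lambda>A B i j. \<Oplus>\<^bsub>R\<^esub>k\<in>UNIV. A i k \<otimes>\<^bsub>R\<^esub> B k j),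
     one = (\<lambda>i j. if i = j then \<one>\<^bsub>R\<^esub> else \<zero>\<^bsub>R\<^esub>),
     zero = (\<lambda>i j. \<zero>\<^bsub>R\<^esub>),
     add = (\<lambda>A B i j. A i j \<oplus>\<^bsub>R\<^esub> B i j)\<rparr>"

definition column_module :: "'a ring \<Rightarrow> ('n::finite \<Rightarrow> 'n \<Rightarrow> 'a, 'n \<Rightarrow> 'a) module" where
  "column_module R = \<lparr>carrier = {v. \<forall>i. v i \<in> carrier R}, mult = undefined, one = undefined,
     zero = (\<lambda>i. \<zero>\<^bsub>R\<^esub>),
     add = (\<lambda>v w i. v i \<oplus>\<^bsub>R\<^esub> w i),
     smult = (\<lambda>A v i. \<Oplus>\<^bsub>R\<^esub>k\<in>UNIV. A i k \<otimes>\<^bsub>R\<^esub> v k)\<rparr>"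

definition quat_ring :: "quat ring" where
  "quat_ring = \<lparr>carrier = UNIV, mult = (*), one = 1, zero = 0, add = (+)\<rparr>"

definition hurwitz_ring :: "quat ring" where
  "hurwitz_ring = quat_ring\<lparr>carrier := hurwitz\<rparr>"

text \<open>A vector of quaternions of length \<open>t\<close> is a function that is \<open>undefined\<close> outside \<open>{..<t}\<close>,
  as in the product measure \<open>PiM {..<t}\<close> used for volumes.\<close>

abbreviation quat_space :: "nat \<Rightarrow> (quat, nat \<Rightarrow> quat) module" where
  "quat_space t \<equiv> power_module (left_regular quat_ring) t"

abbreviation hurwitz_power :: "nat \<Rightarrow> (quat, nat \<Rightarrow> quat) module" where
  "hurwitz_power t \<equiv> power_module (left_regular hurwitz_ring) t"

definition vec_norm :: "nat \<Rightarrow> (nat \<Rightarrow> quat) \<Rightarrow> real" where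
  "vec_norm t x = sqrt (\<Sum>i<t. quat_trace (quat_cnj (x i) * x i))"

lemma quat_trace_cnj_times: "quat_trace (quat_cnj x * x) = 4 * (norm x)\<^sup>2"
proof -
  have "quat_trace y = 4 * quat_re y" for y
    by (simp add: quat_trace_def Basis_quat_def times_quat_def inner_quat_def)
  then show ?thesis
    by (simp add: quat_cnj_def times_quat_def norm_quat_def inner_quat_def)
qed

definition vec_cball :: "nat \<Rightarrow> real \<Rightarrow> (nat \<Rightarrow> quat) set" where
  "vec_cball t \<rho> = {x \<in> carrier (quat_space t). vec_norm t x \<le> \<rho>}"

text \<open>By \<open>quat_trace_cnj_times\<close> the norm is twice the standard norm of real \<open>4 * t\<close>-space, so the volume it induces
  is \<open>2 ^ (4 * t) = 16 ^ t\<close> times the standard Lebesgue measure.\<close>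

definition vec_vol :: "nat \<Rightarrow> (nat \<Rightarrow> quat) set \<Rightarrow> real" where
  "vec_vol t A = 16 ^ t * measure (PiM {..<t} (\<lambda>_. lborel)) A"

definition is_lattice :: "nat \<Rightarrow> (nat \<Rightarrow> quat) set \<Rightarrow> bool"
  \<comment> \<open>the integer span of a real basis; \<open>4 * t\<close> independent vectors form a basis\<close>
  where "is_lattice t \<Lambda> \<longleftrightarrow> (\<exists>b :: nat \<Rightarrow> nat \<Rightarrow> quat.
    (\<forall>c :: nat \<Rightarrow> real. (\<forall>i<t. (\<Sum>k<4*t. c k *\<^sub>R b k i) = 0) \<longrightarrow> (\<forall>k<4*t. c k = 0)) \<and>
    \<Lambda> = {\<lambda>i\<in>{..<t}. \<Sum>k<4*t. of_int (n k) *\<^sub>R b k i | n :: nat \<Rightarrow> int. True})"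

definition fundamental_domain :: "nat \<Rightarrow> (nat \<Rightarrow> quat) set \<Rightarrow> (nat \<Rightarrow> quat) set \<Rightarrow> bool" where
  "fundamental_domain t \<Lambda> F \<longleftrightarrow> F \<in> sets (PiM {..<t} (\<lambda>_. lborel)) \<and>
    (\<forall>x\<in>carrier (quat_space t). \<exists>!v. v \<in> \<Lambda> \<and> (\<lambda>i\<in>{..<t}. x i - v i) \<in> F)"

definition covolume :: "nat \<Rightarrow> (nat \<Rightarrow> quat) set \<Rightarrow> real" where
  "covolume t \<Lambda> = (THE v. \<exists>F. fundamental_domain t \<Lambda> F \<and> v = vec_vol t F)"

definition free_hurwitz_module :: "nat \<Rightarrow> (nat \<Rightarrow> quat) set \<Rightarrow> bool" where
  "free_hurwitz_module t \<Lambda> \<longleftrightarrow> submodule \<Lambda> hurwitz_ring (quat_space t) \<and>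
    left_module_iso hurwitz_ring (hurwitz_power t) (quat_space t\<lparr>carrier := \<Lambda>\<rparr>) \<noteq> {}"

definition left_independent :: "nat \<Rightarrow> nat \<Rightarrow> (nat \<Rightarrow> nat \<Rightarrow> quat) \<Rightarrow> bool" where
  "left_independent t j v \<longleftrightarrow>
    (\<forall>c :: nat \<Rightarrow> quat. (\<forall>i<t. (\<Sum>k<j. c k * v k i) = 0) \<longrightarrow> (\<forall>k<j. c k = 0))"

text \<open>For a lattice and \<open>1 \<le> j \<le> t\<close> the smallest radius exists by discreteness, so \<open>LEAST\<close> on the reals
  is meaningful.\<close>

definition quat_minimum :: "nat \<Rightarrow> nat \<Rightarrow> (nat \<Rightarrow> quat) set \<Rightarrow> real" where
  "quat_minimum t j \<Lambda> = (LEAST \<rho>. \<exists>v. (\<forall>k<j. v k \<in> \<Lambda> \<inter> vec_cball t \<rho>) \<and> left_independent t j v)"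

definition mat2_mod :: "nat \<Rightarrow> (2 \<Rightarrow> 2 \<Rightarrow> int) ring" where
  "mat2_mod p = matrix_ring (residue_ring (int p))"

definition p_ideal :: "nat \<Rightarrow> quat set" where
  "p_ideal p = {of_nat p * x | x. x \<in> hurwitz}"

text \<open>Below, \<open>\<sigma>\<close> is a ring isomorphism from \<open>hurwitz_ring Quot p_ideal p\<close> onto
  \<open>mat2_mod p\<close>. The lifts do not depend on its choice, since ring automorphisms of \<open>mat2_mod p\<close>
  preserve the set of submodules in \<open>codes p t k\<close>. The factor \<open>p powr ((1 - t) / (2 * t))\<close>
  gives every lift the covolume of \<open>hurwitz_power t\<close>.\<close>

definition reduction :: "(quat set \<Rightarrow> 2 \<Rightarrow> 2 \<Rightarrow> int) \<Rightarrow> nat \<Rightarrow> nat \<Rightarrow> (nat \<Rightarrow> quat) \<Rightarrow> nat \<Rightarrow> 2 \<Rightarrow> 2 \<Rightarrow> int" where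
  "reduction \<sigma> p t x = (\<lambda>i\<in>{..<t}. \<sigma> (p_ideal p +>\<^bsub>hurwitz_ring\<^esub> x i))"

definition codes :: "nat \<Rightarrow> nat \<Rightarrow> nat \<Rightarrow> (nat \<Rightarrow> 2 \<Rightarrow> 2 \<Rightarrow> int) set set" where
  "codes p t k = {C. submodule C (mat2_mod p) (power_module (left_regular (mat2_mod p)) t) \<and>
    left_module_iso (mat2_mod p)
      (power_module (left_regular (mat2_mod p)) t\<lparr>carrier := C\<rparr>)
      (power_module (column_module (residue_ring (int p))) k) \<noteq> {}}"

definition lifts :: "(quat set \<Rightarrow> 2 \<Rightarrow> 2 \<Rightarrow> int) \<Rightarrow> nat \<Rightarrow> nat \<Rightarrow> (nat \<Rightarrow> quat) set set" where
  "lifts \<sigma> p t = {(\<lambda>x. \<lambda>i\<in>{..<t}. (real p powr ((1 - real t) / (2 * real t))) *\<^sub>R x i) `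
      {x \<in> carrier (hurwitz_power t). reduction \<sigma> p t x \<in> C} | C. C \<in> codes p t (t + 1)}"

definition zeta_nat :: "nat \<Rightarrow> real" where
  "zeta_nat s = (\<Sum>n. 1 / real (Suc n) ^ s)"

end

theory Submission
  imports Defs
begin

text \<open>Nothing fixes the covolume of the lattice, so whenever it need not be a lift, a large multiple of
  the standard lattice will do. For the lifts, let \<open>f\<close> be the function of the norm that equals
  \<open>1 / t - 4 ln (N / r)\<close>, cut off to the interval from 0 to 1. Its integral over space is
  \<open>Vol (B(r)) e (1 - exp (-t)) / t\<close>, as one sees by integrating over its level sets, and the average over
  codes of the sum of \<open>f\<close> over the nonzero vectors of a lift is asymptotically at most this integral divided by
  the covolume, hence less than 24. (As \<open>\<zeta>(4 t)\<close> tends to 1, the restriction to primitive vectors can be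
  dropped at the cost of \<open>\<epsilon>\<close>.) On the other hand, vectors that attain the minima are independent and
  contribute with all their 24 unit multiples; if the geometric mean of the minima were at most \<open>r\<close>,
  then these would contribute at least \<open>24 (1 - 4 ln (\<Prod> min\<^sub>j / r ^ t)) \<ge> 24\<close>.

  In the average, a vector whose reduction has rank 2 lies in a code with probability at most
  \<open>p ^ (-2 (t - 1))\<close>, which is the density of the lifts. Vectors of rank 1 lie in one of at most \<open>p\<^sup>2\<close>
  lattices \<open>I ^ t\<close>, where the nonzero elements of the right ideal \<open>I\<close> have norm at least \<open>sqrt p\<close>, so packing
  bounds their number by \<open>p\<^sup>2 L ^ t\<close>, which is negligible against the probability \<open>p ^ (-(t - 1))\<close>. Nonzero
  vectors of rank 0 are too long to matter.\<close>

section \<open>Quaternions and Hurwitz integers\<close>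

text \<open>The growth condition on \<open>p\<close> enters at one point. Before scaling by
  \<open>s = lift_scale p t\<close>, which is p^(-1/2) up to a factor p^(1/(2t)), the relevant
  vectors are Hurwitz vectors of norm at most \<open>level / s\<close>, and they are counted by the
  volume of a ball enlarged by \<open>4 * sqrt t\<close>. As \<open>r\<close> is of order
  \<open>sqrt t\<close>, the radius grows by a relative amount of order \<open>s\<close>, which the
  dimension \<open>4 * t\<close> turns into a factor \<open>exp (32 * (t * s) / a)\<close>. This
  tends to 1 because t^2 = o(p) makes t s tend to 0. The loss of \<open>\<epsilon>\<close> pays for
  this factor, for the zeta value and for the exponentially small share of rank 1. The minima are
  compared with the weights level by level: a weight is an integral over levels from 0 to 1, and at
  each level the number of minima below it is compared with the number of lattice vectors below it.
  The cut of the weight at 1 is harmless, for when the sum over the lattice is less than 24, each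
  minimum has weight less than 1, and its weight is then bounded below by the uncut
  logarithm.\<close>

lemma quat_sel_simps [simp]:
  "quat_re 0 = 0" "quat_i 0 = 0" "quat_j 0 = 0" "quat_k 0 = 0"
  "quat_re 1 = 1" "quat_i 1 = 0" "quat_j 1 = 0" "quat_k 1 = 0"
  "quat_re (x + y) = quat_re x + quat_re y" "quat_i (x + y) = quat_i x + quat_i y"
  "quat_j (x + y) = quat_j x + quat_j y" "quat_k (x + y) = quat_k x + quat_k y"
  "quat_re (x - y) = quat_re x - quat_re y" "quat_i (x - y) = quat_i x - quat_i y"
  "quat_j (x - y) = quat_j x - quat_j y" "quat_k (x - y) = quat_k x - quat_k y"
  "quat_re (- x) = - quat_re x" "quat_i (- x) = - quat_i x"
  "quat_j (- x) = - quat_j x" "quat_k (- x) = - quat_k x"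
  "quat_re (c *\<^sub>R x) = c * quat_re x" "quat_i (c *\<^sub>R x) = c * quat_i x"
  "quat_j (c *\<^sub>R x) = c * quat_j x" "quat_k (c *\<^sub>R x) = c * quat_k x"
  by (simp_all add: zero_quat_def one_quat_def plus_quat_def uminus_quat_def
      minus_quat_def scaleR_quat_def)

lemma quat_times_sel:
  "quat_re (x * y) = quat_re x * quat_re y - quat_i x * quat_i y - quat_j x * quat_j y - quat_k x * quat_k y"
  "quat_i (x * y) = quat_re x * quat_i y + quat_i x * quat_re y + quat_j x * quat_k y - quat_k x * quat_j y"
  "quat_j (x * y) = quat_re x * quat_j y - quat_i x * quat_k y + quat_j x * quat_re y + quat_k x * quat_i y"
  "quat_k (x * y) = quat_re x * quat_k y + quat_i x * quat_j y - quat_j x * quat_i y + quat_k x * quat_re y"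
  by (simp_all add: times_quat_def)

lemma quat_norm_sq: "(norm x)\<^sup>2 = (quat_re x)\<^sup>2 + (quat_i x)\<^sup>2 + (quat_j x)\<^sup>2 + (quat_k x)\<^sup>2" for x :: quat
  by (simp only: power2_norm_eq_inner inner_quat_def) (simp add: power2_eq_square)

text \<open>After squaring this is Euler's four-square identity, a polynomial identity in the eight
  coordinates.\<close>

lemma quat_norm_mult: "norm (x * y) = norm x * norm y" for x y :: quat
proof -
  have "(norm (x * y))\<^sup>2 = (norm x * norm y)\<^sup>2"
    unfolding power_mult_distrib quat_norm_sq quat_times_sel
    by (simp add: power2_eq_square algebra_simps)
  then show ?thesis by (simp add: power2_eq_iff_nonneg)
qed

lemma quat_mult_eq_0_iff: "x * y = 0 \<longleftrightarrow> x = 0 \<or> y = 0" for x y :: quat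
  by (metis mult_eq_0_iff norm_eq_zero quat_norm_mult)

lemma quat_cnj_mult: "quat_cnj x * x = of_real ((norm x)\<^sup>2)" "x * quat_cnj x = of_real ((norm x)\<^sup>2)"
  by (simp_all add: quat_eq_iff quat_times_sel of_real_def quat_cnj_def
      quat_norm_sq)
    (simp_all add: power2_eq_square)

lemma of_int_times_quat: "of_int a * x = real_of_int a *\<^sub>R x" for x :: quat
  by (metis of_real_of_int_eq scaleR_conv_of_real)

text \<open>The generator 1 is redundant: with w = (1 + i + j + k) / 2 it equals 2 w - i - j - k.
  Hence w, i, j, k form an integral basis, and \<open>e\<close>, \<open>b\<close>, \<open>c\<close>,
  \<open>d\<close> are the coordinates in it; \<open>e\<close> is twice the real part.\<close>

lemma hurwitz_iff:
  "x \<in> hurwitz \<longleftrightarrow> (\<exists>e b c d. x = Quat (of_int e/2) (of_int e/2 + of_int b) (of_int e/2 + of_int c) (of_int e/2 + of_int d))"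
proof
  assume "x \<in> hurwitz"
  then obtain a b c d e :: int where "x = of_int a * Quat 1 0 0 0 + of_int b * Quat 0 1 0 0
    + of_int c * Quat 0 0 1 0 + of_int d * Quat 0 0 0 1 + of_int e * Quat (1/2) (1/2) (1/2) (1/2)"
    unfolding hurwitz_def by blast
  then have "x = Quat ((2*a+e)/2) ((2*a+e)/2 + (b-a)) ((2*a+e)/2 + (c-a)) ((2*a+e)/2 + (d-a))"
    by (simp add: quat_eq_iff of_int_times_quat field_simps)
  then show "\<exists>e b c d. x = Quat (of_int e/2) (of_int e/2 + of_int b) (of_int e/2 + of_int c) (of_int e/2 + of_int d)"
    by (intro exI[of _ "2*a+e"] exI[of _ "b-a"] exI[of _ "c-a"] exI[of _ "d-a"]) simp
next
  assume "\<exists>e b c d. x = Quat (of_int e/2) (of_int e/2 + of_int b) (of_int e/2 + of_int c) (of_int e/2 + of_int d)"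
  then obtain e b c d :: int where "x = Quat (e/2) (e/2 + b) (e/2 + c) (e/2 + d)" by blast
  then have "x = of_int 0 * Quat 1 0 0 0 + of_int b * Quat 0 1 0 0
    + of_int c * Quat 0 0 1 0 + of_int d * Quat 0 0 0 1 + of_int e * Quat (1/2) (1/2) (1/2) (1/2)"
    by (simp add: quat_eq_iff of_int_times_quat)
  then show "x \<in> hurwitz" unfolding hurwitz_def by blast
qed

lemma hurwitz_0 [simp]: "0 \<in> hurwitz"
  unfolding hurwitz_iff by (intro exI[of _ 0]) (simp add: quat_eq_iff)

lemma hurwitz_1 [simp]: "1 \<in> hurwitz"
  unfolding hurwitz_iff by (intro exI[of _ 2] exI[of _ "-1"]) (simp add: quat_eq_iff)

lemma hurwitz_add [simp]: "x \<in> hurwitz \<Longrightarrow> y \<in> hurwitz \<Longrightarrow> x + y \<in> hurwitz"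
proof -
  assume "x \<in> hurwitz" "y \<in> hurwitz"
  then obtain e b c d e' b' c' d' :: int where
    "x = Quat (e/2) (e/2 + b) (e/2 + c) (e/2 + d)" "y = Quat (e'/2) (e'/2 + b') (e'/2 + c') (e'/2 + d')"
    unfolding hurwitz_iff by blast
  then show ?thesis unfolding hurwitz_iff
    by (intro exI[of _ "e+e'"] exI[of _ "b+b'"] exI[of _ "c+c'"] exI[of _ "d+d'"])
      (simp add: quat_eq_iff field_simps)
qed

lemma hurwitz_uminus [simp]: "x \<in> hurwitz \<Longrightarrow> - x \<in> hurwitz"
proof -
  assume "x \<in> hurwitz"
  then obtain e b c d :: int where
    "x = Quat (e/2) (e/2 + b) (e/2 + c) (e/2 + d)"
    unfolding hurwitz_iff by blast
  then show ?thesis unfolding hurwitz_iff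
    by (intro exI[of _ "-e"] exI[of _ "-b"] exI[of _ "-c"] exI[of _ "-d"])
      (simp add: quat_eq_iff field_simps)
qed

lemma hurwitz_diff [simp]: "x \<in> hurwitz \<Longrightarrow> y \<in> hurwitz \<Longrightarrow> x - y \<in> hurwitz"
  using hurwitz_add[of x "- y"] by simp

lemma hurwitz_mult [simp]: "x \<in> hurwitz \<Longrightarrow> y \<in> hurwitz \<Longrightarrow> x * y \<in> hurwitz"
proof -
  assume "x \<in> hurwitz" "y \<in> hurwitz"
  then obtain e b c d e' b' c' d' :: int where
    xy: "x = Quat (e/2) (e/2 + b) (e/2 + c) (e/2 + d)" "y = Quat (e'/2) (e'/2 + b') (e'/2 + c') (e'/2 + d')"
    unfolding hurwitz_iff by blast
  \<comment> \<open>Coordinates of the product in the basis w, i, j, k: \<open>E\<close> is twice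
    its real part, while \<open>B\<close>, \<open>C\<close>, \<open>D\<close> are the differences
    between its other components and the real part.\<close>
  define E :: int where "E = - (e*e' + e*(b'+c'+d') + e'*(b+c+d) + 2*(b*b'+c*c'+d*d'))"
  define B :: int where "B = e*e' + e*(b'+d') + e'*(b+c) + (b*b'+c*c'+d*d') + c*d' - d*c'"
  define C :: int where "C = e*e' + e*(c'+b') + e'*(c+d) + (b*b'+c*c'+d*d') + d*b' - b*d'"
  define D :: int where "D = e*e' + e*(d'+c') + e'*(d+b) + (b*b'+c*c'+d*d') + b*c' - c*b'"
  obtain h h' :: real where h: "real_of_int e = 2 * h" "real_of_int e' = 2 * h'"
    by (metis field_sum_of_halves mult_2)
  have "x * y = Quat (E/2) (E/2 + B) (E/2 + C) (E/2 + D)"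
    unfolding quat_eq_iff quat_times_sel xy E_def B_def C_def D_def
    by (simp add: h) (simp add: field_simps)
  then show ?thesis unfolding hurwitz_iff by blast
qed

lemma hurwitz_cnj [simp]: "x \<in> hurwitz \<Longrightarrow> quat_cnj x \<in> hurwitz"
proof -
  assume "x \<in> hurwitz"
  then obtain e b c d :: int where
    "x = Quat (e/2) (e/2 + b) (e/2 + c) (e/2 + d)"
    unfolding hurwitz_iff by blast
  then show ?thesis unfolding hurwitz_iff
    by (intro exI[of _ "e"] exI[of _ "-b-e"] exI[of _ "-c-e"] exI[of _ "-d-e"])
      (simp add: quat_eq_iff quat_cnj_def field_simps)
qed

lemma hurwitz_of_nat [simp]: "of_nat n \<in> hurwitz"
  by (induction n) auto

text \<open>In the basis of \<open>hurwitz_iff\<close> the four copies of e^2 / 4 add up to e^2, so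
  the norm form has integer coefficients.\<close>

lemma hurwitz_norm_sq_nat:
  assumes "x \<in> hurwitz"
  obtains n :: nat where "(norm x)\<^sup>2 = real n"
proof -
  obtain e b c d :: int where x: "x = Quat (e/2) (e/2 + b) (e/2 + c) (e/2 + d)"
    using assms unfolding hurwitz_iff by blast
  define m where "m = e*e + e*(b+c+d) + b*b+c*c+d*d"
  have m: "(norm x)\<^sup>2 = real_of_int m"
    unfolding quat_norm_sq x m_def by (simp add: power2_eq_square field_simps)
  then have "m \<ge> 0" by (metis of_int_0_le_iff zero_le_power2)
  with m that[of "nat m"] show ?thesis by simp
qed

lemma hurwitz_norm_ge_1:
  assumes "x \<in> hurwitz" "x \<noteq> 0"
  shows "norm x \<ge> 1"
proof -
  obtain n :: nat where n: "(norm x)\<^sup>2 = real n" using hurwitz_norm_sq_nat assms by blast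
  with assms have "n > 0" by (cases n) auto
  with n have "(norm x)\<^sup>2 \<ge> 1\<^sup>2" by simp
  then show ?thesis using power2_le_imp_le norm_ge_zero by blast
qed

text \<open>Rounding the coordinates fails to give distance less than 1 only at the centres of the unit
  cubes, which are themselves Hurwitz integers.\<close>

lemma hurwitz_round: "\<exists>q\<in>hurwitz. norm (x - q) < 1"
proof -
  define a b c d where "a = round (quat_re x)" "b = round (quat_i x)"
    "c = round (quat_j x)" "d = round (quat_k x)"
  define q where "q = Quat a b c d"
  have q: "q \<in> hurwitz" unfolding hurwitz_iff q_def
    by (intro exI[of _ "2*a"] exI[of _ "b-a"] exI[of _ "c-a"] exI[of _ "d-a"]) simp
  have half: "\<bar>y - round y\<bar> \<le> 1/2" for y :: real
    using of_int_round_abs_le[of y] by (simp add: abs_minus_commute)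
  have sq: "(y - round y)\<^sup>2 \<le> 1/4" for y :: real
    using power_mono[OF half[of y], of 2] by (simp add: power2_eq_square)
  have nn: "(norm (x - q))\<^sup>2 = (quat_re x - a)\<^sup>2 + (quat_i x - b)\<^sup>2 + (quat_j x - c)\<^sup>2 + (quat_k x - d)\<^sup>2"
    by (simp add: quat_norm_sq q_def)
  note s = sq[of "quat_re x"] sq[of "quat_i x"] sq[of "quat_j x"] sq[of "quat_k x"]
  show ?thesis
  proof (cases "norm (x - q) < 1")
    case True
    with q show ?thesis by blast
  next
    case False
    then have "(norm (x - q))\<^sup>2 \<ge> 1" by simp
    with nn s have eq: "(quat_re x - a)\<^sup>2 = 1/4" "(quat_i x - b)\<^sup>2 = 1/4" "(quat_j x - c)\<^sup>2 = 1/4"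
      "(quat_k x - d)\<^sup>2 = 1/4"
      unfolding a_b_c_d_def by linarith+
    have int: "\<exists>m::int. y = m + 1/2" if "(y - of_int z)\<^sup>2 = 1/4" for y :: real and z :: int
    proof -
      have "(y - of_int z)\<^sup>2 = (1/2)\<^sup>2" using that by (simp add: power2_eq_square)
      then consider "y - of_int z = 1/2" | "y - of_int z = - (1/2)" by (meson power2_eq_iff)
      then show ?thesis
      proof cases
        case 1 then show ?thesis by (intro exI[of _ z]) simp
      next
        case 2 then show ?thesis by (intro exI[of _ "z-1"]) simp
      qed
    qed
    obtain m1 m2 m3 m4 :: int where "quat_re x = m1 + 1/2" "quat_i x = m2 + 1/2"
      "quat_j x = m3 + 1/2" "quat_k x = m4 + 1/2" using eq[THEN int] by blast
    then have "x \<in> hurwitz" unfolding hurwitz_iff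
      by (intro exI[of _ "2*m1+1"] exI[of _ "m2-m1"] exI[of _ "m3-m1"] exI[of _ "m4-m1"])
        (simp add: quat_eq_iff field_simps)
    then show ?thesis by (intro bexI[of _ x]) simp_all
  qed
qed

text \<open>Round x g^(-1) to a nearby Hurwitz integer. The quotient stands on the left of
  \<open>g\<close>, so that the remainder stays in every left ideal containing \<open>x\<close> and
  \<open>g\<close>.\<close>

lemma hurwitz_division:
  assumes "g \<noteq> 0"
  shows "\<exists>q\<in>hurwitz. norm (x - q * g) < norm g"
proof -
  define y where "y = (1 / (norm g)\<^sup>2) *\<^sub>R (x * quat_cnj g)"
  have y: "y * g = x"
    using assms by (simp add: y_def mult.assoc quat_cnj_mult of_real_def)
  obtain q where q: "q \<in> hurwitz" "norm (y - q) < 1" using hurwitz_round by blast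
  have "norm (x - q * g) = norm (y - q) * norm g"
    by (metis y left_diff_distrib quat_norm_mult)
  also have "\<dots> < norm g" using q assms by simp
  finally show ?thesis using q by blast
qed

text \<open>The Euclidean argument: an element of minimal nonzero norm divides all others on the
  right, since a nonzero remainder would be shorter. The minimum exists because squared norms of
  Hurwitz integers are natural numbers.\<close>

lemma hurwitz_left_ideal_principal:
  assumes I: "I \<subseteq> hurwitz" "a \<in> I" "a \<noteq> 0"
    and diff: "\<And>x y. x \<in> I \<Longrightarrow> y \<in> I \<Longrightarrow> x - y \<in> I"
    and mult: "\<And>c x. c \<in> hurwitz \<Longrightarrow> x \<in> I \<Longrightarrow> c * x \<in> I"
  obtains g where "g \<in> I" "g \<noteq> 0" "I = {c * g | c. c \<in> hurwitz}"
proof -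
  \<comment> \<open>The floor makes \<open>\<mu>\<close> natural-valued for \<open>arg_min\<close>;
    on \<open>I\<close> it is the exact squared norm.\<close>
  define \<mu> where "\<mu> x = nat \<lfloor>(norm x)\<^sup>2\<rfloor>" for x :: quat
  have \<mu>: "(norm x)\<^sup>2 = real (\<mu> x)" if "x \<in> I" for x
    using hurwitz_norm_sq_nat[of x] that I unfolding \<mu>_def
    by (metis floor_of_nat nat_int subsetD)
  define g where "g = arg_min \<mu> (\<lambda>x. x \<in> I \<and> x \<noteq> 0)"
  have g: "g \<in> I" "g \<noteq> 0" and least: "\<And>x. x \<in> I \<Longrightarrow> x \<noteq> 0 \<Longrightarrow> \<mu> g \<le> \<mu> x"
    using arg_min_nat_lemma[of "\<lambda>x. x \<in> I \<and> x \<noteq> 0" a \<mu>] I unfolding g_def by auto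
  have "x \<in> {c * g | c. c \<in> hurwitz}" if x: "x \<in> I" for x
  proof -
    obtain q where q: "q \<in> hurwitz" "norm (x - q * g) < norm g"
      using hurwitz_division g by blast
    have m: "x - q * g \<in> I" using x q g diff mult by blast
    have "x - q * g = 0"
    proof (rule ccontr)
      assume "x - q * g \<noteq> 0"
      then have "real (\<mu> g) \<le> real (\<mu> (x - q * g))" using least m by simp
      then have "(norm g)\<^sup>2 \<le> (norm (x - q * g))\<^sup>2" using \<mu> m g by simp
      then have "norm g \<le> norm (x - q * g)" by (rule power2_le_imp_le) simp
      with q show False by simp
    qed
    with q show ?thesis by auto
  qed
  with that[of g] g mult show ?thesis by blast
qed

definition hurwitz_units :: "quat set" where
  "hurwitz_units = {u \<in> hurwitz. norm u = 1}"

lemma card_hurwitz_units_ge: "\<exists>U. U \<subseteq> hurwitz_units \<and> finite U \<and> card U = 24"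
proof -
  define f :: "int \<times> int \<times> int \<times> int \<Rightarrow> quat" where
    "f = (\<lambda>(e, b, c, d). Quat (real_of_int e/2) (real_of_int e/2 + b) (real_of_int e/2 + c) (real_of_int e/2 + d))"
  \<comment> \<open>Coordinates in the basis w, i, j, k. The entries with \<open>e\<close> even are
    plus and minus 1, i, j, k; those with \<open>e\<close> odd are the sixteen elements with all
    components 1/2 or -1/2.\<close>
  define L :: "(int \<times> int \<times> int \<times> int) list" where
    "L = [(2,-1,-1,-1),(-2,1,1,1),(0,1,0,0),(0,-1,0,0),(0,0,1,0),(0,0,-1,0),(0,0,0,1),(0,0,0,-1),
      (1,0,0,0),(1,-1,0,0),(1,0,-1,0),(1,0,0,-1),(1,-1,-1,0),(1,-1,0,-1),(1,0,-1,-1),(1,-1,-1,-1),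
      (-1,0,0,0),(-1,1,0,0),(-1,0,1,0),(-1,0,0,1),(-1,1,1,0),(-1,1,0,1),(-1,0,1,1),(-1,1,1,1)]"
  have inj: "inj_on f A" for A
    by (rule inj_onI) (auto simp: f_def)
  have "distinct L" unfolding L_def by simp
  then have "card (set L) = 24" using distinct_card[of L] by (simp add: L_def)
  then have card: "card (f ` set L) = 24" by (simp add: card_image inj)
  have h: "f z \<in> hurwitz" for z
    unfolding hurwitz_iff f_def by (auto split: prod.splits)
  have "norm (f z) = 1" if "z \<in> set L" for z
  proof -
    have "(norm (f z))\<^sup>2 = 1"
      using that unfolding quat_norm_sq L_def f_def by (auto simp: power2_eq_square)
    then show ?thesis by (simp add: power2_eq_1_iff) (metis norm_ge_zero not_one_le_zero neg_0_le_iff_le)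
  qed
  with h card show ?thesis unfolding hurwitz_units_def
    by (intro exI[of _ "f ` set L"]) auto
qed

section \<open>Lattices spanned by a quaternionic basis\<close>

lemma quat_space_sel:
  "carrier (quat_space t) = {..<t} \<rightarrow>\<^sub>E UNIV"
  "x \<oplus>\<^bsub>quat_space t\<^esub> y = (\<lambda>i\<in>{..<t}. x i + y i)"
  "\<zero>\<^bsub>quat_space t\<^esub> = (\<lambda>i\<in>{..<t}. 0)"
  "a \<odot>\<^bsub>quat_space t\<^esub> x = (\<lambda>i\<in>{..<t}. a * x i)"
  by (simp_all add: power_module_def left_regular_def quat_ring_def)

lemma hurwitz_power_sel:
  "carrier (hurwitz_power t) = {..<t} \<rightarrow>\<^sub>E hurwitz"
  "x \<oplus>\<^bsub>hurwitz_power t\<^esub> y = (\<lambda>i\<in>{..<t}. x i + y i)"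
  "a \<odot>\<^bsub>hurwitz_power t\<^esub> x = (\<lambda>i\<in>{..<t}. a * x i)"
  by (simp_all add: power_module_def left_regular_def quat_ring_def hurwitz_ring_def)

lemma quat_space_group: "group (add_monoid (quat_space t))"
proof (rule groupI)
  fix x y z
  assume "x \<in> carrier (add_monoid (quat_space t))" "y \<in> carrier (add_monoid (quat_space t))"
    "z \<in> carrier (add_monoid (quat_space t))"
  show "x \<otimes>\<^bsub>add_monoid (quat_space t)\<^esub> y \<otimes>\<^bsub>add_monoid (quat_space t)\<^esub> z =
    x \<otimes>\<^bsub>add_monoid (quat_space t)\<^esub> (y \<otimes>\<^bsub>add_monoid (quat_space t)\<^esub> z)"
    by (simp add: quat_space_sel add.assoc cong: restrict_cong)
next
  fix x assume x: "x \<in> carrier (add_monoid (quat_space t))"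
  then have restr: "restrict x {..<t} = x"
    by (simp add: quat_space_sel PiE_iff extensional_restrict)
  then show "\<one>\<^bsub>add_monoid (quat_space t)\<^esub> \<otimes>\<^bsub>add_monoid (quat_space t)\<^esub> x = x"
    by (simp add: quat_space_sel cong: restrict_cong)
  show "\<exists>y\<in>carrier (add_monoid (quat_space t)). y \<otimes>\<^bsub>add_monoid (quat_space t)\<^esub> x = \<one>\<^bsub>add_monoid (quat_space t)\<^esub>"
    by (rule bexI[of _ "\<lambda>i\<in>{..<t}. - x i"])
      (simp_all add: quat_space_sel restrict_PiE_iff cong: restrict_cong)
qed (simp_all add: quat_space_sel restrict_PiE_iff)

lemma quat_space_inv:
  assumes "x \<in> carrier (quat_space t)"
  shows "inv\<^bsub>add_monoid (quat_space t)\<^esub> x = (\<lambda>i\<in>{..<t}. - x i)"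
proof (rule group.inv_equality[OF quat_space_group])
  show "(\<lambda>i\<in>{..<t}. - x i) \<otimes>\<^bsub>add_monoid (quat_space t)\<^esub> x = \<one>\<^bsub>add_monoid (quat_space t)\<^esub>"
    by (simp add: quat_space_sel cong: restrict_cong)
qed (use assms in \<open>simp_all add: quat_space_sel restrict_PiE_iff\<close>)

definition hurwitz_span :: "nat \<Rightarrow> (nat \<Rightarrow> nat \<Rightarrow> quat) \<Rightarrow> (nat \<Rightarrow> quat) set" where
  "hurwitz_span t b = {\<lambda>i\<in>{..<t}. \<Sum>k<t. c k * b k i | c. \<forall>k<t. c k \<in> hurwitz}"

lemma hurwitz_spanI:
  "(\<And>k. k < t \<Longrightarrow> c k \<in> hurwitz) \<Longrightarrow> (\<lambda>i\<in>{..<t}. \<Sum>k<t. c k * b k i) \<in> hurwitz_span t b"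
  unfolding hurwitz_span_def by blast

lemma hurwitz_spanE:
  assumes "x \<in> hurwitz_span t b"
  obtains c where "\<forall>k<t. c k \<in> hurwitz" "x = (\<lambda>i\<in>{..<t}. \<Sum>k<t. c k * b k i)"
  using assms unfolding hurwitz_span_def by blast

lemma hurwitz_span_smult:
  assumes "a \<in> hurwitz" "x \<in> hurwitz_span t b"
  shows "(\<lambda>i\<in>{..<t}. a * x i) \<in> hurwitz_span t b"
proof -
  obtain c where c: "\<forall>k<t. c k \<in> hurwitz" "x = (\<lambda>i\<in>{..<t}. \<Sum>k<t. c k * b k i)"
    using assms(2) by (rule hurwitz_spanE)
  have "(\<lambda>i\<in>{..<t}. a * x i) = (\<lambda>i\<in>{..<t}. \<Sum>k<t. (a * c k) * b k i)"
    unfolding c(2) by (auto simp: sum_distrib_left mult.assoc intro!: restrict_ext)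
  then show ?thesis using hurwitz_spanI[of t "\<lambda>k. a * c k" b] assms(1) c(1) by simp
qed

lemma hurwitz_span_add:
  assumes "x \<in> hurwitz_span t b" "y \<in> hurwitz_span t b"
  shows "(\<lambda>i\<in>{..<t}. x i + y i) \<in> hurwitz_span t b"
proof -
  obtain c where c: "\<forall>k<t. c k \<in> hurwitz" "x = (\<lambda>i\<in>{..<t}. \<Sum>k<t. c k * b k i)"
    using assms(1) by (rule hurwitz_spanE)
  obtain d where d: "\<forall>k<t. d k \<in> hurwitz" "y = (\<lambda>i\<in>{..<t}. \<Sum>k<t. d k * b k i)"
    using assms(2) by (rule hurwitz_spanE)
  have "(\<lambda>i\<in>{..<t}. x i + y i) = (\<lambda>i\<in>{..<t}. \<Sum>k<t. (c k + d k) * b k i)"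
    unfolding c(2) d(2) by (auto simp: sum.distrib distrib_right intro!: restrict_ext)
  then show ?thesis using hurwitz_spanI[of t "\<lambda>k. c k + d k" b] c(1) d(1) by simp
qed

lemma hurwitz_span_basis:
  assumes "k < t"
  shows "(\<lambda>i\<in>{..<t}. b k i) \<in> hurwitz_span t b"
proof -
  have "(\<Sum>l<t. (if l = k then 1 else 0) * b l i) = b k i" for i
    using assms by (subst sum.remove[of _ k]) auto
  then show ?thesis
    using hurwitz_spanI[of t "\<lambda>l. if l = k then 1 else 0" b] by simp
qed

lemma hurwitz_span_subset: "hurwitz_span t b \<subseteq> carrier (quat_space t)"
proof
  fix x assume "x \<in> hurwitz_span t b"
  then obtain c where "x = (\<lambda>i\<in>{..<t}. \<Sum>k<t. c k * b k i)"
    unfolding hurwitz_span_def by blast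
  then have "x \<in> {..<t} \<rightarrow>\<^sub>E UNIV" by (simp only: restrict_PiE_iff) simp
  then show "x \<in> carrier (quat_space t)" by (simp only: quat_space_sel)
qed

lemma left_independentD:
  "left_independent t j v \<Longrightarrow> (\<And>i. i < t \<Longrightarrow> (\<Sum>k<j. c k * v k i) = 0) \<Longrightarrow> k < j \<Longrightarrow> c k = 0"
  unfolding left_independent_def by blast

text \<open>The isomorphism is the coefficient map: it is left linear because coefficients multiply
  from the left, onto by the form of the span, and injective by independence.\<close>

lemma hurwitz_span_free:
  assumes b: "left_independent t t b"
  shows "free_hurwitz_module t (hurwitz_span t b)"
  unfolding free_hurwitz_module_def
proof
  show "submodule (hurwitz_span t b) hurwitz_ring (quat_space t)"
  proof (intro submodule.intro subgroup.intro submodule_axioms.intro)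
    show "hurwitz_span t b \<subseteq> carrier (add_monoid (quat_space t))"
      using hurwitz_span_subset by simp
    show "x \<otimes>\<^bsub>add_monoid (quat_space t)\<^esub> y \<in> hurwitz_span t b"
      if "x \<in> hurwitz_span t b" "y \<in> hurwitz_span t b" for x y
      using hurwitz_span_add[OF that] by (simp add: quat_space_sel)
    show "\<one>\<^bsub>add_monoid (quat_space t)\<^esub> \<in> hurwitz_span t b"
      using hurwitz_spanI[of t "\<lambda>_. 0" b] by (simp add: quat_space_sel)
    show "inv\<^bsub>add_monoid (quat_space t)\<^esub> x \<in> hurwitz_span t b" if "x \<in> hurwitz_span t b" for x
      using hurwitz_span_smult[OF hurwitz_uminus[OF hurwitz_1] that] hurwitz_span_subset that
      by (subst quat_space_inv) auto
    show "a \<odot>\<^bsub>quat_space t\<^esub> x \<in> hurwitz_span t b"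
      if "a \<in> carrier hurwitz_ring" "x \<in> hurwitz_span t b" for a x
      using hurwitz_span_smult[of a x] that by (simp add: quat_space_sel hurwitz_ring_def)
  qed
  define f where "f = (\<lambda>c. \<lambda>i\<in>{..<t}. \<Sum>k<t. c k * b k i)"
  have inj: "inj_on f ({..<t} \<rightarrow>\<^sub>E hurwitz)"
  proof (rule inj_onI)
    fix x y assume xy: "x \<in> {..<t} \<rightarrow>\<^sub>E hurwitz" "y \<in> {..<t} \<rightarrow>\<^sub>E hurwitz" "f x = f y"
    have "(\<Sum>k<t. (x k - y k) * b k i) = 0" if "i < t" for i
      using fun_cong[OF xy(3), of i] that
      by (simp add: f_def left_diff_distrib sum_subtractf)
    then have "x k = y k" if "k < t" for k
      using left_independentD[OF b, of "\<lambda>k. x k - y k"] that by simp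
    with xy show "x = y" by (intro PiE_ext) auto
  qed
  have surj: "f ` ({..<t} \<rightarrow>\<^sub>E hurwitz) = hurwitz_span t b"
  proof (intro equalityI subsetI)
    fix x assume "x \<in> hurwitz_span t b"
    then obtain c where c: "\<forall>k<t. c k \<in> hurwitz" "x = (\<lambda>i\<in>{..<t}. \<Sum>k<t. c k * b k i)"
      by (rule hurwitz_spanE)
    then have "x = f (restrict c {..<t})" by (simp add: f_def cong: restrict_cong)
    moreover have "restrict c {..<t} \<in> {..<t} \<rightarrow>\<^sub>E hurwitz" using c by (simp add: restrict_PiE_iff)
    ultimately show "x \<in> f ` ({..<t} \<rightarrow>\<^sub>E hurwitz)" by blast
  next
    fix x assume "x \<in> f ` ({..<t} \<rightarrow>\<^sub>E hurwitz)"
    then obtain c where c: "c \<in> {..<t} \<rightarrow>\<^sub>E hurwitz" "x = f c" by blast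
    then show "x \<in> hurwitz_span t b"
      unfolding f_def using hurwitz_spanI[of t c b] by (simp add: PiE_iff)
  qed
  have "f \<in> iso (add_monoid (hurwitz_power t)) (add_monoid (quat_space t\<lparr>carrier := hurwitz_span t b\<rparr>))"
  proof (rule isoI)
    show "f \<in> hom (add_monoid (hurwitz_power t)) (add_monoid (quat_space t\<lparr>carrier := hurwitz_span t b\<rparr>))"
    proof (rule homI)
      fix x assume "x \<in> carrier (add_monoid (hurwitz_power t))"
      then show "f x \<in> carrier (add_monoid (quat_space t\<lparr>carrier := hurwitz_span t b\<rparr>))"
        using surj by (auto simp: hurwitz_power_sel)
    next
      fix x y
      show "f (x \<otimes>\<^bsub>add_monoid (hurwitz_power t)\<^esub> y)
        = f x \<otimes>\<^bsub>add_monoid (quat_space t\<lparr>carrier := hurwitz_span t b\<rparr>)\<^esub> f y"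
        by (simp add: hurwitz_power_sel quat_space_sel f_def sum.distrib distrib_right cong: restrict_cong)
    qed
    show "bij_betw f (carrier (add_monoid (hurwitz_power t)))
      (carrier (add_monoid (quat_space t\<lparr>carrier := hurwitz_span t b\<rparr>)))"
      using inj surj by (simp add: bij_betw_def hurwitz_power_sel)
  qed
  moreover have "f (a \<odot>\<^bsub>hurwitz_power t\<^esub> x) = a \<odot>\<^bsub>quat_space t\<lparr>carrier := hurwitz_span t b\<rparr>\<^esub> f x" for a x
    by (simp add: hurwitz_power_sel quat_space_sel f_def sum_distrib_left mult.assoc cong: restrict_cong)
  ultimately have "f \<in> left_module_iso hurwitz_ring (hurwitz_power t) (quat_space t\<lparr>carrier := hurwitz_span t b\<rparr>)"
    unfolding left_module_iso_def by simp
  then show "left_module_iso hurwitz_ring (hurwitz_power t) (quat_space t\<lparr>carrier := hurwitz_span t b\<rparr>) \<noteq> {}"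
    by blast
qed

lemma sum_lessThan_mult_4:
  "(\<Sum>n<4*t. f n) = (\<Sum>k<t. f (4*k) + f (4*k+1) + f (4*k+2) + f (4*k+3))" for f :: "nat \<Rightarrow> 'a :: comm_monoid_add"
proof (induction t)
  case (Suc t)
  have "{..<4 * Suc t} = insert (4*t+3) (insert (4*t+2) (insert (4*t+1) (insert (4*t) {..<4*t})))" by auto
  then show ?case using Suc by (simp add: ac_simps)
qed simp

text \<open>Each quaternionic basis vector splits into four real ones, its left multiples by w, i,
  j, k. Real coefficients of these four combine into one quaternionic coefficient
  \<open>q c k\<close>, which runs through the Hurwitz integers when they run through the integers;
  real independence thus follows from quaternionic independence.\<close>

lemma hurwitz_span_lattice:
  assumes b: "left_independent t t b"
  shows "is_lattice t (hurwitz_span t b)"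
proof -
  define w :: "nat \<Rightarrow> quat" where
    "w m = (if m = 0 then Quat (1/2) (1/2) (1/2) (1/2) else if m = 1 then Quat 0 1 0 0
      else if m = 2 then Quat 0 0 1 0 else Quat 0 0 0 1)" for m
  \<comment> \<open>The index \<open>n = 4 * k + m\<close> stands for the \<open>m\<close>-th basis
    element of the order times \<open>b k\<close>.\<close>
  define B where "B n i = w (n mod 4) * b (n div 4) i" for n i
  define q where "q c k = Quat (c (4*k) / 2) (c (4*k) / 2 + c (4*k+1)) (c (4*k) / 2 + c (4*k+2))
    (c (4*k) / 2 + c (4*k+3))" for c :: "nat \<Rightarrow> real" and k :: nat
  have mod4: "(4*k+1) mod 4 = 1" "(4*k+2) mod 4 = 2" "(4*k+3) mod 4 = 3"
    "(4*k+1) div 4 = k" "(4*k+2) div 4 = k" "(4*k+3) div 4 = k" for k :: nat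
    by presburger+
  have q: "q c k = c (4*k) *\<^sub>R w 0 + c (4*k+1) *\<^sub>R w 1 + c (4*k+2) *\<^sub>R w 2 + c (4*k+3) *\<^sub>R w 3" for c k
    by (simp add: q_def w_def quat_eq_iff)
  have sum: "(\<Sum>n<4*t. c n *\<^sub>R B n i) = (\<Sum>k<t. q c k * b k i)" for c i
    unfolding sum_lessThan_mult_4 B_def mod4 q by (simp add: distrib_right)
  show ?thesis
    unfolding is_lattice_def
  proof (intro exI[of _ B] conjI allI impI)
    fix c :: "nat \<Rightarrow> real" and n
    assume c: "\<forall>i<t. (\<Sum>k<4 * t. c k *\<^sub>R B k i) = 0" and n: "n < 4 * t"
    have "q c k = 0" if "k < t" for k
      using left_independentD[OF b, of "q c" k] c that unfolding sum by blast
    then have z: "c (4*k) = 0 \<and> c (4*k+1) = 0 \<and> c (4*k+2) = 0 \<and> c (4*k+3) = 0" if "k < t" for k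
      using that[THEN \<open>\<And>k. k < t \<Longrightarrow> q c k = 0\<close>] by (simp add: q_def zero_quat_def)
    have "n div 4 < t" using n by auto
    moreover have "n = 4 * (n div 4) \<or> n = 4 * (n div 4) + 1 \<or> n = 4 * (n div 4) + 2 \<or> n = 4 * (n div 4) + 3"
      by presburger
    ultimately show "c n = 0" using z by metis
  next
    show "hurwitz_span t b = {\<lambda>i\<in>{..<t}. \<Sum>k<4 * t. real_of_int (n k) *\<^sub>R B k i |n. True}"
    proof (intro equalityI subsetI)
      fix x assume "x \<in> hurwitz_span t b"
      then obtain c where c: "\<forall>k<t. c k \<in> hurwitz" "x = (\<lambda>i\<in>{..<t}. \<Sum>k<t. c k * b k i)"
        by (rule hurwitz_spanE)
      then have "\<forall>k. \<exists>e b' c' d. k < t \<longrightarrow> c k = Quat (of_int e/2) (of_int e/2 + of_int b') (of_int e/2 + of_int c') (of_int e/2 + of_int d)"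
        unfolding hurwitz_iff by blast
      then obtain e b' c' d where ebcd: "\<And>k. k < t \<Longrightarrow> c k = Quat (of_int (e k)/2) (of_int (e k)/2 + of_int (b' k))
          (of_int (e k)/2 + of_int (c' k)) (of_int (e k)/2 + of_int (d k))"
        by metis
      define n where "n m = (if m mod 4 = 0 then e (m div 4) else if m mod 4 = 1 then b' (m div 4)
        else if m mod 4 = 2 then c' (m div 4) else d (m div 4))" for m
      have "q n k = c k" if "k < t" for k
        using ebcd[OF that] unfolding q_def n_def mod4 by simp
      then have "x = (\<lambda>i\<in>{..<t}. \<Sum>k<4 * t. real_of_int (n k) *\<^sub>R B k i)"
        unfolding c(2) sum by (auto intro!: restrict_ext)
      then show "x \<in> {\<lambda>i\<in>{..<t}. \<Sum>k<4 * t. real_of_int (n k) *\<^sub>R B k i |n. True}" by blast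
    next
      fix x assume "x \<in> {\<lambda>i\<in>{..<t}. \<Sum>k<4 * t. real_of_int (n k) *\<^sub>R B k i |n. True}"
      then obtain n :: "nat \<Rightarrow> int" where "x = (\<lambda>i\<in>{..<t}. \<Sum>k<4 * t. real_of_int (n k) *\<^sub>R B k i)" by blast
      moreover have "q n k \<in> hurwitz" for k
        unfolding hurwitz_iff q_def by blast
      ultimately show "x \<in> hurwitz_span t b"
        unfolding sum using hurwitz_spanI by blast
    qed
  qed
qed

lemma hurwitz_span_scale:
  "(\<lambda>x. \<lambda>i\<in>{..<t}. s *\<^sub>R x i) ` hurwitz_span t b = hurwitz_span t (\<lambda>k i. s *\<^sub>R b k i)"
proof -
  have eq: "(\<lambda>i\<in>{..<t}. s *\<^sub>R (\<lambda>i\<in>{..<t}. \<Sum>k<t. c k * b k i) i) = (\<lambda>i\<in>{..<t}. \<Sum>k<t. c k * s *\<^sub>R b k i)" for c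
    by (auto simp: scaleR_sum_right intro!: restrict_ext)
  show ?thesis
  proof (intro equalityI subsetI)
    fix x assume "x \<in> (\<lambda>x. \<lambda>i\<in>{..<t}. s *\<^sub>R x i) ` hurwitz_span t b"
    then obtain y where y: "y \<in> hurwitz_span t b" "x = (\<lambda>i\<in>{..<t}. s *\<^sub>R y i)" by blast
    obtain c where "\<forall>k<t. c k \<in> hurwitz" "y = (\<lambda>i\<in>{..<t}. \<Sum>k<t. c k * b k i)"
      using y(1) by (rule hurwitz_spanE)
    with y(2) eq[of c] show "x \<in> hurwitz_span t (\<lambda>k i. s *\<^sub>R b k i)"
      using hurwitz_spanI[of t c "\<lambda>k i. s *\<^sub>R b k i"] by simp
  next
    fix x assume "x \<in> hurwitz_span t (\<lambda>k i. s *\<^sub>R b k i)"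
    then obtain c where c: "\<forall>k<t. c k \<in> hurwitz" "x = (\<lambda>i\<in>{..<t}. \<Sum>k<t. c k * s *\<^sub>R b k i)"
      by (rule hurwitz_spanE)
    show "x \<in> (\<lambda>x. \<lambda>i\<in>{..<t}. s *\<^sub>R x i) ` hurwitz_span t b"
      unfolding c(2) eq[of c, symmetric] by (intro imageI hurwitz_spanI[of t c b]) (simp add: c(1))
  qed
qed

lemma left_independent_scale:
  assumes "left_independent t j b" "s \<noteq> 0"
  shows "left_independent t j (\<lambda>k i. s *\<^sub>R b k i)"
  unfolding left_independent_def
proof (intro allI impI)
  fix c k assume c: "\<forall>i<t. (\<Sum>k<j. c k * s *\<^sub>R b k i) = 0" and k: "k < j"
  have "(\<Sum>k<j. c k * b k i) = 0" if "i < t" for i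
  proof -
    have "s *\<^sub>R (\<Sum>k<j. c k * b k i) = 0" using c that by (simp add: scaleR_sum_right)
    then show ?thesis using assms(2) by simp
  qed
  then show "c k = 0" using left_independentD[OF assms(1) _ k, of c] by blast
qed

text \<open>A triangular basis: the \<open>k\<close>-th vector generates the left ideal of \<open>k\<close>-th coordinates of
  the elements of \<open>\<Lambda>\<close> that vanish beyond \<open>k\<close>.\<close>

lemma hurwitz_submodule_basis:
  assumes t: "t > 0" and sub: "\<Lambda> \<subseteq> {..<t} \<rightarrow>\<^sub>E hurwitz"
    and diff: "\<And>x y. x \<in> \<Lambda> \<Longrightarrow> y \<in> \<Lambda> \<Longrightarrow> (\<lambda>i\<in>{..<t}. x i - y i) \<in> \<Lambda>"
    and mult: "\<And>c x. c \<in> hurwitz \<Longrightarrow> x \<in> \<Lambda> \<Longrightarrow> (\<lambda>i\<in>{..<t}. c * x i) \<in> \<Lambda>"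
    and full: "\<And>k. k < t \<Longrightarrow> \<exists>a. a \<noteq> 0 \<and> (\<lambda>i\<in>{..<t}. if i = k then a else 0) \<in> \<Lambda>"
  obtains b where "left_independent t t b" "\<Lambda> = hurwitz_span t b"
proof -
  define I where "I k = {x k | x. x \<in> \<Lambda> \<and> (\<forall>i<t. k < i \<longrightarrow> x i = 0)}" for k
  define P where "P k x \<longleftrightarrow> x \<in> \<Lambda> \<and> (\<forall>i<t. k < i \<longrightarrow> x i = 0) \<and> x k \<noteq> 0 \<and> I k = {c * x k | c. c \<in> hurwitz}" for k x
  have "\<forall>k\<in>{..<t}. \<exists>x. P k x"
  proof
    fix k assume "k \<in> {..<t}"
    then have k: "k < t" by simp
    obtain a where a: "a \<noteq> 0" "(\<lambda>i\<in>{..<t}. if i = k then a else 0) \<in> \<Lambda>" using full k by blast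
    have I1: "I k \<subseteq> hurwitz" using sub k unfolding I_def by blast
    have I2: "a \<in> I k" unfolding I_def
      using a k by (intro CollectI exI[of _ "\<lambda>i\<in>{..<t}. if i = k then a else 0"]) auto
    have I3: "x - y \<in> I k" if "x \<in> I k" "y \<in> I k" for x y
    proof -
      from that obtain u v where uv: "u \<in> \<Lambda>" "v \<in> \<Lambda>" "\<forall>i<t. k < i \<longrightarrow> u i = 0"
        "\<forall>i<t. k < i \<longrightarrow> v i = 0" "x = u k" "y = v k"
        unfolding I_def by blast
      then show ?thesis unfolding I_def
        using diff k by (intro CollectI exI[of _ "\<lambda>i\<in>{..<t}. u i - v i"]) auto
    qed
    have I4: "c * x \<in> I k" if "c \<in> hurwitz" "x \<in> I k" for c x
    proof -
      from that obtain u where u: "u \<in> \<Lambda>" "\<forall>i<t. k < i \<longrightarrow> u i = 0" "x = u k"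
        unfolding I_def by blast
      then show ?thesis unfolding I_def
        using mult k that by (intro CollectI exI[of _ "\<lambda>i\<in>{..<t}. c * u i"]) auto
    qed
    obtain g where g: "g \<in> I k" "g \<noteq> 0" "I k = {c * g | c. c \<in> hurwitz}"
      by (rule hurwitz_left_ideal_principal[OF I1 I2 a(1) I3 I4])
    then obtain x where x: "x \<in> \<Lambda>" "\<forall>i<t. k < i \<longrightarrow> x i = 0" "g = x k" unfolding I_def by blast
    then have "P k x" using g unfolding P_def by simp
    then show "\<exists>x. P k x" by blast
  qed
  then obtain b where "\<forall>k\<in>{..<t}. P k (b k)" by (rule bchoice[THEN exE])
  then have b: "\<And>k. k < t \<Longrightarrow> b k \<in> \<Lambda>" "\<And>k i. i < t \<Longrightarrow> k < i \<Longrightarrow> b k i = 0"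
    "\<And>k. k < t \<Longrightarrow> b k k \<noteq> 0" "\<And>k. k < t \<Longrightarrow> I k = {c * b k k | c. c \<in> hurwitz}"
    unfolding P_def by (meson lessThan_iff less_trans)+
  have "left_independent t t b"
    unfolding left_independent_def
  proof (rule allI, rule impI, rule ccontr)
    fix c assume c: "\<forall>i<t. (\<Sum>k<t. c k * b k i) = 0" and "\<not> (\<forall>k<t. c k = 0)"
    \<comment> \<open>At coordinate \<open>m\<close>, the last index with a nonzero coefficient,
      only \<open>c m * b m m\<close> survives: later terms have coefficient zero, and earlier basis
      vectors vanish at \<open>m\<close>.\<close>
    define m where "m = Max {k. k < t \<and> c k \<noteq> 0}"
    have ne: "{k. k < t \<and> c k \<noteq> 0} \<noteq> {}" "finite {k. k < t \<and> c k \<noteq> 0}"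
      using \<open>\<not> (\<forall>k<t. c k = 0)\<close> by auto
    have m: "m < t" "c m \<noteq> 0" using Max_in[OF ne(2,1)] unfolding m_def by auto
    have gt: "c k = 0" if "m < k" "k < t" for k
      using Max_ge[OF ne(2), of k] that unfolding m_def by fastforce
    have "0 = (\<Sum>k<t. c k * b k m)" using c m by simp
    also have "\<dots> = c m * b m m + (\<Sum>k\<in>{..<t} - {m}. c k * b k m)"
      using m by (subst sum.remove[of _ m]) auto
    also have "(\<Sum>k\<in>{..<t} - {m}. c k * b k m) = 0"
    proof (intro sum.neutral ballI)
      fix k assume "k \<in> {..<t} - {m}"
      then show "c k * b k m = 0" using gt[of k] b(2)[of m k] m by (cases "k < m") auto
    qed
    finally show False using m b(3)[of m] by (simp add: quat_mult_eq_0_iff)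
  qed
  \<comment> \<open>Elimination from the last coordinate downwards: \<open>m\<close> bounds the
    support of \<open>x\<close>, and subtracting a left multiple of the last available basis vector
    shortens the support by one.\<close>
  moreover have "\<exists>c. (\<forall>k<m. c k \<in> hurwitz) \<and> (\<forall>i<t. x i = (\<Sum>k<m. c k * b k i))"
    if "m \<le> t" "x \<in> \<Lambda>" "\<And>i. i < t \<Longrightarrow> m \<le> i \<Longrightarrow> x i = 0" for m x
    using that
  proof (induction m arbitrary: x)
    case (Suc m)
    have "x m \<in> I m" unfolding I_def using Suc.prems by auto
    then obtain a where a: "a \<in> hurwitz" "x m = a * b m m" using b(4)[of m] Suc.prems by auto
    define y where "y = (\<lambda>i\<in>{..<t}. x i - (\<lambda>i\<in>{..<t}. a * b m i) i)"
    have y: "y \<in> \<Lambda>" unfolding y_def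
      using Suc.prems a b by (intro diff mult) auto
    have "y i = 0" if "i < t" "m \<le> i" for i
    proof (cases "i = m")
      case False
      then show ?thesis using that Suc.prems(3)[of i] b(2)[of i m] by (simp add: y_def)
    qed (use a that in \<open>simp add: y_def\<close>)
    with Suc.IH[OF _ y] Suc.prems obtain c where c: "\<forall>k<m. c k \<in> hurwitz" "\<forall>i<t. y i = (\<Sum>k<m. c k * b k i)"
      by auto
    have "x i = (\<Sum>k<Suc m. (c(m := a)) k * b k i)" if "i < t" for i
    proof -
      have "x i = y i + a * b m i" using that by (simp add: y_def)
      also have "\<dots> = (\<Sum>k<Suc m. (c(m := a)) k * b k i)" using c that by simp
      finally show ?thesis .
    qed
    moreover have "\<forall>k<Suc m. (c(m := a)) k \<in> hurwitz" using a c by (simp add: less_Suc_eq)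
    ultimately show ?case by blast
  qed simp
  then have "\<Lambda> \<subseteq> hurwitz_span t b"
  proof (intro subsetI)
    fix x assume *: "\<And>m x. \<lbrakk>m \<le> t; x \<in> \<Lambda>; \<And>i. \<lbrakk>i < t; m \<le> i\<rbrakk> \<Longrightarrow> x i = 0\<rbrakk>
      \<Longrightarrow> \<exists>c. (\<forall>k<m. c k \<in> hurwitz) \<and> (\<forall>i<t. x i = (\<Sum>k<m. c k * b k i))" and x: "x \<in> \<Lambda>"
    obtain c where c: "\<forall>k<t. c k \<in> hurwitz" "\<forall>i<t. x i = (\<Sum>k<t. c k * b k i)"
      using *[of t x] x by auto
    have "x = (\<lambda>i\<in>{..<t}. \<Sum>k<t. c k * b k i)"
      using c x sub by (intro extensionalityI[of _ "{..<t}"]) (auto simp: PiE_def)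
    then show "x \<in> hurwitz_span t b" using hurwitz_spanI c by simp
  qed
  moreover have "hurwitz_span t b \<subseteq> \<Lambda>"
  proof
    fix x assume "x \<in> hurwitz_span t b"
    then obtain c where c: "\<forall>k<t. c k \<in> hurwitz" "x = (\<lambda>i\<in>{..<t}. \<Sum>k<t. c k * b k i)"
      by (rule hurwitz_spanE)
    have "(\<lambda>i\<in>{..<t}. \<Sum>k<m. c k * b k i) \<in> \<Lambda>" if "m \<le> t" for m
      using that
    proof (induction m)
      case 0
      \<comment> \<open>The zero vector is obtained as the zero multiple of \<open>b 0\<close>,
        which is available because \<open>t > 0\<close>.\<close>
      have "(\<lambda>i\<in>{..<t}. 0 * b 0 i) \<in> \<Lambda>" using t b by (intro mult) auto
      then show ?case by (simp only: mult_zero_left lessThan_0 sum.empty)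
    next
      case (Suc m)
      have 1: "(\<lambda>i\<in>{..<t}. - c m * b m i) \<in> \<Lambda>" using b c Suc.prems by (intro mult) auto
      have "(\<lambda>i\<in>{..<t}. (\<lambda>i\<in>{..<t}. \<Sum>k<m. c k * b k i) i - (\<lambda>i\<in>{..<t}. - c m * b m i) i) \<in> \<Lambda>"
        using Suc by (intro diff 1) auto
      also have "(\<lambda>i\<in>{..<t}. (\<lambda>i\<in>{..<t}. \<Sum>k<m. c k * b k i) i - (\<lambda>i\<in>{..<t}. - c m * b m i) i)
        = (\<lambda>i\<in>{..<t}. \<Sum>k<Suc m. c k * b k i)" by (intro restrict_ext) simp
      finally show ?case .
    qed
    then show "x \<in> \<Lambda>" using c by blast
  qed
  ultimately show thesis using that by blast
qed

section \<open>Volumes\<close>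

abbreviation quat_measure :: "nat \<Rightarrow> (nat \<Rightarrow> quat) measure" where
  "quat_measure t \<equiv> PiM {..<t} (\<lambda>_. lborel)"

lemma DIM_quat [simp]: "DIM(quat) = 4"
  by (simp add: Basis_quat_def)

lemma space_quat_measure: "space (quat_measure t) = {..<t} \<rightarrow>\<^sub>E UNIV"
  by (simp add: space_PiM)

lemma product_sigma_finite_lborel: "product_sigma_finite (\<lambda>_ :: nat. lborel :: quat measure)"
  by standard

lemma emeasure_quat_measure_PiE:
  assumes "\<And>i. i < t \<Longrightarrow> A i \<in> sets borel"
  shows "emeasure (quat_measure t) (PiE {..<t} A) = (\<Prod>i<t. emeasure lborel (A i))"
  using assms by (intro product_sigma_finite.emeasure_PiM[OF product_sigma_finite_lborel]) auto

text \<open>Scaling by \<open>c\<close> in one four-dimensional factor costs |c|^4. The pushforward,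
  corrected by the density \<open>\<bar>c\<bar> ^ (4 * t)\<close>, agrees with Lebesgue measure on
  boxes and hence everywhere, by uniqueness of the product measure.\<close>

lemma emeasure_quat_measure_affine:
  assumes c: "c \<noteq> 0" and A: "A \<in> sets (quat_measure t)"
  shows "emeasure (quat_measure t) A = ennreal (\<bar>c\<bar> ^ (4 * t)) *
    emeasure (quat_measure t) ((\<lambda>x. \<lambda>i\<in>{..<t}. v i + c *\<^sub>R x i) -` A \<inter> space (quat_measure t))"
proof -
  let ?M = "quat_measure t"
  define T where "T = (\<lambda>x. \<lambda>i\<in>{..<t}. v i + c *\<^sub>R x i)"
  have T [measurable]: "T \<in> measurable ?M ?M"
    unfolding T_def by measurable
  define N where "N = density (distr ?M ?M T) (\<lambda>_. ennreal (\<bar>c\<bar> ^ (4 * t)))"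
  have N: "emeasure N B = ennreal (\<bar>c\<bar> ^ (4 * t)) * emeasure ?M (T -` B \<inter> space ?M)"
    if "B \<in> sets ?M" for B
    unfolding N_def using that
    by (simp add: emeasure_density emeasure_distr nn_integral_cmult_indicator)
  have "N = ?M"
  proof (rule product_sigma_finite.PiM_eqI[OF product_sigma_finite_lborel])
    fix A :: "nat \<Rightarrow> quat set" assume A: "\<And>i. i \<in> {..<t} \<Longrightarrow> A i \<in> sets lborel"
    define pre where "pre i = (\<lambda>x. v i + c *\<^sub>R x) -` A i" for i
    have pre_sets: "pre i \<in> sets borel" if "i < t" for i
    proof -
      have "(\<lambda>x. v i + c *\<^sub>R x) \<in> borel_measurable (borel :: quat measure)" by measurable
      from measurable_sets[OF this, of "A i"] show ?thesis using A that by (simp add: pre_def)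
    qed
    have pre: "emeasure lborel (A i) = ennreal (\<bar>c\<bar> ^ 4) * emeasure lborel (pre i)" if "i < t" for i
    proof -
      have "emeasure lborel (A i) = emeasure (density (distr lborel borel (\<lambda>x. v i + c *\<^sub>R x)) (\<lambda>_. ennreal (\<bar>c\<bar> ^ 4))) (A i)"
        using lborel_affine[OF c, of "v i"] by simp
      also have "\<dots> = ennreal (\<bar>c\<bar> ^ 4) * emeasure lborel (pre i)"
        using A that by (simp add: emeasure_density emeasure_distr nn_integral_cmult_indicator pre_def)
      finally show ?thesis .
    qed
    have "T -` PiE {..<t} A \<inter> space ?M = PiE {..<t} pre"
      unfolding space_quat_measure T_def pre_def by (auto simp: PiE_iff)
    moreover have "PiE {..<t} A \<in> sets ?M" using A by (intro sets_PiM_I_finite) auto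
    ultimately have "emeasure N (PiE {..<t} A) = ennreal (\<bar>c\<bar> ^ (4 * t)) * emeasure ?M (PiE {..<t} pre)"
      using N by simp
    also have "emeasure ?M (PiE {..<t} pre) = (\<Prod>i<t. emeasure lborel (pre i))"
      using pre_sets by (rule emeasure_quat_measure_PiE)
    also have "ennreal (\<bar>c\<bar> ^ (4 * t)) = (\<Prod>i<t. ennreal (\<bar>c\<bar> ^ 4))"
      by (simp add: power_mult ennreal_power)
    also have "(\<Prod>i<t. ennreal (\<bar>c\<bar> ^ 4)) * (\<Prod>i<t. emeasure lborel (pre i)) = (\<Prod>i<t. emeasure lborel (A i))"
      unfolding prod.distrib[symmetric] by (intro prod.cong) (simp_all add: pre)
    finally show "emeasure N (PiE {..<t} A) = (\<Prod>i\<in>{..<t}. emeasure lborel (A i))" .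
  qed (simp_all add: N_def)
  with N[OF A] show ?thesis by (simp add: T_def)
qed

lemma emeasure_quat_measure_translate:
  assumes "A \<in> sets (quat_measure t)"
  shows "emeasure (quat_measure t) {x \<in> space (quat_measure t). (\<lambda>i\<in>{..<t}. v i + x i) \<in> A}
    = emeasure (quat_measure t) A"
proof -
  have "{x \<in> space (quat_measure t). (\<lambda>i\<in>{..<t}. v i + x i) \<in> A}
    = (\<lambda>x. \<lambda>i\<in>{..<t}. v i + 1 *\<^sub>R x i) -` A \<inter> space (quat_measure t)"
    unfolding scaleR_one by blast
  then show ?thesis
    by (simp only: emeasure_quat_measure_affine[of 1 A t v] assms) simp
qed

lemma sets_quat_measure_translate:
  assumes "A \<in> sets (quat_measure t)"
  shows "{x \<in> space (quat_measure t). (\<lambda>i\<in>{..<t}. v i + x i) \<in> A} \<in> sets (quat_measure t)"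
proof -
  have "(\<lambda>x. \<lambda>i\<in>{..<t}. v i + x i) \<in> measurable (quat_measure t) (quat_measure t)"
    by measurable
  from measurable_sets[OF this assms] show ?thesis
    by (simp add: vimage_def Int_def conj_commute)
qed

text \<open>The 2 is the square root of the 4 in \<open>quat_trace_cnj_times\<close>. In this form
  the triangle inequality is inherited from \<open>L2_set\<close>.\<close>

lemma vec_norm_eq: "vec_norm t x = L2_set (\<lambda>i. 2 * norm (x i)) {..<t}"
  by (simp add: vec_norm_def quat_trace_cnj_times L2_set_def power_mult_distrib)

lemma vec_norm_nonneg [simp]: "vec_norm t x \<ge> 0"
  by (simp add: vec_norm_eq)

lemma vec_norm_cong: "(\<And>i. i < t \<Longrightarrow> x i = y i) \<Longrightarrow> vec_norm t x = vec_norm t y"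
  unfolding vec_norm_eq by (rule L2_set_cong) auto

lemma vec_norm_restrict [simp]: "vec_norm t (restrict x {..<t}) = vec_norm t x"
  by (rule vec_norm_cong) simp

lemma vec_norm_triangle: "vec_norm t (\<lambda>i. x i + y i) \<le> vec_norm t x + vec_norm t y"
proof -
  have "vec_norm t (\<lambda>i. x i + y i) \<le> L2_set (\<lambda>i. 2 * norm (x i) + 2 * norm (y i)) {..<t}"
    unfolding vec_norm_eq
  proof (rule L2_set_mono)
    show "2 * norm (x i + y i) \<le> 2 * norm (x i) + 2 * norm (y i)" for i
      using norm_triangle_ineq[of "x i" "y i"] by linarith
  qed simp
  also have "\<dots> \<le> vec_norm t x + vec_norm t y"
    unfolding vec_norm_eq by (rule L2_set_triangle_ineq)
  finally show ?thesis .
qed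

lemma vec_norm_scaleR: "vec_norm t (\<lambda>i. c *\<^sub>R x i) = \<bar>c\<bar> * vec_norm t x"
  unfolding vec_norm_eq by (subst L2_set_right_distrib) (auto intro!: L2_set_cong)

lemma vec_norm_left_mult: "vec_norm t (\<lambda>i. c * x i) = norm c * vec_norm t x"
  unfolding vec_norm_eq by (subst L2_set_right_distrib) (auto intro!: L2_set_cong simp: quat_norm_mult)

lemma vec_norm_ge_coordinate: "i < t \<Longrightarrow> 2 * norm (x i) \<le> vec_norm t x"
  unfolding vec_norm_eq by (rule member_le_L2_set) auto

text \<open>The source of the terms with \<open>sqrt t\<close> in the counting bounds: moving each
  coordinate by at most d / 2 moves the vector by at most \<open>d * sqrt t\<close>.\<close>

lemma vec_norm_le_sqrt:
  assumes "\<And>i. i < t \<Longrightarrow> 2 * norm (x i) \<le> d" "d \<ge> 0"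
  shows "vec_norm t x \<le> d * sqrt t"
proof -
  have "vec_norm t x \<le> L2_set (\<lambda>i. d) {..<t}"
    unfolding vec_norm_eq by (rule L2_set_mono) (use assms in auto)
  also have "\<dots> = d * sqrt t" using assms(2) by (simp add: L2_set_constant)
  finally show ?thesis .
qed

section \<open>Balls and the order of magnitude of their volumes\<close>

lemma vec_cball_sets [measurable]: "vec_cball t \<rho> \<in> sets (quat_measure t)"
proof -
  have "vec_cball t \<rho> = {x \<in> space (quat_measure t). sqrt (\<Sum>i<t. (2 * norm (x i))\<^sup>2) \<le> \<rho>}"
    by (auto simp: vec_cball_def vec_norm_eq L2_set_def space_quat_measure quat_space_sel)
  also have "\<dots> \<in> sets (quat_measure t)" by measurable
  finally show ?thesis .
qed

lemma vec_cball_iff: "x \<in> vec_cball t \<rho> \<longleftrightarrow> x \<in> {..<t} \<rightarrow>\<^sub>E UNIV \<and> vec_norm t x \<le> \<rho>"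
  by (simp add: vec_cball_def quat_space_sel)

lemma emeasure_vec_cball_finite: "emeasure (quat_measure t) (vec_cball t \<rho>) < \<infinity>"
proof -
  have "vec_cball t \<rho> \<subseteq> PiE {..<t} (\<lambda>_. cball 0 \<rho>)"
  proof
    fix x assume x: "x \<in> vec_cball t \<rho>"
    have "norm (x i) \<le> \<rho>" if "i < t" for i
      using vec_norm_ge_coordinate[OF that, of x] x norm_ge_zero[of "x i"]
      unfolding vec_cball_iff by linarith
    with x show "x \<in> PiE {..<t} (\<lambda>_. cball 0 \<rho>)" by (auto simp: vec_cball_iff PiE_iff)
  qed
  then have "emeasure (quat_measure t) (vec_cball t \<rho>) \<le> emeasure (quat_measure t) (PiE {..<t} (\<lambda>_. cball 0 \<rho>))"
    by (rule emeasure_mono) (auto intro!: sets_PiM_I_finite)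
  also have "\<dots> = (\<Prod>i<t. emeasure lborel (cball (0::quat) \<rho>))"
    by (rule emeasure_quat_measure_PiE) simp
  also have "\<dots> < \<infinity>"
    using emeasure_lborel_cball_finite[of "0::quat" \<rho>] by (simp add: power_less_top_ennreal)
  finally show ?thesis .
qed

text \<open>Plain Lebesgue volume, without the factor \<open>16 ^ t\<close> of
  \<open>vec_vol\<close>. Divided by the covolume \<open>8 ^ t\<close>, that factor later survives
  as \<open>2 ^ t\<close>.\<close>

definition ball_volume :: "nat \<Rightarrow> real \<Rightarrow> real" where
  "ball_volume t \<rho> = measure (quat_measure t) (vec_cball t \<rho>)"

lemma emeasure_vec_cball: "emeasure (quat_measure t) (vec_cball t \<rho>) = ennreal (ball_volume t \<rho>)"
  using emeasure_vec_cball_finite[of t \<rho>]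
  by (simp add: ball_volume_def emeasure_eq_ennreal_measure top.not_eq_extremum)

lemma ball_volume_nonneg [simp]: "ball_volume t \<rho> \<ge> 0"
  by (simp add: ball_volume_def)

lemma ball_volume_scale:
  assumes "c > 0"
  shows "ball_volume t (c * \<rho>) = c ^ (4 * t) * ball_volume t \<rho>"
proof -
  have "(\<lambda>x. \<lambda>i\<in>{..<t}. 0 + c *\<^sub>R x i) -` vec_cball t (c * \<rho>) \<inter> space (quat_measure t) = vec_cball t \<rho>"
  proof (rule Set.set_eqI)
    fix x
    have "vec_norm t (\<lambda>i. c *\<^sub>R x i) \<le> c * \<rho> \<longleftrightarrow> vec_norm t x \<le> \<rho>"
      using assms by (simp add: vec_norm_scaleR)
    then show "x \<in> (\<lambda>x. \<lambda>i\<in>{..<t}. 0 + c *\<^sub>R x i) -` vec_cball t (c * \<rho>) \<inter> space (quat_measure t)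
      \<longleftrightarrow> x \<in> vec_cball t \<rho>"
      by (simp add: vec_cball_iff space_quat_measure restrict_PiE_iff conj_commute)
  qed
  then have "emeasure (quat_measure t) (vec_cball t (c * \<rho>)) = ennreal (c ^ (4 * t)) * emeasure (quat_measure t) (vec_cball t \<rho>)"
    using emeasure_quat_measure_affine[of c "vec_cball t (c * \<rho>)" t "\<lambda>_. 0"] assms by simp
  then have "ennreal (ball_volume t (c * \<rho>)) = ennreal (c ^ (4 * t) * ball_volume t \<rho>)"
    using assms by (simp add: emeasure_vec_cball ennreal_mult)
  then show ?thesis using assms by (simp add: ennreal_inj)
qed

lemma ball_volume_power:
  assumes "\<rho> > 0" "\<rho>' > 0"
  shows "ball_volume t \<rho> = (\<rho> / \<rho>') ^ (4 * t) * ball_volume t \<rho>'"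
  using ball_volume_scale[of "\<rho> / \<rho>'" t \<rho>'] assms by simp

text \<open>A product of \<open>t\<close> balls of radius 1/2 fits inside, and (1/2)^4 gives the 16.
  Together with \<open>ball_volume_upper\<close> this pins the volume down up to a factor
  exponential in \<open>t\<close>, which is precise enough to locate \<open>r\<close>.\<close>

lemma ball_volume_lower:
  "ball_volume t (sqrt t) \<ge> (unit_ball_vol 4 / 16) ^ t"
proof -
  have "PiE {..<t} (\<lambda>_. cball 0 (1/2)) \<subseteq> vec_cball t (sqrt t)"
  proof
    fix x :: "nat \<Rightarrow> quat" assume x: "x \<in> PiE {..<t} (\<lambda>_. cball 0 (1/2))"
    have "2 * norm (x i) \<le> 1" if "i < t" for i
      using PiE_mem[OF x, of i] that by simp
    then have "vec_norm t x \<le> 1 * sqrt t" by (intro vec_norm_le_sqrt) simp_all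
    with x show "x \<in> vec_cball t (sqrt t)" by (auto simp: vec_cball_iff PiE_iff)
  qed
  then have "emeasure (quat_measure t) (PiE {..<t} (\<lambda>_. cball 0 (1/2))) \<le> emeasure (quat_measure t) (vec_cball t (sqrt t))"
    by (rule emeasure_mono) simp
  also have "emeasure (quat_measure t) (PiE {..<t} (\<lambda>_. cball 0 (1/2))) = (\<Prod>i<t. emeasure lborel (cball (0::quat) (1/2)))"
    by (rule emeasure_quat_measure_PiE) simp
  also have "\<dots> = ennreal ((unit_ball_vol 4 / 16) ^ t)"
    by (simp add: emeasure_cball ennreal_power power_divide)
  finally show ?thesis by (simp add: emeasure_vec_cball)
qed

lemma prod_mono_ennreal:
  "(\<And>i. i \<in> A \<Longrightarrow> f i \<le> (g i :: ennreal)) \<Longrightarrow> prod f A \<le> prod g A"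
  by (induction A rule: infinite_finite_induct) (auto intro: mult_mono)

text \<open>The product of copies of a rapidly decaying function of one quaternion bounds
  the indicator function of a ball of radius \<open>sqrt t\<close> up to a factor exponential in \<open>t\<close>.\<close>

lemma ball_volume_upper: "\<exists>K\<ge>1. \<forall>t. ball_volume t (sqrt t) \<le> K ^ t"
proof -
  \<comment> \<open>\<open>B n\<close> consists of the \<open>q\<close> with 4 |q|^2 at most
    \<open>n\<close>, so \<open>g\<close> decays like 4^(-4 |q|^2).\<close>
  define B :: "nat \<Rightarrow> quat set" where "B n = cball 0 (sqrt n / 2)" for n
  define g :: "quat \<Rightarrow> ennreal" where "g q = (\<Sum>n. ennreal ((1/4) ^ n) * indicator (B n) q)" for q
  have [measurable]: "B n \<in> sets borel" for n
    unfolding B_def by simp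
  have g_meas [measurable]: "g \<in> borel_measurable borel"
    unfolding g_def by measurable
  \<comment> \<open>The volume of \<open>B n\<close> is a multiple of n^2; this bound makes the
    weighted volumes of the \<open>B n\<close> a geometric series of ratio 1/2.\<close>
  have sq: "real n ^ 2 \<le> 2 * 2 ^ n" for n
  proof (induction n)
    case (Suc n)
    show ?case
    proof (cases "n \<le> 3")
      case True
      then have "n = 0 \<or> n = 1 \<or> n = 2 \<or> n = 3" by auto
      then show ?thesis by auto
    next
      case False
      then have n: "4 \<le> real n" by simp
      then have "4 * real n \<le> real n * real n" by (intro mult_right_mono) auto
      then have "1 + real n * 2 \<le> real n * real n" using n by linarith
      then have "real (Suc n) ^ 2 \<le> 2 * real n ^ 2"
        by (simp add: power2_eq_square algebra_simps)
      then show ?thesis using Suc by simp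
    qed
  qed simp
  define v where "v = unit_ball_vol 4"
  have v: "v > 0" by (simp add: v_def)
  have "(\<integral>\<^sup>+q. g q \<partial>lborel) = (\<Sum>n. \<integral>\<^sup>+q. ennreal ((1/4) ^ n) * indicator (B n) q \<partial>lborel)"
    unfolding g_def by (rule nn_integral_suminf) measurable
  also have "\<dots> = (\<Sum>n. ennreal ((1/4) ^ n) * emeasure lborel (B n))"
    by (simp add: nn_integral_cmult_indicator)
  also have "\<dots> \<le> (\<Sum>n. ennreal (v * (1/2) ^ n))"
  proof (intro suminf_le)
    fix n
    have "emeasure lborel (B n) = ennreal (v * (real n ^ 2 / 16))"
    proof -
      have "(sqrt (real n) / 2) ^ 4 = ((sqrt (real n))\<^sup>2)\<^sup>2 / 16"
        by (simp add: power_divide power_mult[symmetric] del: real_sqrt_pow2)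
      then show ?thesis unfolding B_def v_def by (simp add: emeasure_cball)
    qed
    also have "\<dots> \<le> ennreal (v * 2 ^ n)"
    proof (intro ennreal_leI mult_left_mono)
      have "(0::real) \<le> 2 ^ n" by simp
      then show "(real n)\<^sup>2 / 16 \<le> 2 ^ n" using sq[of n] by linarith
    qed (use v in simp)
    finally have "ennreal ((1/4) ^ n) * emeasure lborel (B n) \<le> ennreal ((1/4)^n) * ennreal (v * 2 ^ n)"
      by (rule mult_left_mono) simp
    also have "\<dots> = ennreal (v * ((1/4) ^ n * 2 ^ n))"
      using v by (simp add: ennreal_mult[symmetric] mult_ac)
    also have "(1/4) ^ n * 2 ^ n = (1/2 :: real) ^ n"
      by (simp add: power_mult_distrib[symmetric])
    finally show "ennreal ((1/4) ^ n) * emeasure lborel (B n) \<le> ennreal (v * (1/2) ^ n)" .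
  qed auto
  also have "(\<Sum>n. ennreal (v * (1/2) ^ n)) = ennreal (2 * v)"
  proof (rule suminf_ennreal_eq)
    show "(\<lambda>n. v * (1/2) ^ n) sums (2 * v)"
      using sums_mult[OF geometric_sums[of "1/2 :: real"], of v] by (simp add: mult.commute)
  qed (use v in auto)
  finally have int_g: "(\<integral>\<^sup>+q. g q \<partial>lborel) \<le> ennreal (2 * v)" .
  \<comment> \<open>A single term of the series suffices, the one whose index is the ceiling of 4
    |q|^2.\<close>
  have g_ge: "g q \<ge> ennreal ((1/4) powr (4 * norm q ^ 2 + 1))" for q
  proof -
    define n where "n = nat \<lceil>4 * norm q ^ 2\<rceil>"
    have n: "4 * norm q ^ 2 \<le> real n" "real n \<le> 4 * norm q ^ 2 + 1"
      unfolding n_def by (auto simp: of_nat_nat intro: real_nat_ceiling_ge)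
    have "norm q \<le> sqrt n / 2"
    proof -
      have "2 * norm q \<le> sqrt n" using n by (intro real_le_rsqrt) (simp add: power_mult_distrib)
      then show ?thesis by simp
    qed
    then have "ennreal ((1/4) ^ n) = (\<Sum>k\<in>{n}. ennreal ((1/4) ^ k) * indicator (B k) q)"
      by (simp add: B_def)
    also have "\<dots> \<le> g q" unfolding g_def by (intro sum_le_suminf) auto
    finally have "ennreal ((1/4) powr real n) \<le> g q" by (simp add: powr_realpow)
    moreover have "(1/4 :: real) powr (4 * norm q ^ 2 + 1) \<le> (1/4) powr real n"
      using n by (intro powr_mono') auto
    ultimately show ?thesis by (meson ennreal_leI order_trans)
  qed
  \<comment> \<open>Inside the ball the exponents 4 |x i|^2 + 1 add up to at most 2 t, so the factor
    4^(2t) = 16^t lifts the product of the \<open>g (x i)\<close> above 1. Each factor has integral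
    at most \<open>2 * v\<close>, whence the base 16 * 2 v = 32 v.\<close>
  have "ball_volume t (sqrt t) \<le> (32 * v) ^ t" for t
  proof -
    have le: "indicator (vec_cball t (sqrt t)) x \<le> ennreal (16 ^ t) * (\<Prod>i<t. g (x i))" for x
    proof (cases "x \<in> vec_cball t (sqrt t)")
      case True
      then have "vec_norm t x ^ 2 \<le> sqrt t ^ 2" unfolding vec_cball_iff by (intro power_mono) auto
      then have S: "(\<Sum>i<t. 4 * norm (x i) ^ 2) \<le> t"
        by (simp add: vec_norm_def quat_trace_cnj_times sum_nonneg)
      have "ennreal (\<Prod>i<t. (1/4) powr (4 * norm (x i) ^ 2 + 1)) = (\<Prod>i<t. ennreal ((1/4) powr (4 * norm (x i) ^ 2 + 1)))"
        by (rule prod_ennreal[symmetric]) simp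
      also have "\<dots> \<le> (\<Prod>i<t. g (x i))" by (rule prod_mono_ennreal) (simp add: g_ge)
      also have "(\<Prod>i<t. (1/4 :: real) powr (4 * norm (x i) ^ 2 + 1)) = (1/4) powr (\<Sum>i<t. (4 * norm (x i) ^ 2 + 1))"
        by (simp add: powr_sum)
      finally have 1: "ennreal ((1/4) powr (\<Sum>i<t. (4 * norm (x i) ^ 2 + 1))) \<le> (\<Prod>i<t. g (x i))" .
      have "(1/4 :: real) powr real (2 * t) \<le> (1/4) powr (\<Sum>i<t. (4 * norm (x i) ^ 2 + 1))"
        using S by (intro powr_mono') (auto simp: sum.distrib)
      also have "(1/4 :: real) powr real (2 * t) = (1/4) ^ (2 * t)" by (rule powr_realpow) simp
      also have "\<dots> = (1/16) ^ t" by (simp add: power_mult power2_eq_square)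
      finally have "ennreal ((1/16) ^ t) \<le> (\<Prod>i<t. g (x i))"
        using 1 by (meson ennreal_leI order_trans)
      then have "ennreal (16 ^ t) * ennreal ((1/16) ^ t) \<le> ennreal (16 ^ t) * (\<Prod>i<t. g (x i))"
        by (rule mult_left_mono) simp
      moreover have "ennreal (16 ^ t) * ennreal ((1/16) ^ t) = 1"
        by (simp add: ennreal_mult[symmetric] power_mult_distrib[symmetric])
      ultimately show ?thesis using True by simp
    qed simp
    have prod_2v: "(\<Prod>i<t. ennreal (2 * v)) = ennreal ((2 * v) ^ t)"
      using ennreal_power[of "2 * v" t] v by (simp only: prod_constant card_lessThan)
    have "ennreal (ball_volume t (sqrt t)) = (\<integral>\<^sup>+x. indicator (vec_cball t (sqrt t)) x \<partial>quat_measure t)"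
      by (simp add: emeasure_vec_cball)
    also have "\<dots> \<le> (\<integral>\<^sup>+x. ennreal (16 ^ t) * (\<Prod>i<t. g (x i)) \<partial>quat_measure t)"
      by (intro nn_integral_mono le)
    also have "\<dots> = ennreal (16 ^ t) * (\<integral>\<^sup>+x. (\<Prod>i<t. g (x i)) \<partial>quat_measure t)"
      by (rule nn_integral_cmult) measurable
    also have "(\<integral>\<^sup>+x. (\<Prod>i<t. g (x i)) \<partial>quat_measure t) = (\<Prod>i<t. \<integral>\<^sup>+q. g q \<partial>lborel)"
      by (rule product_sigma_finite.product_nn_integral_prod[OF product_sigma_finite_lborel]) auto
    also have "ennreal (16 ^ t) * (\<Prod>i<t. \<integral>\<^sup>+q. g q \<partial>lborel) \<le> ennreal (16 ^ t) * (\<Prod>i<t. ennreal (2 * v))"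
      using int_g by (intro mult_left_mono prod_mono_ennreal) simp_all
    also have "\<dots> = ennreal (16 ^ t * (2 * v) ^ t)"
      unfolding prod_2v using v by (subst ennreal_mult) simp_all
    also have "16 ^ t * (2 * v) ^ t = (16 * (2 * v)) ^ t"
      by (rule power_mult_distrib[symmetric])
    also have "16 * (2 * v) = 32 * v" by simp
    finally have "ennreal (ball_volume t (sqrt t)) \<le> ennreal ((32 * v) ^ t)" .
    then show ?thesis using v by simp
  qed
  moreover have "(32 * v) ^ t \<le> (max 1 (32 * v)) ^ t" for t
    using v by (intro power_mono) auto
  ultimately have "ball_volume t (sqrt t) \<le> (max 1 (32 * v)) ^ t" for t
    using order_trans by blast
  then show ?thesis by (intro exI[of _ "max 1 (32 * v)"]) simp
qed

text \<open>The sets x + B^t for \<open>x\<close> in \<open>S\<close> are disjoint, have volume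
  \<open>m ^ t\<close> each, and lie in the ball enlarged by \<open>d * sqrt t\<close>. With a
  fundamental cell as \<open>B\<close> this gives the main term, with small balls the bound for rank
  1.\<close>

lemma packing_bound:
  fixes t :: nat and \<rho> :: real
  assumes B: "B \<in> sets borel" "\<And>q. q \<in> B \<Longrightarrow> 2 * norm q \<le> d" "d \<ge> 0"
    and m: "emeasure lborel B = ennreal m" "m > 0"
    and disj: "\<And>x y a b. x \<in> D \<Longrightarrow> y \<in> D \<Longrightarrow> a \<in> B \<Longrightarrow> b \<in> B \<Longrightarrow> x + a = y + b \<Longrightarrow> x = y"
  defines "S \<equiv> {x \<in> {..<t} \<rightarrow>\<^sub>E D. vec_norm t x \<le> \<rho>}"
  shows "finite S \<and> real (card S) * m ^ t \<le> ball_volume t (\<rho> + d * sqrt t)"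
proof -
  let ?M = "quat_measure t" and ?V = "ball_volume t (\<rho> + d * sqrt t)"
  define E where "E x = PiE {..<t} (\<lambda>i. {q. q - x i \<in> B})" for x :: "nat \<Rightarrow> quat"
  have pre: "{q. q - a \<in> B} \<in> sets borel" "emeasure lborel {q. q - a \<in> B} = ennreal m" for a
  proof -
    have eq: "{q. q - a \<in> B} = (+) (- a) -` B" by (auto simp: algebra_simps)
    have meas: "(+) (- a) \<in> borel_measurable (borel :: quat measure)" by measurable
    show "{q. q - a \<in> B} \<in> sets borel" unfolding eq using measurable_sets[OF meas B(1)] by simp
    have "emeasure lborel B = emeasure (distr lborel borel ((+) (- a))) B"
      by (simp add: lborel_distr_plus)
    also have "\<dots> = emeasure lborel {q. q - a \<in> B}"
      unfolding eq using B(1) by (subst emeasure_distr) auto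
    finally show "emeasure lborel {q. q - a \<in> B} = ennreal m" using m by simp
  qed
  have E_sets: "E x \<in> sets ?M" for x
    unfolding E_def using pre by (intro sets_PiM_I_finite) auto
  have E_meas: "emeasure ?M (E x) = ennreal (m ^ t)" for x
  proof -
    have "emeasure ?M (E x) = (\<Prod>i<t. emeasure lborel {q. q - x i \<in> B})"
      unfolding E_def by (rule emeasure_quat_measure_PiE) (rule pre)
    then show ?thesis using m(2) by (simp add: pre(2) ennreal_power)
  qed
  have bound: "real (card G) * m ^ t \<le> ?V" if G: "G \<subseteq> S" "finite G" for G
  proof -
    have "disjoint_family_on E G"
      unfolding disjoint_family_on_def
    proof (intro ballI impI, rule ccontr)
      fix x y assume xy: "x \<in> G" "y \<in> G" "x \<noteq> y" "E x \<inter> E y \<noteq> {}"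
      then obtain z where z: "z \<in> E x" "z \<in> E y" by blast
      have xyD: "x \<in> {..<t} \<rightarrow>\<^sub>E D" "y \<in> {..<t} \<rightarrow>\<^sub>E D" using xy G by (auto simp: S_def)
      have "x i = y i" if "i < t" for i
      proof (rule disj)
        show "x i \<in> D" "y i \<in> D" using xyD that by (auto dest: PiE_mem)
        show "z i - x i \<in> B" "z i - y i \<in> B" using z that unfolding E_def by (auto dest: PiE_mem)
      qed simp
      then have "x = y" using xyD by (intro PiE_ext) auto
      with xy show False by simp
    qed
    then have "(\<Sum>x\<in>G. emeasure ?M (E x)) = emeasure ?M (\<Union>x\<in>G. E x)"
      using G E_sets by (intro sum_emeasure) auto
    also have "\<dots> \<le> emeasure ?M (vec_cball t (\<rho> + d * sqrt t))"
    proof (rule emeasure_mono)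
      show "(\<Union>x\<in>G. E x) \<subseteq> vec_cball t (\<rho> + d * sqrt t)"
      proof (rule UN_least)
        fix x assume "x \<in> G"
        then have x: "vec_norm t x \<le> \<rho>" using G by (auto simp: S_def)
        show "E x \<subseteq> vec_cball t (\<rho> + d * sqrt t)"
        proof
          fix z assume z: "z \<in> E x"
          have "vec_norm t z = vec_norm t (\<lambda>i. x i + (z i - x i))" by simp
          also have "\<dots> \<le> vec_norm t x + vec_norm t (\<lambda>i. z i - x i)"
            by (rule vec_norm_triangle)
          also have "vec_norm t (\<lambda>i. z i - x i) \<le> d * sqrt t"
          proof (rule vec_norm_le_sqrt)
            fix i assume "i < t"
            then have "z i - x i \<in> B" using PiE_mem[OF z[unfolded E_def], of i] by simp
            then show "2 * norm (z i - x i) \<le> d" by (rule B)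
          qed (rule B)
          finally have "vec_norm t z \<le> \<rho> + d * sqrt t" using x by linarith
          moreover have "z \<in> {..<t} \<rightarrow>\<^sub>E UNIV" using z unfolding E_def PiE_iff by blast
          ultimately show "z \<in> vec_cball t (\<rho> + d * sqrt t)" unfolding vec_cball_iff by blast
        qed
      qed
    qed simp
    also have "\<dots> = ennreal ?V" by (rule emeasure_vec_cball)
    also have "(\<Sum>x\<in>G. emeasure ?M (E x)) = ennreal (real (card G) * m ^ t)"
      using m(2) by (simp add: E_meas ennreal_mult ennreal_of_nat_eq_real_of_nat)
    finally show ?thesis by simp
  qed
  \<comment> \<open>The uniform bound on finite subsets is what proves that \<open>S\<close> is
    finite.\<close>
  have "card G \<le> nat \<lfloor>?V / m ^ t\<rfloor>" if "G \<subseteq> S" "finite G" for G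
  proof -
    have "real (card G) \<le> ?V / m ^ t" using bound[OF that] m(2) by (simp add: field_simps)
    then show ?thesis by (simp add: le_nat_iff le_floor_iff)
  qed
  then have "finite S" using finite_if_finite_subsets_card_bdd by blast
  then show ?thesis using bound[of S] by blast
qed

text \<open>A fundamental cell of the order: as w has real part 1/2, the real part is reduced modulo
  1/2, and then the other components modulo 1 by means of i, j, k. Its Lebesgue measure is
  1/2.\<close>

definition hurwitz_box :: "quat set" where
  "hurwitz_box = {q. 0 \<le> quat_re q \<and> quat_re q < 1/2 \<and> 0 \<le> quat_i q \<and> quat_i q < 1 \<and>
    0 \<le> quat_j q \<and> quat_j q < 1 \<and> 0 \<le> quat_k q \<and> quat_k q < 1}"

lemma quat_sel_inner:
  "quat_re q = inner q (Quat 1 0 0 0)" "quat_i q = inner q (Quat 0 1 0 0)"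
  "quat_j q = inner q (Quat 0 0 1 0)" "quat_k q = inner q (Quat 0 0 0 1)"
  by (simp_all add: inner_quat_def)

lemma hurwitz_box_sets [measurable]: "hurwitz_box \<in> sets borel"
  unfolding hurwitz_box_def quat_sel_inner by measurable

lemma hurwitz_box_norm:
  assumes "q \<in> hurwitz_box"
  shows "2 * norm q \<le> 4"
proof -
  have sq: "x\<^sup>2 \<le> 1" if "0 \<le> x" "x < 1" for x :: real
    using that by (simp add: power_le_one)
  have "(norm q)\<^sup>2 \<le> 1 + 1 + 1 + 1"
    unfolding quat_norm_sq using assms
    by (intro add_mono sq) (auto simp: hurwitz_box_def)
  then have "(norm q)\<^sup>2 \<le> 2\<^sup>2" by simp
  then have "norm q \<le> 2" by (rule power2_le_imp_le) simp
  then show ?thesis by simp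
qed

lemma hurwitz_box_unique:
  assumes "h \<in> hurwitz" "h' \<in> hurwitz" "a \<in> hurwitz_box" "b \<in> hurwitz_box" "h + a = h' + b"
  shows "h = h'"
proof -
  have "h - h' \<in> hurwitz" using assms by simp
  then obtain e x y z :: int where eq:
    "h - h' = Quat (of_int e/2) (of_int e/2 + of_int x) (of_int e/2 + of_int y) (of_int e/2 + of_int z)"
    unfolding hurwitz_iff by blast
  have d: "h - h' = b - a" using assms(5) by (simp add: algebra_simps)
  have "quat_re (b - a) = of_int e/2" "quat_i (b - a) = of_int e/2 + of_int x"
    "quat_j (b - a) = of_int e/2 + of_int y" "quat_k (b - a) = of_int e/2 + of_int z"
    using eq unfolding d by simp_all
  then have c: "quat_re b - quat_re a = of_int e/2" "quat_i b - quat_i a = of_int e/2 + of_int x"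
    "quat_j b - quat_j a = of_int e/2 + of_int y" "quat_k b - quat_k a = of_int e/2 + of_int z"
    by simp_all
  have ab: "0 \<le> quat_re a" "quat_re a < 1/2" "0 \<le> quat_i a" "quat_i a < 1" "0 \<le> quat_j a" "quat_j a < 1"
    "0 \<le> quat_k a" "quat_k a < 1"
    "0 \<le> quat_re b" "quat_re b < 1/2" "0 \<le> quat_i b" "quat_i b < 1" "0 \<le> quat_j b" "quat_j b < 1"
    "0 \<le> quat_k b" "quat_k b < 1" using assms(3,4) by (auto simp: hurwitz_box_def)
  have "-1 < (of_int e :: real)" "(of_int e :: real) < 1" using c(1) ab by linarith+
  then have e: "e = 0" by linarith
  have "-1 < (of_int x :: real)" "(of_int x :: real) < 1" "-1 < (of_int y :: real)" "(of_int y :: real) < 1"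
    "-1 < (of_int z :: real)" "(of_int z :: real) < 1"
    using c(2-4) ab e by simp_all
  then have "x = 0" "y = 0" "z = 0" by linarith+
  with e eq have "h - h' = 0" by (simp add: zero_quat_def)
  then show ?thesis by simp
qed

text \<open>The real part determines \<open>e\<close>, the multiple of w; only then can the
  multiples of i, j, k be read off, since w shifts every component.\<close>

lemma hurwitz_box_exists: "\<exists>h\<in>hurwitz. q - h \<in> hurwitz_box"
proof -
  define e where "e = \<lfloor>2 * quat_re q\<rfloor>"
  define x where "x = \<lfloor>quat_i q - of_int e / 2\<rfloor>"
  define y where "y = \<lfloor>quat_j q - of_int e / 2\<rfloor>"
  define z where "z = \<lfloor>quat_k q - of_int e / 2\<rfloor>"
  define h where "h = Quat (of_int e/2) (of_int e/2 + of_int x) (of_int e/2 + of_int y) (of_int e/2 + of_int z)"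
  have "h \<in> hurwitz" unfolding hurwitz_iff h_def by blast
  moreover have "q - h \<in> hurwitz_box"
  proof -
    have "of_int e \<le> 2 * quat_re q" "2 * quat_re q < of_int e + 1" unfolding e_def by linarith+
    moreover have "of_int x \<le> quat_i q - of_int e / 2" "quat_i q - of_int e / 2 < of_int x + 1" unfolding x_def by linarith+
    moreover have "of_int y \<le> quat_j q - of_int e / 2" "quat_j q - of_int e / 2 < of_int y + 1" unfolding y_def by linarith+
    moreover have "of_int z \<le> quat_k q - of_int e / 2" "quat_k q - of_int e / 2 < of_int z + 1" unfolding z_def by linarith+
    ultimately show ?thesis unfolding hurwitz_box_def h_def by simp
  qed
  ultimately show ?thesis by blast
qed

lemma emeasure_hurwitz_box: "emeasure lborel hurwitz_box = ennreal (1/2)"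
proof (rule antisym)
  define u where "u = Quat (1/2) 1 1 1"
  have prod: "(\<Prod>b\<in>Basis. inner (u - 0) b) = 1/2"
    by (simp add: Basis_quat_def inner_quat_def u_def)
  have nn: "inner 0 b \<le> inner u b" if "b \<in> Basis" for b
    using that by (auto simp: Basis_quat_def inner_quat_def u_def)
  have sub: "box 0 u \<subseteq> hurwitz_box" "hurwitz_box \<subseteq> cbox 0 u"
    by (auto simp: hurwitz_box_def box_def cbox_def Basis_quat_def inner_quat_def u_def)
  have "emeasure lborel hurwitz_box \<le> emeasure lborel (cbox 0 u)"
    by (rule emeasure_mono[OF sub(2)]) simp
  also have "\<dots> = ennreal (\<Prod>b\<in>Basis. inner (u - 0) b)" using nn by (rule emeasure_lborel_cbox)
  also have "\<dots> = ennreal (1/2)" by (simp only: prod)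
  finally show "emeasure lborel hurwitz_box \<le> ennreal (1/2)" .
  have "ennreal (1/2) = ennreal (\<Prod>b\<in>Basis. inner (u - 0) b)" by (simp only: prod)
  also have "\<dots> = emeasure lborel (box 0 u)" using emeasure_lborel_box[OF nn] by simp
  also have "\<dots> \<le> emeasure lborel hurwitz_box"
    by (rule emeasure_mono[OF sub(1)]) simp
  finally show "ennreal (1/2) \<le> emeasure lborel hurwitz_box" .
qed

text \<open>The cell volume 1/2 gives the density \<open>2 ^ t\<close>, and the norm bound 4 of the
  cell gives the enlargement. The estimate is asymptotically sharp for radii that are large against
  t^(3/2); radii of order sqrt(t p) are so if t^2 = o(p).\<close>

lemma hurwitz_count:
  fixes t :: nat and \<rho> :: real
  defines "S \<equiv> \<lambda>\<rho>. {x \<in> {..<t} \<rightarrow>\<^sub>E hurwitz. vec_norm t x \<le> \<rho>}"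
  shows "finite (S \<rho>)" "real (card (S \<rho>)) \<le> 2 ^ t * ball_volume t (\<rho> + 4 * sqrt t)"
proof -
  have "finite (S \<rho>) \<and> real (card (S \<rho>)) * (1/2) ^ t \<le> ball_volume t (\<rho> + 4 * sqrt t)"
    unfolding S_def
    by (rule packing_bound[OF hurwitz_box_sets hurwitz_box_norm _ emeasure_hurwitz_box _ hurwitz_box_unique]) simp_all
  then show "finite (S \<rho>)" "real (card (S \<rho>)) \<le> 2 ^ t * ball_volume t (\<rho> + 4 * sqrt t)"
    by (simp_all add: power_divide field_simps)
qed

text \<open>Open balls of radius \<open>s / 2\<close> around the points of \<open>D\<close> are
  disjoint. It is meant for the ideals of singular elements, with \<open>s\<close> equal to
  \<open>sqrt p\<close>.\<close>

lemma separated_count: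
  fixes t :: nat and \<rho> :: real
  assumes D: "\<And>x y. x \<in> D \<Longrightarrow> y \<in> D \<Longrightarrow> x \<noteq> y \<Longrightarrow> norm (x - y) \<ge> s" and s: "s > 0"
  defines "S \<equiv> {x \<in> {..<t} \<rightarrow>\<^sub>E D. vec_norm t x \<le> \<rho>}"
  shows "finite S" "real (card S) * (unit_ball_vol 4 * (s/2) ^ 4) ^ t \<le> ball_volume t (\<rho> + s * sqrt t)"
proof -
  have "finite S \<and> real (card S) * (unit_ball_vol 4 * (s/2) ^ 4) ^ t \<le> ball_volume t (\<rho> + s * sqrt t)"
    unfolding S_def
  proof (rule packing_bound)
    show "ball 0 (s/2) \<in> sets (borel :: quat measure)" by simp
    show "2 * norm q \<le> s" if "q \<in> ball 0 (s/2)" for q :: quat using that by simp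
    show "emeasure lborel (ball (0::quat) (s/2)) = ennreal (unit_ball_vol 4 * (s/2) ^ 4)"
      using s by (simp add: emeasure_ball)
    show "0 < unit_ball_vol 4 * (s/2) ^ 4" using s by simp
    fix x y a b assume *: "x \<in> D" "y \<in> D" "a \<in> ball 0 (s/2)" "b \<in> ball 0 (s/2)" "x + a = y + b"
    have "x - y = b - a" using *(5) by (simp add: algebra_simps)
    then have "norm (x - y) \<le> norm b + norm a" by (metis norm_triangle_ineq4)
    also have "\<dots> < s" using * by simp
    finally show "x = y" using D[of x y] * by force
  qed (use s in simp)
  then show "finite S" "real (card S) * (unit_ball_vol 4 * (s/2) ^ 4) ^ t \<le> ball_volume t (\<rho> + s * sqrt t)" by auto
qed

section \<open>Fundamental domains and the covolume of the standard lattice\<close>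

lemma countable_hurwitz: "countable hurwitz"
proof -
  have eq: "hurwitz = (\<lambda>(e,b,c,d). Quat (of_int e/2) (of_int e/2 + of_int b) (of_int e/2 + of_int c) (of_int e/2 + of_int d)) ` UNIV"
    by (auto simp: hurwitz_iff image_iff)
  show ?thesis unfolding eq by (intro countable_image countableI_type)
qed

text \<open>Cut \<open>A\<close> along the translates v + B and move each piece back by its
  \<open>v\<close>: the pieces then lie in \<open>B\<close>, and they are disjoint because
  \<open>A\<close> is a fundamental domain as well. By symmetry all fundamental domains have the
  same measure, which makes the \<open>THE\<close> in \<open>covolume\<close> meaningful.\<close>

lemma fundamental_domain_emeasure_le:
  assumes A: "fundamental_domain t \<Lambda> A" and B: "fundamental_domain t \<Lambda> B"
    and cnt: "countable \<Lambda>" and sub: "\<Lambda> \<subseteq> carrier (quat_space t)"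
    and neg: "\<And>v. v \<in> \<Lambda> \<Longrightarrow> (\<lambda>i\<in>{..<t}. - v i) \<in> \<Lambda>"
  shows "emeasure (quat_measure t) A \<le> emeasure (quat_measure t) B"
proof -
  let ?M = "quat_measure t"
  have AB: "A \<in> sets ?M" "B \<in> sets ?M" using A B by (auto simp: fundamental_domain_def)
  \<comment> \<open>\<open>P v\<close> is the translate v + B; \<open>Q v\<close> below is the piece
    of \<open>A\<close> inside it, moved back by \<open>v\<close>.\<close>
  define P where "P v = {x \<in> space ?M. (\<lambda>i\<in>{..<t}. - v i + x i) \<in> B}" for v
  have P_sets: "P v \<in> sets ?M" for v unfolding P_def using AB(2) by (rule sets_quat_measure_translate)
  have cover: "A \<subseteq> (\<Union>v\<in>\<Lambda>. A \<inter> P v)"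
  proof
    fix x assume x: "x \<in> A"
    then have xs: "x \<in> space ?M" using sets.sets_into_space[OF AB(1)] by blast
    then have "\<exists>!v. v \<in> \<Lambda> \<and> (\<lambda>i\<in>{..<t}. x i - v i) \<in> B"
      using B unfolding fundamental_domain_def quat_space_sel space_quat_measure by blast
    then obtain v where "v \<in> \<Lambda>" "(\<lambda>i\<in>{..<t}. x i - v i) \<in> B" by blast
    then show "x \<in> (\<Union>v\<in>\<Lambda>. A \<inter> P v)" using x xs by (auto simp: P_def)
  qed
  define Q where "Q v = {x \<in> space ?M. (\<lambda>i\<in>{..<t}. v i + x i) \<in> A \<inter> P v}" for v
  have Q_B: "Q v = {x \<in> B. (\<lambda>i\<in>{..<t}. v i + x i) \<in> A}" for v
  proof -
    have inv: "(\<lambda>i\<in>{..<t}. - v i + (\<lambda>i\<in>{..<t}. v i + x i) i) = x" if "x \<in> space ?M" for x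
    proof -
      have "restrict x {..<t} = x" using that by (simp add: space_quat_measure PiE_iff extensional_restrict)
      then show ?thesis by (simp cong: restrict_cong)
    qed
    have sp: "(\<lambda>i\<in>{..<t}. v i + x i) \<in> space ?M" for x by (simp add: space_quat_measure restrict_PiE_iff)
    have B_sp: "B \<subseteq> space ?M" using sets.sets_into_space[OF AB(2)] .
    show ?thesis
    proof (intro equalityI subsetI)
      fix x assume "x \<in> Q v"
      then have "x \<in> space ?M" "(\<lambda>i\<in>{..<t}. v i + x i) \<in> A"
        "(\<lambda>i\<in>{..<t}. - v i + (\<lambda>i\<in>{..<t}. v i + x i) i) \<in> B"
        unfolding Q_def P_def by blast+
      then show "x \<in> {x \<in> B. (\<lambda>i\<in>{..<t}. v i + x i) \<in> A}" using inv[of x] by (simp only: mem_Collect_eq)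
    next
      fix x assume x: "x \<in> {x \<in> B. (\<lambda>i\<in>{..<t}. v i + x i) \<in> A}"
      then have "x \<in> space ?M" using B_sp by blast
      moreover from this have "(\<lambda>i\<in>{..<t}. - v i + (\<lambda>i\<in>{..<t}. v i + x i) i) \<in> B"
        using inv[of x] x by (simp only: mem_Collect_eq)
      ultimately show "x \<in> Q v" unfolding Q_def P_def using sp[of x] x by blast
    qed
  qed
  have "emeasure ?M A \<le> emeasure ?M (\<Union>v\<in>\<Lambda>. A \<inter> P v)"
    using cover AB P_sets cnt by (intro emeasure_mono sets.countable_UN') auto
  also have "\<dots> = (\<integral>\<^sup>+v. emeasure ?M (A \<inter> P v) \<partial>count_space \<Lambda>)"
  proof (rule emeasure_UN_countable)
    show "A \<inter> P v \<in> sets ?M" for v using AB P_sets by blast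
    show "disjoint_family_on (\<lambda>v. A \<inter> P v) \<Lambda>"
      unfolding disjoint_family_on_def
    proof (intro ballI impI, rule ccontr)
      fix v w assume vw: "v \<in> \<Lambda>" "w \<in> \<Lambda>" "v \<noteq> w" "(A \<inter> P v) \<inter> (A \<inter> P w) \<noteq> {}"
      then obtain x where x: "x \<in> space ?M" "(\<lambda>i\<in>{..<t}. - v i + x i) \<in> B" "(\<lambda>i\<in>{..<t}. - w i + x i) \<in> B"
        unfolding P_def by blast
      have "\<exists>!v. v \<in> \<Lambda> \<and> (\<lambda>i\<in>{..<t}. x i - v i) \<in> B"
        using B x(1) unfolding fundamental_domain_def quat_space_sel space_quat_measure by blast
      moreover have "(\<lambda>i\<in>{..<t}. - u i + x i) = (\<lambda>i\<in>{..<t}. x i - u i)" for u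
        by (rule restrict_ext) simp
      ultimately show False using vw x by metis
    qed
  qed (rule cnt)
  also have "\<dots> = (\<integral>\<^sup>+v. emeasure ?M (Q v) \<partial>count_space \<Lambda>)"
  proof (intro nn_integral_cong)
    fix v
    show "emeasure ?M (A \<inter> P v) = emeasure ?M (Q v)"
      unfolding Q_def using AB P_sets by (intro emeasure_quat_measure_translate[symmetric]) auto
  qed
  also have "\<dots> = emeasure ?M (\<Union>v\<in>\<Lambda>. Q v)"
  proof (rule emeasure_UN_countable[symmetric])
    show "Q v \<in> sets ?M" for v
      unfolding Q_def using AB P_sets by (intro sets_quat_measure_translate) auto
    show "disjoint_family_on Q \<Lambda>"
      unfolding disjoint_family_on_def
    proof (intro ballI impI, rule ccontr)
      fix v w assume vw: "v \<in> \<Lambda>" "w \<in> \<Lambda>" "v \<noteq> w" "Q v \<inter> Q w \<noteq> {}"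
      then obtain x where x: "x \<in> B" "(\<lambda>i\<in>{..<t}. v i + x i) \<in> A" "(\<lambda>i\<in>{..<t}. w i + x i) \<in> A"
        unfolding Q_B by blast
      have "x \<in> carrier (quat_space t)"
        using x sets.sets_into_space[OF AB(2)] by (auto simp: quat_space_sel space_quat_measure)
      then have "\<exists>!v. v \<in> \<Lambda> \<and> (\<lambda>i\<in>{..<t}. x i - v i) \<in> A"
        using A unfolding fundamental_domain_def by blast
      \<comment> \<open>Uniqueness for \<open>A\<close> is applied to the lattice vectors -v and -w,
        as v + x = x - (-v).\<close>
      moreover have "(\<lambda>i\<in>{..<t}. x i - (\<lambda>i\<in>{..<t}. - u i) i) = (\<lambda>i\<in>{..<t}. u i + x i)" for u
        by (rule restrict_ext) simp
      ultimately have eq: "(\<lambda>i\<in>{..<t}. - v i) = (\<lambda>i\<in>{..<t}. - w i)"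
        using neg vw x by metis
      have "v = w"
      proof (rule PiE_ext)
        show "v \<in> {..<t} \<rightarrow>\<^sub>E UNIV" "w \<in> {..<t} \<rightarrow>\<^sub>E UNIV"
          using vw sub unfolding quat_space_sel by blast+
        show "v i = w i" if "i \<in> {..<t}" for i using fun_cong[OF eq, of i] that by simp
      qed
      with vw show False by simp
    qed
  qed (rule cnt)
  also have "\<dots> \<le> emeasure ?M B"
    by (rule emeasure_mono[OF _ AB(2)]) (unfold Q_B, blast)
  finally show ?thesis .
qed

text \<open>The product of \<open>t\<close> cells has Lebesgue measure 2^(-t), and 16^t 2^(-t) =
  8^t.\<close>

lemma covolume_hurwitz: "covolume t (carrier (hurwitz_power t)) = 8 ^ t"
proof -
  let ?M = "quat_measure t"
  define \<Lambda> where "\<Lambda> = carrier (hurwitz_power t)"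
  define F where "F = PiE {..<t} (\<lambda>_. hurwitz_box)"
  have \<Lambda>: "\<Lambda> = {..<t} \<rightarrow>\<^sub>E hurwitz" by (simp add: \<Lambda>_def hurwitz_power_sel)
  have F: "fundamental_domain t \<Lambda> F"
    unfolding fundamental_domain_def
  proof (intro conjI ballI)
    show "F \<in> sets ?M" unfolding F_def by (intro sets_PiM_I_finite) auto
    fix x assume "x \<in> carrier (quat_space t)"
    define v where "v = (\<lambda>i\<in>{..<t}. SOME h. h \<in> hurwitz \<and> x i - h \<in> hurwitz_box)"
    have "v i \<in> hurwitz \<and> x i - v i \<in> hurwitz_box" if "i < t" for i
      using someI_ex[of "\<lambda>h. h \<in> hurwitz \<and> x i - h \<in> hurwitz_box"] hurwitz_box_exists[of "x i"] that
      by (auto simp: v_def)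
    then have v: "v \<in> \<Lambda>" "(\<lambda>i\<in>{..<t}. x i - v i) \<in> F"
      unfolding \<Lambda> F_def by (auto simp: PiE_iff v_def)
    show "\<exists>!v. v \<in> \<Lambda> \<and> (\<lambda>i\<in>{..<t}. x i - v i) \<in> F"
    proof (rule ex1I[of _ v])
      fix w assume w: "w \<in> \<Lambda> \<and> (\<lambda>i\<in>{..<t}. x i - w i) \<in> F"
      show "w = v"
      proof (rule PiE_ext)
        show "w \<in> {..<t} \<rightarrow>\<^sub>E hurwitz" "v \<in> {..<t} \<rightarrow>\<^sub>E hurwitz" using w v \<Lambda> by auto
        fix i assume i: "i \<in> {..<t}"
        show "w i = v i"
        proof (rule hurwitz_box_unique)
          show "w i \<in> hurwitz" "v i \<in> hurwitz" using w v i unfolding \<Lambda> by (auto dest: PiE_mem)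
          show "x i - w i \<in> hurwitz_box" "x i - v i \<in> hurwitz_box"
            using w v i unfolding F_def by (auto dest!: PiE_mem)
        qed simp
      qed
    qed (use v in blast)
  qed
  have F_meas: "vec_vol t F = 8 ^ t"
  proof -
    have "emeasure ?M F = (\<Prod>i<t. emeasure lborel hurwitz_box)"
      unfolding F_def by (rule emeasure_quat_measure_PiE) simp
    also have "\<dots> = ennreal ((1/2) ^ t)"
      unfolding emeasure_hurwitz_box by (simp only: prod_constant card_lessThan) (rule ennreal_power, simp)
    finally have "measure ?M F = (1/2) ^ t" by (simp add: measure_def)
    moreover have "(16 :: real) ^ t * (1/2) ^ t = (16 * (1/2)) ^ t" by (rule power_mult_distrib[symmetric])
    ultimately show ?thesis by (simp add: vec_vol_def)
  qed
  have cnt: "countable \<Lambda>" unfolding \<Lambda> by (intro countable_PiE countable_hurwitz) auto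
  have sub: "\<Lambda> \<subseteq> carrier (quat_space t)" unfolding \<Lambda> quat_space_sel by (rule PiE_mono) simp
  have neg: "(\<lambda>i\<in>{..<t}. - v i) \<in> \<Lambda>" if "v \<in> \<Lambda>" for v
    using that unfolding \<Lambda> by (simp add: restrict_PiE_iff PiE_iff)
  have "vec_vol t G = vec_vol t F" if G: "fundamental_domain t \<Lambda> G" for G
    using antisym[OF fundamental_domain_emeasure_le[OF G F cnt sub neg]
        fundamental_domain_emeasure_le[OF F G cnt sub neg]]
    by (simp add: vec_vol_def measure_def)
  then have "covolume t \<Lambda> = 8 ^ t"
    unfolding covolume_def using F F_meas by (intro the_equality) auto
  then show ?thesis by (simp add: \<Lambda>_def)
qed

section \<open>Codes over the matrix ring\<close>

text \<open>\<open>exhaust_2\<close> lists the elements as 1 and 2, and 2 = 0 in this type.\<close>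

lemma UNIV_2': "(UNIV :: 2 set) = {0, 1}"
proof -
  have "x \<in> {0, 1}" for x :: 2
    using exhaust_2[of x] by auto
  then show ?thesis by blast
qed

lemma two_cases: "b = 0 \<or> b = 1" for b :: 2
  using UNIV_I[of b] unfolding UNIV_2' by simp

lemma residue_ring_sel:
  "carrier (residue_ring m) = {0..m - 1}" "x \<otimes>\<^bsub>residue_ring m\<^esub> y = (x * y) mod m"
  "x \<oplus>\<^bsub>residue_ring m\<^esub> y = (x + y) mod m" "\<zero>\<^bsub>residue_ring m\<^esub> = 0" "\<one>\<^bsub>residue_ring m\<^esub> = 1"
  by (simp_all add: residue_ring_def)

lemma finsum_residue_ring_2:
  assumes "m > 1"
  shows "(\<Oplus>\<^bsub>residue_ring m\<^esub>k\<in>(UNIV :: 2 set). f k \<otimes>\<^bsub>residue_ring m\<^esub> g k) = (f 0 * g 0 + f 1 * g 1) mod m"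
proof -
  interpret residues m "residue_ring m" using assms by unfold_locales simp_all
  have car: "(a * b) mod m \<in> carrier (residue_ring m)" for a b
    using assms by (simp add: residue_ring_sel)
  show ?thesis
    unfolding UNIV_2' using car assms
    by (subst finsum_insert) (auto simp: residue_ring_sel mod_simps)
qed

text \<open>The \<open>t\<close> matrices of \<open>x\<close>, side by side, form one matrix with
  two rows and \<open>2 * t\<close> columns; this is its column \<open>n\<close>. Left
  multiplication acts on all columns alike, so linear relations between columns define
  submodules.\<close>

definition mat_column :: "(nat \<Rightarrow> 2 \<Rightarrow> 2 \<Rightarrow> int) \<Rightarrow> nat \<Rightarrow> 2 \<Rightarrow> int" where
  "mat_column x n = (\<lambda>a. x (n div 2) a (if even n then 0 else 1))"

abbreviation mat2_space :: "nat \<Rightarrow> nat \<Rightarrow> (2 \<Rightarrow> 2 \<Rightarrow> int, nat \<Rightarrow> 2 \<Rightarrow> 2 \<Rightarrow> int) module" where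
  "mat2_space p t \<equiv> power_module (left_regular (mat2_mod p)) t"

lemma mat2_space_sel:
  "carrier (mat2_space p t) = {..<t} \<rightarrow>\<^sub>E {A. \<forall>a b. A a b \<in> {0..int p - 1}}"
  "x \<oplus>\<^bsub>mat2_space p t\<^esub> y = (\<lambda>i\<in>{..<t}. \<lambda>a b. (x i a b + y i a b) mod int p)"
  "\<zero>\<^bsub>mat2_space p t\<^esub> = (\<lambda>i\<in>{..<t}. \<lambda>a b. 0)"
  by (simp_all add: power_module_def left_regular_def mat2_mod_def matrix_ring_def residue_ring_sel)

lemma mat2_space_smult:
  assumes "p > 1"
  shows "A \<odot>\<^bsub>mat2_space p t\<^esub> x = (\<lambda>i\<in>{..<t}. \<lambda>a b. (A a 0 * x i 0 b + A a 1 * x i 1 b) mod int p)"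
  using assms
  by (simp add: power_module_def left_regular_def mat2_mod_def matrix_ring_def finsum_residue_ring_2)

lemma mat2_space_group:
  assumes p: "p > 1"
  shows "group (add_monoid (mat2_space p t))"
proof (rule groupI)
  fix x y z
  show "x \<otimes>\<^bsub>add_monoid (mat2_space p t)\<^esub> y \<otimes>\<^bsub>add_monoid (mat2_space p t)\<^esub> z =
    x \<otimes>\<^bsub>add_monoid (mat2_space p t)\<^esub> (y \<otimes>\<^bsub>add_monoid (mat2_space p t)\<^esub> z)"
    by (simp add: mat2_space_sel mod_simps add.assoc cong: restrict_cong)
next
  fix x y assume "x \<in> carrier (add_monoid (mat2_space p t))" "y \<in> carrier (add_monoid (mat2_space p t))"
  show "x \<otimes>\<^bsub>add_monoid (mat2_space p t)\<^esub> y \<in> carrier (add_monoid (mat2_space p t))"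
    using p by (simp add: mat2_space_sel restrict_PiE_iff)
next
  fix x assume x: "x \<in> carrier (add_monoid (mat2_space p t))"
  then have "(x i a b) mod int p = x i a b" if "i < t" for i a b
    using that p PiE_mem[of x "{..<t}" "\<lambda>_. {A. \<forall>a b. A a b \<in> {0..int p - 1}}" i]
    by (simp add: mat2_space_sel)
  moreover have "restrict x {..<t} = x"
    using x by (simp add: mat2_space_sel PiE_iff extensional_restrict)
  ultimately show "\<one>\<^bsub>add_monoid (mat2_space p t)\<^esub> \<otimes>\<^bsub>add_monoid (mat2_space p t)\<^esub> x = x"
    by (simp add: mat2_space_sel cong: restrict_cong)
  show "\<exists>y\<in>carrier (add_monoid (mat2_space p t)). y \<otimes>\<^bsub>add_monoid (mat2_space p t)\<^esub> x = \<one>\<^bsub>add_monoid (mat2_space p t)\<^esub>"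
    using p
    by (intro bexI[of _ "\<lambda>i\<in>{..<t}. \<lambda>a b. (- x i a b) mod int p"])
      (simp_all add: mat2_space_sel restrict_PiE_iff mod_simps cong: restrict_cong)
qed (use p in \<open>simp_all add: mat2_space_sel restrict_PiE_iff\<close>)

lemma mat2_space_inv:
  assumes p: "p > 1" and x: "x \<in> carrier (mat2_space p t)"
  shows "inv\<^bsub>add_monoid (mat2_space p t)\<^esub> x = (\<lambda>i\<in>{..<t}. \<lambda>a b. (- x i a b) mod int p)"
proof (rule group.inv_equality[OF mat2_space_group[OF p]])
  show "(\<lambda>i\<in>{..<t}. \<lambda>a b. (- x i a b) mod int p) \<otimes>\<^bsub>add_monoid (mat2_space p t)\<^esub> x = \<one>\<^bsub>add_monoid (mat2_space p t)\<^esub>"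
    by (simp add: mat2_space_sel mod_simps cong: restrict_cong)
qed (use assms in \<open>simp_all add: mat2_space_sel restrict_PiE_iff\<close>)

text \<open>Only codes that are graphs over their first \<open>t + 1\<close> columns take part in the average: they
  are parametrised by a matrix of coefficients, so that no subspaces have to be counted.\<close>

definition code :: "nat \<Rightarrow> nat \<Rightarrow> (nat \<Rightarrow> nat \<Rightarrow> int) \<Rightarrow> (nat \<Rightarrow> 2 \<Rightarrow> 2 \<Rightarrow> int) set" where
  "code p t A = {x \<in> carrier (mat2_space p t). \<forall>n\<in>{t+1..<2*t}. \<forall>a.
     mat_column x n a = (\<Sum>m<t+1. mat_column x m a * A n m) mod int p}"

lemma mat_column_restrict: "n < 2 * t \<Longrightarrow> mat_column (restrict f {..<t}) n = mat_column f n"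
  by (auto simp: mat_column_def fun_eq_iff)

text \<open>The relations between columns hold in both rows with the same coefficients
  \<open>A\<close>, hence survive any mixing of rows. One statement covers sums, with
  \<open>c\<close> and \<open>d\<close> equal to 1, and the matrix action, where the new row
  \<open>a\<close> is \<open>B a 0\<close> times row 0 plus \<open>B a 1\<close> times row
  1.\<close>

lemma code_combination:
  assumes xy: "x \<in> code p t A" "y \<in> code p t A" and t: "t \<ge> 1" and z: "z \<in> carrier (mat2_space p t)"
    and col: "\<And>n a. n < 2 * t \<Longrightarrow>
      mat_column z n a = (c a * mat_column x n (f a) + d a * mat_column y n (g a)) mod int p"
  shows "z \<in> code p t A"
  unfolding code_def
proof (intro CollectI conjI ballI allI z)
  fix n a assume n: "n \<in> {t+1..<2*t}"
  let ?u = "\<lambda>m. c a * mat_column x m (f a) + d a * mat_column y m (g a)"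
  have "mat_column z n a = (c a * ((\<Sum>m<t+1. mat_column x m (f a) * A n m) mod int p)
    + d a * ((\<Sum>m<t+1. mat_column y m (g a) * A n m) mod int p)) mod int p"
    using n xy by (simp add: col code_def)
  also have "\<dots> = (c a * (\<Sum>m<t+1. mat_column x m (f a) * A n m) + d a * (\<Sum>m<t+1. mat_column y m (g a) * A n m)) mod int p"
    by (intro mod_add_cong mod_mult_cong) simp_all
  also have "\<dots> = (\<Sum>m<t+1. ?u m * A n m) mod int p"
    by (simp only: sum.distrib distrib_right sum_distrib_left mult.assoc)
  also have "\<dots> = (\<Sum>m<t+1. ((?u m mod int p) * A n m) mod int p) mod int p"
    by (simp only: mod_mult_left_eq mod_sum_eq)
  also have "\<dots> = (\<Sum>m<t+1. (?u m mod int p) * A n m) mod int p"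
    by (rule mod_sum_eq)
  \<comment> \<open>The free columns are all below \<open>2 * t\<close>, since
    \<open>t \<ge> 1\<close> gives \<open>t + 1 \<le> 2 * t\<close>.\<close>
  also have "(\<Sum>m<t+1. (?u m mod int p) * A n m) = (\<Sum>m<t+1. mat_column z m a * A n m)"
    using t by (intro sum.cong) (simp_all add: col)
  finally show "mat_column z n a = (\<Sum>m<t+1. mat_column z m a * A n m) mod int p" .
qed

lemma code_add:
  assumes "x \<in> code p t A" "y \<in> code p t A" "t \<ge> 1" "p > 1"
  shows "(\<lambda>i\<in>{..<t}. \<lambda>a b. (x i a b + y i a b) mod int p) \<in> code p t A"
  by (rule code_combination[OF assms(1-3), where c = "\<lambda>_. 1" and d = "\<lambda>_. 1" and f = "\<lambda>a. a" and g = "\<lambda>a. a"])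
    (use assms(4) in \<open>simp add: mat2_space_sel restrict_PiE_iff\<close>,
      simp only: mat_column_restrict, simp add: mat_column_def)

lemma code_smult:
  assumes "x \<in> code p t A" "t \<ge> 1" "p > 1"
  shows "(\<lambda>i\<in>{..<t}. \<lambda>a b. (B a 0 * x i 0 b + B a 1 * x i 1 b) mod int p) \<in> code p t A"
  by (rule code_combination[OF assms(1,1,2), where c = "\<lambda>a. B a 0" and d = "\<lambda>a. B a 1" and f = "\<lambda>_. 0" and g = "\<lambda>_. 1"])
    (use assms(3) in \<open>simp add: mat2_space_sel restrict_PiE_iff\<close>,
      simp only: mat_column_restrict, simp add: mat_column_def)

lemma column_module_sel:
  "carrier (power_module (column_module (residue_ring (int p))) k) = {..<k} \<rightarrow>\<^sub>E {v. \<forall>a. v a \<in> {0..int p - 1}}"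
  "x \<oplus>\<^bsub>power_module (column_module (residue_ring (int p))) k\<^esub> y = (\<lambda>i\<in>{..<k}. \<lambda>a. (x i a + y i a) mod int p)"
  by (simp_all add: power_module_def column_module_def residue_ring_sel)

lemma column_module_smult:
  assumes "p > 1"
  shows "A \<odot>\<^bsub>power_module (column_module (residue_ring (int p))) k\<^esub> x
    = (\<lambda>i\<in>{..<k}. \<lambda>a :: 2. (A a 0 * x i 0 + A a 1 * x i 1) mod int p)"
  using assms by (simp add: power_module_def column_module_def finsum_residue_ring_2)

lemma mat_column_in_range:
  assumes "x \<in> carrier (mat2_space p t)" "n < 2 * t"
  shows "mat_column x n a \<in> {0..int p - 1}"
  using PiE_mem[of x "{..<t}" "\<lambda>_. {A. \<forall>a b. A a b \<in> {0..int p - 1}}" "n div 2"] assms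
  by (auto simp: mat_column_def mat2_space_sel)

lemma mat2_space_eqI:
  assumes "x \<in> carrier (mat2_space p t)" "y \<in> carrier (mat2_space p t)"
    "\<And>n a. n < 2 * t \<Longrightarrow> mat_column x n a = mat_column y n a"
  shows "x = y"
proof (rule PiE_ext)
  show "x \<in> {..<t} \<rightarrow>\<^sub>E {A. \<forall>a b. A a b \<in> {0..int p - 1}}" "y \<in> {..<t} \<rightarrow>\<^sub>E {A. \<forall>a b. A a b \<in> {0..int p - 1}}"
    using assms(1,2) by (simp_all only: mat2_space_sel)
  fix i assume i: "i \<in> {..<t}"
  have "x i a b = y i a b" for a b
  proof -
    have "b = 0 \<or> b = 1" using UNIV_2' by auto
    then show ?thesis
      using assms(3)[of "2 * i" a] assms(3)[of "2 * i + 1" a] i by (auto simp: mat_column_def)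
  qed
  then show "x i = y i" by blast
qed

text \<open>Taking the first \<open>t + 1\<close> columns is the isomorphism: the other
  \<open>t - 1\<close> columns are functions of them, and the columns with two entries form the
  simple module.\<close>

lemma code_in_codes:
  assumes p: "p > 1" and t: "t \<ge> 1"
  shows "code p t A \<in> codes p t (t + 1)"
  unfolding codes_def
proof (intro CollectI conjI)
  let ?M = "mat2_space p t" and ?N = "power_module (column_module (residue_ring (int p))) (t + 1) :: (2 \<Rightarrow> 2 \<Rightarrow> int, nat \<Rightarrow> 2 \<Rightarrow> int) module"
  let ?C = "?M\<lparr>carrier := code p t A\<rparr>"
  have sub: "code p t A \<subseteq> carrier ?M" by (auto simp: code_def)
  show "submodule (code p t A) (mat2_mod p) ?M"
  proof (intro submodule.intro subgroup.intro submodule_axioms.intro)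
    show "code p t A \<subseteq> carrier (add_monoid ?M)" using sub by simp
    show "x \<otimes>\<^bsub>add_monoid ?M\<^esub> y \<in> code p t A" if "x \<in> code p t A" "y \<in> code p t A" for x y
      using code_add[OF that t p] by (simp add: mat2_space_sel)
    show "\<one>\<^bsub>add_monoid ?M\<^esub> \<in> code p t A"
      using p t by (simp add: code_def mat2_space_sel restrict_PiE_iff mat_column_restrict) (simp add: mat_column_def)
    show "inv\<^bsub>add_monoid ?M\<^esub> x \<in> code p t A" if x: "x \<in> code p t A" for x
    proof -
      \<comment> \<open>Negation is the action of minus the identity matrix.\<close>
      define B :: "2 \<Rightarrow> 2 \<Rightarrow> int" where "B a b = (if a = b then -1 else 0)" for a b
      have "B a 0 * x i 0 b + B a 1 * x i 1 b = - x i a b" for i a b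
      proof -
        have "a = 0 \<or> a = 1" using UNIV_2' by auto
        then show ?thesis by (elim disjE) (simp_all add: B_def)
      qed
      then show ?thesis
        using code_smult[OF x t p, of B] x sub mat2_space_inv[OF p, of x t] by auto
    qed
    show "B \<odot>\<^bsub>?M\<^esub> x \<in> code p t A" if "x \<in> code p t A" for B x
      unfolding mat2_space_smult[OF p] using code_smult[OF that t p] .
  qed
  define f where "f x = (\<lambda>m\<in>{..<t+1}. mat_column x m)" for x
  have "f \<in> iso (add_monoid ?C) (add_monoid ?N)"
  proof (rule isoI)
    show "f \<in> hom (add_monoid ?C) (add_monoid ?N)"
    proof (rule homI)
      fix x assume "x \<in> carrier (add_monoid ?C)"
      then show "f x \<in> carrier (add_monoid ?N)"
        using mat_column_in_range[of x p t] sub t by (auto simp: f_def column_module_sel restrict_PiE_iff)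
    next
      fix x y
      have "mat_column (x \<oplus>\<^bsub>?M\<^esub> y) m = (\<lambda>a. (mat_column x m a + mat_column y m a) mod int p)" if "m < t + 1" for m
        using that t by (simp add: mat2_space_sel mat_column_restrict) (simp add: mat_column_def)
      then show "f (x \<otimes>\<^bsub>add_monoid ?C\<^esub> y) = f x \<otimes>\<^bsub>add_monoid ?N\<^esub> f y"
        by (simp add: f_def column_module_sel cong: restrict_cong)
    qed
    show "bij_betw f (carrier (add_monoid ?C)) (carrier (add_monoid ?N))"
      unfolding bij_betw_def
    proof
      show "inj_on f (carrier (add_monoid ?C))"
      proof (rule inj_onI)
        fix x y assume "x \<in> carrier (add_monoid ?C)" "y \<in> carrier (add_monoid ?C)" and eq: "f x = f y"
        then have xy: "x \<in> code p t A" "y \<in> code p t A" by simp_all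
        have c: "mat_column x m = mat_column y m" if "m < t + 1" for m
          using fun_cong[OF eq, of m] that by (simp add: f_def)
        have "mat_column x n a = mat_column y n a" if "n < 2 * t" for n a
        proof (cases "n < t + 1")
          case False
          then have "mat_column x n a = (\<Sum>m<t+1. mat_column x m a * A n m) mod int p"
            "mat_column y n a = (\<Sum>m<t+1. mat_column y m a * A n m) mod int p"
            using xy that by (simp_all add: code_def)
          then show ?thesis using c by simp
        qed (simp add: c)
        then show "x = y" using xy sub by (intro mat2_space_eqI) auto
      qed
      show "f ` carrier (add_monoid ?C) = carrier (add_monoid ?N)"
      proof (intro equalityI subsetI)
        fix y assume "y \<in> f ` carrier (add_monoid ?C)"
        then obtain x where "x \<in> code p t A" "y = f x" by auto
        then show "y \<in> carrier (add_monoid ?N)"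
          using mat_column_in_range[of x p t] sub t by (auto simp: f_def column_module_sel restrict_PiE_iff)
      next
        fix y assume "y \<in> carrier (add_monoid ?N)"
        then have y: "y \<in> {..<t+1} \<rightarrow>\<^sub>E {v. \<forall>a :: 2. v a \<in> {0..int p - 1}}" by (simp add: column_module_sel)
        then have y_range: "y m a \<in> {0..int p - 1}" if "m < t + 1" for m a
          using PiE_mem[OF y, of m] that by simp
        \<comment> \<open>The prescribed \<open>t + 1\<close> columns, completed by the relations of
          the code.\<close>
        define e where "e n a = (if n < t + 1 then y n a else (\<Sum>m<t+1. y m a * A n m) mod int p)" for n and a :: 2
        define x where "x = (\<lambda>i\<in>{..<t}. \<lambda>a (b :: 2). e (2 * i + (if b = 0 then 0 else 1)) a)"
        have col: "mat_column x n = e n" if "n < 2 * t" for n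
          using that unfolding x_def by (auto simp: mat_column_restrict mat_column_def[of _ n] fun_eq_iff)
        have e_range: "e n a \<in> {0..int p - 1}" for n a
          using p y_range by (auto simp: e_def)
        have "x \<in> carrier ?M"
          using e_range by (simp add: x_def mat2_space_sel restrict_PiE_iff)
        moreover have "mat_column x n a = (\<Sum>m<t+1. mat_column x m a * A n m) mod int p" if "n \<in> {t+1..<2*t}" for n a
        proof -
          have "(\<Sum>m<t+1. mat_column x m a * A n m) = (\<Sum>m<t+1. y m a * A n m)"
            using t by (intro sum.cong) (simp_all add: col e_def)
          then show ?thesis using that by (simp add: col e_def)
        qed
        ultimately have "x \<in> code p t A" unfolding code_def by blast
        moreover have "f x = y"
        proof -
          have "restrict y {..<t+1} = y" using y by (simp add: PiE_iff extensional_restrict)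
          moreover have "mat_column x m = y m" if "m < t + 1" for m
            using that t by (auto simp: col e_def)
          ultimately show ?thesis unfolding f_def by (metis lessThan_iff restrict_ext)
        qed
        ultimately show "y \<in> f ` carrier (add_monoid ?C)" by auto
      qed
    qed
  qed
  moreover have "f (B \<odot>\<^bsub>?C\<^esub> x) = B \<odot>\<^bsub>?N\<^esub> f x" for B x
  proof -
    have s: "B \<odot>\<^bsub>?C\<^esub> x = B \<odot>\<^bsub>?M\<^esub> x" by simp
    have "mat_column (B \<odot>\<^bsub>?M\<^esub> x) m = (\<lambda>a. (B a 0 * mat_column x m 0 + B a 1 * mat_column x m 1) mod int p)" if "m < t + 1" for m
      using that t unfolding mat2_space_smult[OF p] by (simp add: mat_column_restrict) (simp add: mat_column_def)
    then show ?thesis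
      unfolding s column_module_smult[OF p] by (simp add: f_def cong: restrict_cong)
  qed
  ultimately have "f \<in> left_module_iso (mat2_mod p) ?C ?N"
    unfolding left_module_iso_def by blast
  then show "left_module_iso (mat2_mod p) ?C ?N \<noteq> {}" by blast
qed

section \<open>Counting the codes that contain a given vector\<close>

lemma card_le_by_restriction:
  assumes "finite P" "finite V" "E \<subseteq> P \<rightarrow>\<^sub>E V"
    and det: "\<And>\<alpha> \<beta>. \<alpha> \<in> E \<Longrightarrow> \<beta> \<in> E \<Longrightarrow> (\<And>m. m \<in> P - Z \<Longrightarrow> \<alpha> m = \<beta> m) \<Longrightarrow> \<alpha> = \<beta>"
  shows "card E \<le> card V ^ card (P - Z)"
proof -
  have "card E \<le> card ((P - Z) \<rightarrow>\<^sub>E V)"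
  proof (rule card_inj_on_le)
    show "inj_on (\<lambda>\<alpha>. restrict \<alpha> (P - Z)) E"
    proof (rule inj_onI)
      fix \<alpha> \<beta> assume *: "\<alpha> \<in> E" "\<beta> \<in> E" "restrict \<alpha> (P - Z) = restrict \<beta> (P - Z)"
      show "\<alpha> = \<beta>"
      proof (rule det[OF *(1,2)])
        fix m assume "m \<in> P - Z"
        then show "\<alpha> m = \<beta> m" using fun_cong[OF *(3), of m] by simp
      qed
    qed
    show "(\<lambda>\<alpha>. restrict \<alpha> (P - Z)) ` E \<subseteq> (P - Z) \<rightarrow>\<^sub>E V"
    proof (rule image_subsetI)
      fix \<alpha> assume "\<alpha> \<in> E"
      then have "\<alpha> \<in> P \<rightarrow>\<^sub>E V" using assms(3) by blast
      then show "restrict \<alpha> (P - Z) \<in> (P - Z) \<rightarrow>\<^sub>E V"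
        by (simp add: restrict_PiE_iff PiE_iff)
    qed
    show "finite ((P - Z) \<rightarrow>\<^sub>E V)" using assms by (intro finite_PiE) auto
  qed
  then show ?thesis using assms(1) by (simp add: card_PiE)
qed

lemma residue_eqI: "x \<in> {0..<q} \<Longrightarrow> y \<in> {0..<q} \<Longrightarrow> q dvd x - y \<Longrightarrow> x = y" for x y q :: int
  by (metis atLeastLessThan_iff mod_eq_dvd_iff mod_pos_pos_trivial)

text \<open>An affine hyperplane over the field with \<open>p\<close> elements, unless
  \<open>u\<close> vanishes modulo \<open>p\<close> or \<open>c\<close> is no reduced residue. In
  the application \<open>\<alpha>\<close> is a row \<open>A n\<close> of code parameters and
  \<open>u\<close> a row of the matrix of \<open>x\<close>.\<close>

definition solutions :: "nat \<Rightarrow> nat set \<Rightarrow> (nat \<Rightarrow> int) \<Rightarrow> int \<Rightarrow> (nat \<Rightarrow> int) set" where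
  "solutions p P u c = {\<alpha> \<in> P \<rightarrow>\<^sub>E {0..<int p}. (\<Sum>m\<in>P. u m * \<alpha> m) mod int p = c}"

lemma solutions_PiE: "\<alpha> \<in> solutions p P u c \<Longrightarrow> \<alpha> \<in> P \<rightarrow>\<^sub>E {0..<int p}"
  by (simp add: solutions_def)

lemma finite_solutions: "finite P \<Longrightarrow> finite (solutions p P u c)"
  unfolding solutions_def by (rule finite_subset[of _ "P \<rightarrow>\<^sub>E {0..<int p}"]) (auto intro: finite_PiE)

lemma solutions_eq_at:
  assumes "\<alpha> \<in> solutions p P u c" "\<beta> \<in> solutions p P v d" "k \<in> P" "int p dvd \<alpha> k - \<beta> k"
  shows "\<alpha> k = \<beta> k"
  using PiE_mem[OF solutions_PiE[OF assms(1)] assms(3)] PiE_mem[OF solutions_PiE[OF assms(2)] assms(3)] assms(4)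
  by (rule residue_eqI)

text \<open>The difference of two solutions solves the homogeneous congruence, in which only the
  coordinates in \<open>Q\<close> are left.\<close>

lemma solutions_dvd:
  assumes "\<alpha> \<in> solutions p P u c" "\<beta> \<in> solutions p P u c" "finite P" "Q \<subseteq> P"
    and "\<And>m. m \<in> P - Q \<Longrightarrow> \<alpha> m = \<beta> m"
  shows "int p dvd (\<Sum>m\<in>Q. u m * (\<alpha> m - \<beta> m))"
proof -
  have "(\<Sum>m\<in>P. u m * \<alpha> m) mod int p = (\<Sum>m\<in>P. u m * \<beta> m) mod int p"
    using assms(1,2) by (simp add: solutions_def)
  then have "int p dvd (\<Sum>m\<in>P. u m * \<alpha> m) - (\<Sum>m\<in>P. u m * \<beta> m)" by (rule mod_eq_dvd_iff[THEN iffD1])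
  also have "(\<Sum>m\<in>P. u m * \<alpha> m) - (\<Sum>m\<in>P. u m * \<beta> m) = (\<Sum>m\<in>P. u m * (\<alpha> m - \<beta> m))"
    by (simp add: sum_subtractf right_diff_distrib)
  also have "\<dots> = (\<Sum>m\<in>Q. u m * (\<alpha> m - \<beta> m))"
    using assms(3-5) by (intro sum.mono_neutral_right) auto
  finally show ?thesis .
qed

lemma card_solutions_one:
  assumes q: "prime (int p)" and P: "finite P" "k \<in> P" and u: "\<not> int p dvd u k"
  shows "card (solutions p P u c) \<le> p ^ (card P - 1)"
proof -
  have "card (solutions p P u c) \<le> card {0..<int p} ^ card (P - {k})"
  proof (rule card_le_by_restriction)
    fix \<alpha> \<beta> assume ab: "\<alpha> \<in> solutions p P u c" "\<beta> \<in> solutions p P u c"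
      and eq: "\<And>m. m \<in> P - {k} \<Longrightarrow> \<alpha> m = \<beta> m"
    have "int p dvd u k * (\<alpha> k - \<beta> k)" using solutions_dvd[OF ab P(1), of "{k}"] eq P(2) by simp
    then have "int p dvd \<alpha> k - \<beta> k" using q u prime_dvd_mult_iff by blast
    then have "\<alpha> k = \<beta> k" by (rule solutions_eq_at[OF ab P(2)])
    with eq have "\<alpha> m = \<beta> m" if "m \<in> P" for m using that by (cases "m = k") auto
    with ab[THEN solutions_PiE] show "\<alpha> = \<beta>" by (rule PiE_ext)
  qed (use P in \<open>auto simp: solutions_def\<close>)
  then show ?thesis using P by simp
qed

text \<open>Cramer's rule: the minor at \<open>k\<close> and \<open>l\<close> is invertible modulo
  \<open>p\<close>, so all other coordinates determine these two.\<close>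

lemma card_solutions_two:
  assumes q: "prime (int p)" and P: "finite P" "k \<in> P" "l \<in> P"
    and minor: "\<not> int p dvd u k * v l - u l * v k"
  shows "card (solutions p P u c \<inter> solutions p P v d) \<le> p ^ (card P - 2)"
proof -
  let ?E = "solutions p P u c \<inter> solutions p P v d"
  have kl: "k \<noteq> l" using minor by (auto simp: mult.commute)
  have "card ?E \<le> card {0..<int p} ^ card (P - {k, l})"
  proof (rule card_le_by_restriction)
    fix \<alpha> \<beta> assume "\<alpha> \<in> ?E" "\<beta> \<in> ?E" and eq: "\<And>m. m \<in> P - {k, l} \<Longrightarrow> \<alpha> m = \<beta> m"
    then have ab: "\<alpha> \<in> solutions p P u c" "\<beta> \<in> solutions p P u c"
      "\<alpha> \<in> solutions p P v d" "\<beta> \<in> solutions p P v d" by blast+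
    define x y where "x = \<alpha> k - \<beta> k" and "y = \<alpha> l - \<beta> l"
    have du: "int p dvd u k * x + u l * y" and dv: "int p dvd v k * x + v l * y"
      using solutions_dvd[OF ab(1,2) P(1), of "{k, l}"] solutions_dvd[OF ab(3,4) P(1), of "{k, l}"] eq P(2,3) kl
      by (simp_all add: x_def y_def)
    have "(u k * v l - u l * v k) * x = v l * (u k * x + u l * y) - u l * (v k * x + v l * y)"
      "(u k * v l - u l * v k) * y = u k * (v k * x + v l * y) - v k * (u k * x + u l * y)"
      by (simp_all add: algebra_simps)
    then have "int p dvd (u k * v l - u l * v k) * x" "int p dvd (u k * v l - u l * v k) * y"
      using du dv by (simp_all only: dvd_diff dvd_mult)
    then have "int p dvd x" "int p dvd y" using q minor prime_dvd_mult_iff by blast+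
    then have "\<alpha> k = \<beta> k" "\<alpha> l = \<beta> l"
      using solutions_eq_at[OF ab(1,2) P(2)] solutions_eq_at[OF ab(1,2) P(3)] by (simp_all add: x_def y_def)
    with eq have "\<alpha> m = \<beta> m" if "m \<in> P" for m using that by (cases "m = k \<or> m = l") auto
    with ab(1,2)[THEN solutions_PiE] show "\<alpha> = \<beta>" by (rule PiE_ext)
  qed (use P in \<open>auto simp: solutions_def\<close>)
  moreover have "card (P - {k, l}) = card P - 2" using P kl by (subst card_Diff_subset) auto
  ultimately show ?thesis by simp
qed

definition code_params :: "nat \<Rightarrow> nat \<Rightarrow> (nat \<Rightarrow> nat \<Rightarrow> int) set" where
  "code_params p t = {t+1..<2*t} \<rightarrow>\<^sub>E ({..<t+1} \<rightarrow>\<^sub>E {0..<int p})"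

lemma finite_code_params: "finite (code_params p t)"
  unfolding code_params_def by (intro finite_PiE) auto

lemma card_code_params: "card (code_params p t) = (p ^ (t + 1)) ^ (t - 1)"
  by (simp add: code_params_def card_PiE)

text \<open>Column \<open>n\<close> of \<open>x\<close> constrains only the row \<open>A n\<close>,
  by one congruence for each of the two matrix rows. The conditions for different \<open>n\<close>
  are independent, so the counts multiply over the \<open>t - 1\<close> dependent columns.\<close>

lemma card_codes_containing:
  assumes bound: "\<And>n. card (\<Inter>a. solutions p {..<t+1} (\<lambda>m. mat_column x m a) (mat_column x n a)) \<le> N"
  shows "card {A \<in> code_params p t. x \<in> code p t A} \<le> N ^ (t - 1)"
proof -
  define E where "E n = (\<Inter>a. solutions p {..<t+1} (\<lambda>m. mat_column x m a) (mat_column x n a))" for n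
  have fin: "finite (E n)" for n
    by (rule finite_subset[OF _ finite_solutions[of "{..<t+1}" p "\<lambda>m. mat_column x m 0" "mat_column x n 0"]])
      (auto simp: E_def)
  have "{A \<in> code_params p t. x \<in> code p t A} \<subseteq> PiE {t+1..<2*t} E"
  proof
    fix A assume A: "A \<in> {A \<in> code_params p t. x \<in> code p t A}"
    then have A1: "A \<in> {t+1..<2*t} \<rightarrow>\<^sub>E ({..<t+1} \<rightarrow>\<^sub>E {0..<int p})" unfolding code_params_def by blast
    show "A \<in> PiE {t+1..<2*t} E"
      unfolding PiE_iff
    proof (intro conjI ballI)
      show "A \<in> extensional {t+1..<2*t}" using A1 unfolding PiE_iff by blast
      fix n assume n: "n \<in> {t+1..<2*t}"
      then have "\<forall>a. mat_column x n a = (\<Sum>m<t+1. mat_column x m a * A n m) mod int p"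
        using A unfolding code_def by blast
      then show "A n \<in> E n" using PiE_mem[OF A1 n] unfolding E_def solutions_def by simp
    qed
  qed
  then have "card {A \<in> code_params p t. x \<in> code p t A} \<le> card (PiE {t+1..<2*t} E)"
    by (intro card_mono finite_PiE fin) auto
  also have "\<dots> = (\<Prod>n\<in>{t+1..<2*t}. card (E n))" by (intro card_PiE) simp
  also have "\<dots> \<le> (\<Prod>n\<in>{t+1..<2*t}. N)" using bound unfolding E_def by (intro prod_mono) auto
  also have "\<dots> = N ^ (t - 1)" by simp
  finally show ?thesis .
qed

text \<open>The vector \<open>(\<alpha>, \<beta>)\<close> is in the left kernel modulo \<open>p\<close> of the matrix with two rows and
  \<open>2 * t\<close> columns that \<open>x\<close> represents.\<close>

definition degenerate :: "nat \<Rightarrow> nat \<Rightarrow> (nat \<Rightarrow> 2 \<Rightarrow> 2 \<Rightarrow> int) \<Rightarrow> int \<Rightarrow> int \<Rightarrow> bool" where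
  "degenerate p t x \<alpha> \<beta> \<longleftrightarrow> (\<forall>i<t. \<forall>b. int p dvd \<alpha> * x i 0 b + \<beta> * x i 1 b)"

text \<open>The dependent columns are combinations of the first \<open>t + 1\<close>, so a relation
  between the two rows that holds there holds everywhere: for a vector of the code, the rank is
  visible in the free columns.\<close>

lemma code_dependence:
  assumes x: "x \<in> code p t A"
    and free: "\<And>m. m < t + 1 \<Longrightarrow> int p dvd \<alpha> * mat_column x m 0 + \<beta> * mat_column x m 1"
  shows "degenerate p t x \<alpha> \<beta>"
  unfolding degenerate_def
proof (intro allI impI)
  fix i b assume i: "i < t"
  have all: "int p dvd \<alpha> * mat_column x n 0 + \<beta> * mat_column x n 1" if "n < 2 * t" for n
  proof (cases "n < t + 1")
    case False
    then have n: "mat_column x n a = (\<Sum>m<t+1. mat_column x m a * A n m) mod int p" for a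
      using x that by (simp add: code_def)
    have "(\<alpha> * mat_column x n 0 + \<beta> * mat_column x n 1) mod int p
      = (\<alpha> * (\<Sum>m<t+1. mat_column x m 0 * A n m) + \<beta> * (\<Sum>m<t+1. mat_column x m 1 * A n m)) mod int p"
      unfolding n by (intro mod_add_cong mod_mult_cong) simp_all
    also have "\<alpha> * (\<Sum>m<t+1. mat_column x m 0 * A n m) + \<beta> * (\<Sum>m<t+1. mat_column x m 1 * A n m)
      = (\<Sum>m<t+1. (\<alpha> * mat_column x m 0 + \<beta> * mat_column x m 1) * A n m)"
      by (simp only: sum.distrib distrib_right sum_distrib_left mult.assoc)
    also have "\<dots> mod int p = 0"
      using free by (intro dvd_imp_mod_0 dvd_sum dvd_mult2) simp
    finally show ?thesis by (rule mod_0_imp_dvd)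
  qed (rule free)
  show "int p dvd \<alpha> * x i 0 b + \<beta> * x i 1 b"
    using two_cases[of b] all[of "2 * i"] all[of "2 * i + 1"] i by (auto simp: mat_column_def)
qed

text \<open>If \<open>x\<close> lies in some code at all, its rank 2 is visible in the first
  \<open>t + 1\<close> columns, where some minor is then nonzero. Each dependent column thus imposes
  two independent conditions on \<open>t + 1\<close> coefficients, which leaves
  \<open>p ^ (t - 1)\<close> choices.\<close>

lemma card_codes_nondegenerate:
  assumes p: "prime p" and t: "t \<ge> 1" and x: "x \<in> carrier (mat2_space p t)"
    and nd: "\<And>\<alpha> \<beta>. \<alpha> \<in> {0..<int p} \<Longrightarrow> \<beta> \<in> {0..<int p} \<Longrightarrow> degenerate p t x \<alpha> \<beta> \<Longrightarrow> \<alpha> = 0 \<and> \<beta> = 0"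
  shows "card {A \<in> code_params p t. x \<in> code p t A} \<le> (p ^ (t - 1)) ^ (t - 1)"
proof (cases "{A \<in> code_params p t. x \<in> code p t A} = {}")
  case False
  then obtain A where A: "x \<in> code p t A" by blast
  have p1: "p > 1" "prime (int p)" using p prime_gt_1_nat by auto
  let ?u = "\<lambda>m. mat_column x m 0" and ?v = "\<lambda>m. mat_column x m 1"
  have range: "mat_column x n a \<in> {0..<int p}" if "n < 2 * t" for n a
    using mat_column_in_range[OF x that, of a] by simp
  have "\<exists>k<t+1. \<exists>l<t+1. \<not> int p dvd ?u k * ?v l - ?u l * ?v k"
  proof (rule ccontr)
    assume "\<not> ?thesis"
    then have minors: "int p dvd ?u k * ?v l - ?u l * ?v k" if "k < t + 1" "l < t + 1" for k l
      using that by blast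
    show False
    proof (cases "\<forall>k<t+1. ?u k = 0")
      case True
      \<comment> \<open>If row 0 vanishes on the free columns, then (1, 0) is a left kernel
        vector.\<close>
      then have "degenerate p t x 1 0" using A by (intro code_dependence) auto
      then show False using nd[of 1 0] p1 by simp
    next
      case False
      then obtain k where k: "k < t + 1" "?u k \<noteq> 0" by blast
      \<comment> \<open>If all minors with column \<open>k\<close> vanish, then minus the lower
        entry and the upper entry of this column form a left kernel vector, which is nonzero because
        the upper entry is.\<close>
      have "degenerate p t x ((- ?v k) mod int p) (?u k)"
      proof (rule code_dependence[OF A])
        fix m assume m: "m < t + 1"
        have "((- ?v k) mod int p * ?u m + ?u k * ?v m) mod int p = ((- ?v k) * ?u m + ?u k * ?v m) mod int p"
          by (intro mod_add_cong mod_mult_cong) simp_all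
        also have "(- ?v k) * ?u m + ?u k * ?v m = ?u k * ?v m - ?u m * ?v k" by simp
        also have "\<dots> mod int p = 0" using minors[OF k(1) m] by (rule dvd_imp_mod_0)
        finally show "int p dvd (- ?v k) mod int p * ?u m + ?u k * ?v m" by (rule mod_0_imp_dvd)
      qed
      then show False using nd[of "(- ?v k) mod int p" "?u k"] range[of k 0] k p1 t by simp
    qed
  qed
  then obtain k l where kl: "k < t + 1" "l < t + 1" "\<not> int p dvd ?u k * ?v l - ?u l * ?v k" by blast
  have "(\<Inter>a. solutions p {..<t+1} (\<lambda>m. mat_column x m a) (mat_column x n a))
    = solutions p {..<t+1} ?u (?u n) \<inter> solutions p {..<t+1} ?v (?v n)" for n
    unfolding UNIV_2' by simp
  then show ?thesis
    using card_solutions_two[OF p1(2), of "{..<t+1}" k l ?u ?v] kl by (intro card_codes_containing) simp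
qed (simp only: card.empty le0)

text \<open>The argument for rank 2 with a single entry in place of a minor: a nonzero vector of a
  code has a nonzero entry in the free columns, and each dependent column imposes one
  condition.\<close>

lemma card_codes_nonzero:
  assumes p: "prime p" and t: "t \<ge> 1" and x: "x \<in> carrier (mat2_space p t)"
    and nz: "\<exists>n<2*t. \<exists>a. mat_column x n a \<noteq> 0"
  shows "card {A \<in> code_params p t. x \<in> code p t A} \<le> (p ^ t) ^ (t - 1)"
proof (cases "{A \<in> code_params p t. x \<in> code p t A} = {}")
  case False
  then obtain A where A: "x \<in> code p t A" by blast
  have p1: "p > 1" "prime (int p)" using p prime_gt_1_nat by auto
  have "\<exists>k<t+1. \<exists>a. mat_column x k a \<noteq> 0"
  proof (rule ccontr)
    assume "\<not> ?thesis"
    then have z: "mat_column x k a = 0" if "k < t + 1" for k a using that by blast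
    obtain n a where n: "n < 2 * t" "mat_column x n a \<noteq> 0" using nz by blast
    then have "n \<in> {t+1..<2*t}" using z by (metis atLeastLessThan_iff not_le_imp_less)
    then have "mat_column x n a = (\<Sum>m<t+1. mat_column x m a * A n m) mod int p"
      using A by (simp add: code_def)
    then show False using n z by simp
  qed
  then obtain k a where k: "k < t + 1" "mat_column x k a \<noteq> 0" by blast
  have nd: "\<not> int p dvd mat_column x k a"
    using mat_column_in_range[OF x, of k a] k t zdvd_not_zless[of "mat_column x k a" "int p"] by auto
  show ?thesis
  proof (rule card_codes_containing)
    fix n
    let ?S = "\<lambda>a. solutions p {..<t+1} (\<lambda>m. mat_column x m a) (mat_column x n a)"
    have "card (\<Inter>a. ?S a) \<le> card (?S a)" by (intro card_mono finite_solutions) auto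
    also have "\<dots> \<le> p ^ (t + 1 - 1)"
      using card_solutions_one[OF p1(2), of "{..<t+1}" k "\<lambda>m. mat_column x m a"] k nd by simp
    finally show "card (\<Inter>a. ?S a) \<le> p ^ t" by simp
  qed
qed (simp only: card.empty le0)

section \<open>Reduction of the Hurwitz order modulo a prime\<close>

lemma hurwitz_ring_sel:
  "carrier hurwitz_ring = hurwitz" "x \<otimes>\<^bsub>hurwitz_ring\<^esub> y = x * y" "\<one>\<^bsub>hurwitz_ring\<^esub> = 1"
  "x \<oplus>\<^bsub>hurwitz_ring\<^esub> y = x + y" "\<zero>\<^bsub>hurwitz_ring\<^esub> = 0"
  by (simp_all add: hurwitz_ring_def quat_ring_def)

lemma ring_hurwitz: "ring hurwitz_ring"
proof (intro ringI abelian_groupI monoidI)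
  show "\<exists>y\<in>carrier hurwitz_ring. y \<oplus>\<^bsub>hurwitz_ring\<^esub> x = \<zero>\<^bsub>hurwitz_ring\<^esub>" if "x \<in> carrier hurwitz_ring" for x
    using that by (intro bexI[of _ "- x"]) (simp_all add: hurwitz_ring_sel)
qed (simp_all add: hurwitz_ring_sel algebra_simps)

lemma hurwitz_ring_a_inv: "x \<in> hurwitz \<Longrightarrow> inv\<^bsub>add_monoid hurwitz_ring\<^esub> x = - x"
proof -
  assume x: "x \<in> hurwitz"
  have "group (add_monoid hurwitz_ring)"
    using ring_hurwitz abelian_group.a_group ring.is_abelian_group by blast
  then show ?thesis by (rule group.inv_equality) (use x in \<open>simp_all add: hurwitz_ring_sel\<close>)
qed

lemma ideal_p_ideal: "ideal (p_ideal p) hurwitz_ring"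
proof (rule idealI[OF ring_hurwitz])
  show "subgroup (p_ideal p) (add_monoid hurwitz_ring)"
  proof (rule subgroup.intro)
    show "p_ideal p \<subseteq> carrier (add_monoid hurwitz_ring)"
      by (auto simp: p_ideal_def hurwitz_ring_sel)
    show "x \<otimes>\<^bsub>add_monoid hurwitz_ring\<^esub> y \<in> p_ideal p" if xy: "x \<in> p_ideal p" "y \<in> p_ideal p" for x y
    proof -
      obtain a b where "a \<in> hurwitz" "b \<in> hurwitz" "x = of_nat p * a" "y = of_nat p * b"
        using xy unfolding p_ideal_def by blast
      then show ?thesis
        unfolding p_ideal_def by (intro CollectI exI[of _ "a + b"]) (simp add: hurwitz_ring_sel distrib_left)
    qed
    show "\<one>\<^bsub>add_monoid hurwitz_ring\<^esub> \<in> p_ideal p"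
      unfolding p_ideal_def by (intro CollectI exI[of _ 0]) (simp add: hurwitz_ring_sel)
    show "inv\<^bsub>add_monoid hurwitz_ring\<^esub> x \<in> p_ideal p" if x: "x \<in> p_ideal p" for x
    proof -
      obtain a where "a \<in> hurwitz" "x = of_nat p * a" using x unfolding p_ideal_def by blast
      then show ?thesis
        unfolding p_ideal_def
        by (intro CollectI exI[of _ "- a"]) (subst hurwitz_ring_a_inv; simp)
    qed
  qed
  fix a x assume a: "a \<in> p_ideal p" and x: "x \<in> carrier hurwitz_ring"
  obtain b where b: "b \<in> hurwitz" "a = of_nat p * b" using a unfolding p_ideal_def by blast
  have "x * a = of_nat p * (x * b)" using b by (metis mult.assoc mult_of_nat_commute)
  then show "x \<otimes>\<^bsub>hurwitz_ring\<^esub> a \<in> p_ideal p"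
    unfolding p_ideal_def using b x by (intro CollectI exI[of _ "x * b"]) (simp add: hurwitz_ring_sel)
  have "a * x = of_nat p * (b * x)" using b by (simp add: mult.assoc)
  then show "a \<otimes>\<^bsub>hurwitz_ring\<^esub> x \<in> p_ideal p"
    unfolding p_ideal_def using b x by (intro CollectI exI[of _ "b * x"]) (simp add: hurwitz_ring_sel)
qed

text \<open>The quotient map followed by the matrix isomorphism, entry by entry and with reduced
  residues as values, so that later arguments deal with integer congruences instead of
  cosets.\<close>

locale hurwitz_reduction =
  fixes p :: nat and \<phi> :: "quat \<Rightarrow> 2 \<Rightarrow> 2 \<Rightarrow> int"
  assumes prime_p: "prime p"
    and range: "h \<in> hurwitz \<Longrightarrow> \<phi> h a b \<in> {0..<int p}"
    and add: "h \<in> hurwitz \<Longrightarrow> k \<in> hurwitz \<Longrightarrow> \<phi> (h + k) a b = (\<phi> h a b + \<phi> k a b) mod int p"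
    and mult: "h \<in> hurwitz \<Longrightarrow> k \<in> hurwitz \<Longrightarrow>
      \<phi> (h * k) a b = (\<phi> h a 0 * \<phi> k 0 b + \<phi> h a 1 * \<phi> k 1 b) mod int p"
    and one: "\<phi> 1 a b = (if a = b then 1 else 0)"
    and ker: "h \<in> hurwitz \<Longrightarrow> (\<And>a b. \<phi> h a b = 0) \<Longrightarrow> \<exists>k\<in>hurwitz. h = of_nat p * k"

lemma hurwitz_reductionI:
  assumes p: "prime p" and \<sigma>: "\<sigma> \<in> ring_iso (hurwitz_ring Quot p_ideal p) (mat2_mod p)"
  shows "hurwitz_reduction p (\<lambda>h. \<sigma> (p_ideal p +>\<^bsub>hurwitz_ring\<^esub> h))"
proof -
  let ?Q = "hurwitz_ring Quot p_ideal p"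
  define \<phi> where "\<phi> h = \<sigma> (p_ideal p +>\<^bsub>hurwitz_ring\<^esub> h)" for h
  have p1: "p > 1" using p prime_gt_1_nat by blast
  interpret ideal "p_ideal p" hurwitz_ring by (rule ideal_p_ideal)
  have \<sigma>_hom: "\<sigma> \<in> ring_hom ?Q (mat2_mod p)" and \<sigma>_inj: "inj_on \<sigma> (carrier ?Q)"
    using \<sigma> by (auto simp: ring_iso_def bij_betw_def)
  have \<pi>: "(+>\<^bsub>hurwitz_ring\<^esub>) (p_ideal p) \<in> ring_hom hurwitz_ring ?Q" by (rule rcos_ring_hom)
  have \<phi>: "\<phi> \<in> ring_hom hurwitz_ring (mat2_mod p)"
    using ring_hom_trans[OF \<pi> \<sigma>_hom] by (simp add: \<phi>_def[abs_def] comp_def)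
  have mat_sel: "carrier (mat2_mod p) = {A. \<forall>a b. A a b \<in> {0..int p - 1}}"
    "A \<oplus>\<^bsub>mat2_mod p\<^esub> B = (\<lambda>a b. (A a b + B a b) mod int p)"
    "A \<otimes>\<^bsub>mat2_mod p\<^esub> B = (\<lambda>a b. (A a 0 * B 0 b + A a 1 * B 1 b) mod int p)"
    "\<one>\<^bsub>mat2_mod p\<^esub> = (\<lambda>a b. if a = b then 1 else 0)" for A B
    using p1 by (simp_all add: mat2_mod_def matrix_ring_def finsum_residue_ring_2)
      (simp_all add: residue_ring_sel cong: if_cong)
  have "hurwitz_reduction p \<phi>"
  proof
    show "prime p" by (rule p)
  next
    fix h a b assume "h \<in> hurwitz"
    then have "\<phi> h \<in> carrier (mat2_mod p)" using ring_hom_memE(1)[OF \<phi>] by (simp add: hurwitz_ring_sel)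
    then show "\<phi> h a b \<in> {0..<int p}" by (simp add: mat_sel)
  next
    fix h k a b assume "h \<in> hurwitz" "k \<in> hurwitz"
    then show "\<phi> (h + k) a b = (\<phi> h a b + \<phi> k a b) mod int p"
      "\<phi> (h * k) a b = (\<phi> h a 0 * \<phi> k 0 b + \<phi> h a 1 * \<phi> k 1 b) mod int p"
      using ring_hom_memE(2,3)[OF \<phi>, of h k] by (simp_all add: hurwitz_ring_sel mat_sel)
  next
    show "\<phi> 1 a b = (if a = b then 1 else 0)" for a b
      using ring_hom_memE(4)[OF \<phi>] by (simp add: hurwitz_ring_sel mat_sel)
  next
    fix h assume h: "h \<in> hurwitz" and z: "\<And>a b. \<phi> h a b = 0"
    \<comment> \<open>As \<open>\<phi> h\<close> is zero, this identifies \<open>\<phi> h\<close>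
      with \<open>\<phi> 0\<close>; injectivity of \<open>\<sigma>\<close> then makes the cosets of
      \<open>h\<close> and 0 equal.\<close>
    have "\<phi> (h + 0) = (\<lambda>a b. (\<phi> h a b + \<phi> 0 a b) mod int p)"
      using ring_hom_memE(3)[OF \<phi>, of h 0] h by (simp add: hurwitz_ring_sel mat_sel)
    moreover have "\<phi> 0 a b \<in> {0..int p - 1}" for a b
      using ring_hom_memE(1)[OF \<phi>, of 0] by (simp add: hurwitz_ring_sel mat_sel)
    then have "\<phi> 0 a b mod int p = \<phi> 0 a b" for a b by simp
    ultimately have "\<phi> h = \<phi> 0" using z by (simp add: fun_eq_iff)
    moreover have "p_ideal p +>\<^bsub>hurwitz_ring\<^esub> k \<in> carrier ?Q" if "k \<in> hurwitz" for k
      using ring_hom_memE(1)[OF \<pi>, of k] that by (simp add: hurwitz_ring_sel)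
    ultimately have eq: "p_ideal p +>\<^bsub>hurwitz_ring\<^esub> h = p_ideal p +>\<^bsub>hurwitz_ring\<^esub> 0"
      using \<sigma>_inj h unfolding \<phi>_def by (meson hurwitz_0 inj_onD)
    have coset: "p_ideal p +>\<^bsub>hurwitz_ring\<^esub> k = {i + k | i. i \<in> p_ideal p}" for k
      by (auto simp: a_r_coset_def' hurwitz_ring_sel)
    have "0 \<in> p_ideal p" unfolding p_ideal_def by (intro CollectI exI[of _ 0]) simp
    then have "0 + h \<in> p_ideal p +>\<^bsub>hurwitz_ring\<^esub> h" unfolding coset by blast
    then have "h \<in> p_ideal p" unfolding eq unfolding coset by auto
    then show "\<exists>k\<in>hurwitz. h = of_nat p * k" unfolding p_ideal_def by blast
  qed
  then show ?thesis by (simp add: \<phi>_def[abs_def])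
qed

context hurwitz_reduction
begin

lemma p_gt_1: "p > 1" using prime_p prime_gt_1_nat by blast

lemma map_0: "\<phi> 0 a b = 0"
proof -
  have "\<phi> 0 a b = (\<phi> 0 a b + \<phi> 0 a b) mod int p" using add[of 0 0 a b] by simp
  moreover have r: "\<phi> 0 a b \<in> {0..<int p}" by (rule range) simp
  ultimately have "int p dvd (\<phi> 0 a b + \<phi> 0 a b) - \<phi> 0 a b"
    by (metis mod_eq_dvd_iff mod_mod_trivial)
  then show ?thesis using residue_eqI[OF r, of 0] p_gt_1 by simp
qed

lemma map_of_nat_mult: "h \<in> hurwitz \<Longrightarrow> \<phi> (of_nat n * h) a b = (int n * \<phi> h a b) mod int p"
proof (induction n)
  case (Suc n)
  have "\<phi> (of_nat (Suc n) * h) a b = \<phi> (h + of_nat n * h) a b"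
    by (simp add: distrib_right)
  also have "\<dots> = (\<phi> h a b + (int n * \<phi> h a b) mod int p) mod int p"
    using Suc by (simp add: add)
  also have "\<dots> = (int (Suc n) * \<phi> h a b) mod int p"
    by (simp add: mod_simps algebra_simps)
  finally show ?case .
qed (simp add: map_0)

lemma map_p_mult: "h \<in> hurwitz \<Longrightarrow> \<phi> (of_nat p * h) a b = 0"
  by (simp add: map_of_nat_mult)

text \<open>The right ideal of those \<open>h\<close> whose reduction is annihilated from the left
  by the row (\<open>\<alpha>\<close>, \<open>\<beta>\<close>). The reduction of a Hurwitz vector is
  \<open>degenerate\<close> for this row exactly if all coordinates lie in the ideal.\<close>

definition singular_ideal :: "int \<Rightarrow> int \<Rightarrow> quat set" where
  "singular_ideal \<alpha> \<beta> = {h \<in> hurwitz. \<forall>b. int p dvd \<alpha> * \<phi> h 0 b + \<beta> * \<phi> h 1 b}"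

text \<open>Closure under differences turns a lower bound for nonzero norms into one for distances,
  as the packing argument requires.\<close>

lemma singular_ideal_diff:
  assumes "h \<in> singular_ideal \<alpha> \<beta>" "k \<in> singular_ideal \<alpha> \<beta>"
  shows "h - k \<in> singular_ideal \<alpha> \<beta>"
  unfolding singular_ideal_def
proof (intro CollectI conjI allI)
  have hk: "h \<in> hurwitz" "k \<in> hurwitz" using assms by (auto simp: singular_ideal_def)
  then show hk': "h - k \<in> hurwitz" by simp
  fix b
  have "\<phi> h a b = (\<phi> (h - k) a b + \<phi> k a b) mod int p" for a
    using add[OF hk' hk(2), of a b] by simp
  then have "(\<alpha> * \<phi> h 0 b + \<beta> * \<phi> h 1 b) mod int p
    = (\<alpha> * (\<phi> (h - k) 0 b + \<phi> k 0 b) + \<beta> * (\<phi> (h - k) 1 b + \<phi> k 1 b)) mod int p"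
    by (intro mod_add_cong mod_mult_cong) simp_all
  also have "\<dots> = ((\<alpha> * \<phi> (h - k) 0 b + \<beta> * \<phi> (h - k) 1 b) + (\<alpha> * \<phi> k 0 b + \<beta> * \<phi> k 1 b)) mod int p"
    by (simp add: algebra_simps)
  finally have "int p dvd (\<alpha> * \<phi> h 0 b + \<beta> * \<phi> h 1 b) -
    ((\<alpha> * \<phi> (h - k) 0 b + \<beta> * \<phi> (h - k) 1 b) + (\<alpha> * \<phi> k 0 b + \<beta> * \<phi> k 1 b))"
    by (rule mod_eq_dvd_iff[THEN iffD1])
  moreover have "int p dvd \<alpha> * \<phi> h 0 b + \<beta> * \<phi> h 1 b" "int p dvd \<alpha> * \<phi> k 0 b + \<beta> * \<phi> k 1 b"
    using assms by (auto simp: singular_ideal_def)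
  ultimately show "int p dvd \<alpha> * \<phi> (h - k) 0 b + \<beta> * \<phi> (h - k) 1 b"
    by (metis dvd_add_left_iff dvd_diff_commute dvd_add_right_iff diff_add_cancel)
qed

text \<open>If the reduction of \<open>h\<close> is singular, then so is that of the reduced norm, as a scalar matrix.\<close>

lemma singular_ideal_norm_ge:
  assumes h: "h \<in> singular_ideal \<alpha> \<beta>" "h \<noteq> 0"
    and ab: "\<alpha> \<in> {0..<int p}" "\<beta> \<in> {0..<int p}" "\<alpha> \<noteq> 0 \<or> \<beta> \<noteq> 0"
  shows "norm h \<ge> sqrt (real p)"
proof -
  have hh: "h \<in> hurwitz" and sing: "\<And>b. int p dvd \<alpha> * \<phi> h 0 b + \<beta> * \<phi> h 1 b"
    using h by (auto simp: singular_ideal_def)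
  obtain n where n: "(norm h)\<^sup>2 = real n" using hurwitz_norm_sq_nat[OF hh] by blast
  \<comment> \<open>The product of \<open>h\<close> and its conjugate reduces to \<open>n\<close>
    times the identity. The row (\<open>\<alpha>\<close>, \<open>\<beta>\<close>) kills this matrix
    because it kills \<open>\<phi> h\<close>, and as one of its entries is invertible,
    \<open>p\<close> divides \<open>n\<close>.\<close>
  have nd: "h * quat_cnj h = of_nat n * 1"
    unfolding quat_cnj_mult n by (simp add: of_real_of_nat_eq)
  have "int p dvd int n * (\<alpha> * (if b = 0 then 1 else 0) + \<beta> * (if b = 1 then 1 else 0))" for b :: 2
  proof -
    have "\<phi> (h * quat_cnj h) a b = (\<phi> h a 0 * \<phi> (quat_cnj h) 0 b + \<phi> h a 1 * \<phi> (quat_cnj h) 1 b) mod int p" for a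
      using hh by (simp add: mult)
    moreover have "\<phi> (h * quat_cnj h) a b = (int n * (if a = b then 1 else 0)) mod int p" for a
      unfolding nd map_of_nat_mult[OF hurwitz_1] one ..
    ultimately have *: "(int n * (if a = b then 1 else 0)) mod int p
      = (\<phi> h a 0 * \<phi> (quat_cnj h) 0 b + \<phi> h a 1 * \<phi> (quat_cnj h) 1 b) mod int p" for a
      by simp
    have "(\<alpha> * (int n * (if 0 = b then 1 else 0)) + \<beta> * (int n * (if 1 = b then 1 else 0))) mod int p
      = (\<alpha> * (\<phi> h 0 0 * \<phi> (quat_cnj h) 0 b + \<phi> h 0 1 * \<phi> (quat_cnj h) 1 b)
        + \<beta> * (\<phi> h 1 0 * \<phi> (quat_cnj h) 0 b + \<phi> h 1 1 * \<phi> (quat_cnj h) 1 b)) mod int p"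
      by (intro mod_add_cong mod_mult_cong *) simp_all
    also have "\<dots> = ((\<alpha> * \<phi> h 0 0 + \<beta> * \<phi> h 1 0) * \<phi> (quat_cnj h) 0 b
        + (\<alpha> * \<phi> h 0 1 + \<beta> * \<phi> h 1 1) * \<phi> (quat_cnj h) 1 b) mod int p"
      by (simp add: algebra_simps)
    also have "\<dots> = 0"
      by (intro dvd_imp_mod_0 dvd_add dvd_mult2 sing)
    finally have "int p dvd \<alpha> * (int n * (if 0 = b then 1 else 0)) + \<beta> * (int n * (if 1 = b then 1 else 0))"
      by (rule mod_0_imp_dvd)
    also have "\<alpha> * (int n * (if 0 = b then 1 else 0)) + \<beta> * (int n * (if 1 = b then 1 else 0))
      = int n * (\<alpha> * (if b = 0 then 1 else 0) + \<beta> * (if b = 1 then 1 else 0))" by auto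
    finally show ?thesis .
  qed
  from this[of 0] this[of 1] have "int p dvd int n * \<alpha>" "int p dvd int n * \<beta>" by simp_all
  moreover have "\<not> int p dvd \<gamma>" if "\<gamma> \<in> {0..<int p}" "\<gamma> \<noteq> 0" for \<gamma>
    using that zdvd_not_zless[of \<gamma> "int p"] by auto
  moreover have "prime (int p)" using prime_p by simp
  ultimately have "int p dvd int n" using ab prime_dvd_mult_iff by metis
  moreover have "n > 0" using n h(2) by (cases n) auto
  ultimately have "p \<le> n" by (simp add: dvd_imp_le)
  then have "sqrt (real p) \<le> sqrt ((norm h)\<^sup>2)" unfolding n by simp
  then show ?thesis by simp
qed

section \<open>The lattices of the codes before scaling\<close>

definition reduce :: "nat \<Rightarrow> (nat \<Rightarrow> quat) \<Rightarrow> nat \<Rightarrow> 2 \<Rightarrow> 2 \<Rightarrow> int" where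
  "reduce t x = (\<lambda>i\<in>{..<t}. \<phi> (x i))"

definition code_lattice :: "nat \<Rightarrow> (nat \<Rightarrow> nat \<Rightarrow> int) \<Rightarrow> (nat \<Rightarrow> quat) set" where
  "code_lattice t A = {x \<in> carrier (hurwitz_power t). reduce t x \<in> code p t A}"

lemma reduce_in_space: "x \<in> carrier (hurwitz_power t) \<Longrightarrow> reduce t x \<in> carrier (mat2_space p t)"
  using range by (auto simp: reduce_def mat2_space_sel restrict_PiE_iff hurwitz_power_sel PiE_iff)

lemma code_lattice_smult:
  assumes "c \<in> hurwitz" "x \<in> code_lattice t A" "t \<ge> 1"
  shows "(\<lambda>i\<in>{..<t}. c * x i) \<in> code_lattice t A"
proof -
  have x: "x i \<in> hurwitz" if "i < t" for i
    using assms(2) that by (auto simp: code_lattice_def hurwitz_power_sel PiE_iff)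
  have "reduce t (\<lambda>i\<in>{..<t}. c * x i)
    = (\<lambda>i\<in>{..<t}. \<lambda>a b. (\<phi> c a 0 * reduce t x i 0 b + \<phi> c a 1 * reduce t x i 1 b) mod int p)"
    unfolding reduce_def by (rule restrict_ext) (use x assms(1) in \<open>auto simp: mult fun_eq_iff\<close>)
  also have "\<dots> \<in> code p t A"
    using assms p_gt_1 by (intro code_smult) (auto simp: code_lattice_def)
  finally show ?thesis
    using x assms(1) by (simp add: code_lattice_def hurwitz_power_sel restrict_PiE_iff)
qed

lemma code_lattice_add:
  assumes "x \<in> code_lattice t A" "y \<in> code_lattice t A" "t \<ge> 1"
  shows "(\<lambda>i\<in>{..<t}. x i + y i) \<in> code_lattice t A"
proof -
  have xy: "x i \<in> hurwitz" "y i \<in> hurwitz" if "i < t" for i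
    using assms(1,2) that by (auto simp: code_lattice_def hurwitz_power_sel PiE_iff)
  have "reduce t (\<lambda>i\<in>{..<t}. x i + y i)
    = (\<lambda>i\<in>{..<t}. \<lambda>a b. (reduce t x i a b + reduce t y i a b) mod int p)"
    unfolding reduce_def by (rule restrict_ext) (use xy in \<open>auto simp: add fun_eq_iff\<close>)
  also have "\<dots> \<in> code p t A"
    using assms p_gt_1 by (intro code_add) (auto simp: code_lattice_def)
  finally show ?thesis
    using xy by (simp add: code_lattice_def hurwitz_power_sel restrict_PiE_iff)
qed

text \<open>The lattice contains \<open>p\<close> times each standard vector, since these reduce to
  zero, so it has full rank; a basis then exists because left ideals of the order are
  principal.\<close>

lemma code_lattice_basis:
  assumes t: "t \<ge> 1"
  obtains b where "left_independent t t b" "code_lattice t A = hurwitz_span t b"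
proof (rule hurwitz_submodule_basis[of t "code_lattice t A"])
  show "t > 0" using t by simp
  show "code_lattice t A \<subseteq> {..<t} \<rightarrow>\<^sub>E hurwitz" by (auto simp: code_lattice_def hurwitz_power_sel)
  show smult: "(\<lambda>i\<in>{..<t}. c * x i) \<in> code_lattice t A" if "c \<in> hurwitz" "x \<in> code_lattice t A" for c x
    using that t by (rule code_lattice_smult)
  show "(\<lambda>i\<in>{..<t}. x i - y i) \<in> code_lattice t A" if xy: "x \<in> code_lattice t A" "y \<in> code_lattice t A" for x y
  proof -
    have "(\<lambda>i\<in>{..<t}. x i + (\<lambda>i\<in>{..<t}. (- 1) * y i) i) \<in> code_lattice t A"
      by (rule code_lattice_add[OF xy(1) smult[OF _ xy(2)] t]) simp
    also have "(\<lambda>i\<in>{..<t}. x i + (\<lambda>i\<in>{..<t}. (- 1) * y i) i) = (\<lambda>i\<in>{..<t}. x i - y i)"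
      by (rule restrict_ext) simp
    finally show ?thesis .
  qed
  show "\<exists>a. a \<noteq> 0 \<and> (\<lambda>i\<in>{..<t}. if i = k then a else 0) \<in> code_lattice t A" if "k < t" for k
  proof (intro exI[of _ "of_nat p"] conjI)
    show "(of_nat p :: quat) \<noteq> 0" using p_gt_1 by simp
    have "reduce t (\<lambda>i\<in>{..<t}. if i = k then of_nat p else 0) = (\<lambda>i\<in>{..<t}. \<lambda>a b. 0)"
      unfolding reduce_def using map_p_mult[OF hurwitz_1]
      by (intro restrict_ext) (auto simp: map_0 fun_eq_iff)
    moreover have "(\<lambda>i\<in>{..<t}. \<lambda>a b. 0) \<in> code p t A"
      using p_gt_1 t by (simp add: code_def mat2_space_sel restrict_PiE_iff mat_column_restrict) (simp add: mat_column_def)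
    ultimately show "(\<lambda>i\<in>{..<t}. if i = k then of_nat p else 0) \<in> code_lattice t A"
      by (simp add: code_lattice_def hurwitz_power_sel restrict_PiE_iff)
  qed
qed (use that in blast)

end

section \<open>The weight function\<close>

text \<open>The norm at which the uncut weight takes the value \<open>s\<close>. In dimension
  \<open>4 * t\<close> the division by 4 gives the ball of this radius
  \<open>exp (1 - t * s)\<close> times the volume of the ball of radius \<open>r\<close>.\<close>

definition level :: "nat \<Rightarrow> real \<Rightarrow> real \<Rightarrow> real" where
  "level t r s = r * exp ((1 / t - s) / 4)"

definition weight :: "nat \<Rightarrow> real \<Rightarrow> real \<Rightarrow> real" where
  "weight t r N = max 0 (min 1 (1 / t - 4 * ln (N / r)))"

lemma weight_nonneg: "0 \<le> weight t r N" and weight_le_1: "weight t r N \<le> 1"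
  by (simp_all add: weight_def)

lemma less_level_iff:
  assumes "r > 0" "N > 0"
  shows "N < level t r s \<longleftrightarrow> s < 1 / t - 4 * ln (N / r)"
proof -
  have "N < level t r s \<longleftrightarrow> N / r < exp ((1 / t - s) / 4)"
    using assms by (simp add: level_def field_simps)
  also have "\<dots> \<longleftrightarrow> ln (N / r) < (1 / t - s) / 4"
    using assms by (metis divide_pos_pos exp_less_cancel_iff exp_ln)
  also have "\<dots> \<longleftrightarrow> s < 1 / t - 4 * ln (N / r)" by (simp add: field_simps)
  finally show ?thesis .
qed

text \<open>A number cut off to the interval from 0 to 1 is the length of the part of this interval
  below it; then sum and integral are exchanged.\<close>

lemma weight_layer_cake:
  assumes "finite X" "r > 0" "\<And>x. x \<in> X \<Longrightarrow> N x > 0"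
  shows "ennreal (\<Sum>x\<in>X. weight t r (N x))
    = (\<integral>\<^sup>+s. of_nat (card {x \<in> X. N x < level t r s}) * indicator {0..1} s \<partial>lborel)"
proof -
  have one: "ennreal (weight t r (N x)) = (\<integral>\<^sup>+s. indicator {..<1 / t - 4 * ln (N x / r)} s * indicator {0..1} s \<partial>lborel)"
    if "x \<in> X" for x
  proof -
    define h where "h = 1 / t - 4 * ln (N x / r)"
    have "(\<integral>\<^sup>+s. indicator {..<h} s * indicator {0..1::real} s \<partial>lborel) = (\<integral>\<^sup>+s. indicator ({..<h} \<inter> {0..1}) s \<partial>lborel)"
      by (simp only: indicator_inter_arith)
    also have "\<dots> = emeasure lborel ({..<h} \<inter> {0..1::real})" by (rule nn_integral_indicator) simp
    also have "\<dots> = ennreal (max 0 (min 1 h))"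
    proof (cases "h > 1")
      case True
      then have "{..<h} \<inter> {0..1::real} = {0..1}" by auto
      then show ?thesis using True by simp
    next
      case False
      then have "{..<h} \<inter> {0..1::real} = {0..<h}" by auto
      then show ?thesis using False by (cases "h \<ge> 0") auto
    qed
    finally show ?thesis by (simp add: weight_def h_def)
  qed
  have "ennreal (\<Sum>x\<in>X. weight t r (N x)) = (\<Sum>x\<in>X. ennreal (weight t r (N x)))"
    by (rule sum_ennreal[symmetric]) (rule weight_nonneg)
  also have "\<dots> = (\<Sum>x\<in>X. \<integral>\<^sup>+s. indicator {..<1 / t - 4 * ln (N x / r)} s * indicator {0..1} s \<partial>lborel)"
    by (rule sum.cong) (simp_all add: one)
  also have "\<dots> = (\<integral>\<^sup>+s. (\<Sum>x\<in>X. indicator {..<1 / t - 4 * ln (N x / r)} s * indicator {0..1} s) \<partial>lborel)"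
    by (rule nn_integral_sum[symmetric]) measurable
  also have "\<dots> = (\<integral>\<^sup>+s. of_nat (card {x \<in> X. N x < level t r s}) * indicator {0..1} s \<partial>lborel)"
  proof (rule nn_integral_cong)
    fix s :: real
    have "(\<Sum>x\<in>X. indicator {..<1 / t - 4 * ln (N x / r)} s * indicator {0..1} s :: ennreal)
      = (\<Sum>x\<in>X. if N x < level t r s then 1 else 0) * indicator {0..1} s"
      unfolding sum_distrib_right using assms(2,3)
      by (intro sum.cong) (simp_all add: less_level_iff indicator_def)
    also have "(\<Sum>x\<in>X. if N x < level t r s then 1 else 0 :: ennreal) = of_nat (card {x \<in> X. N x < level t r s})"
      using assms(1) by (simp add: sum.If_cases Int_def)
    finally show "(\<Sum>x\<in>X. indicator {..<1 / t - 4 * ln (N x / r)} s * indicator {0..1} s :: ennreal)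
      = of_nat (card {x \<in> X. N x < level t r s}) * indicator {0..1} s" .
  qed
  finally show ?thesis .
qed

text \<open>\<open>exp 1 * (1 - exp (- t)) / t\<close> is the integral of
  \<open>exp (1 - t * s)\<close> over the levels \<open>s\<close> from 0 to 1; this is the origin of
  the denominator in the volume that defines \<open>r\<close>.\<close>

lemma weight_sum_upper:
  assumes X: "finite X" "r > 0" "\<And>x. x \<in> X \<Longrightarrow> N x > 0" and t: "t \<ge> 1" and K: "K \<ge> 0"
    and count: "\<And>s. 0 \<le> s \<Longrightarrow> s \<le> 1 \<Longrightarrow> real (card {x \<in> X. N x < level t r s}) \<le> K * exp (1 - real t * s)"
  shows "(\<Sum>x\<in>X. weight t r (N x)) \<le> K * (exp 1 * (1 - exp (- real t)) / t)"
proof -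
  define P where "P s = - (exp (1 - real t * s) / t)" for s :: real
  have "ennreal (\<Sum>x\<in>X. weight t r (N x))
    = (\<integral>\<^sup>+s. of_nat (card {x \<in> X. N x < level t r s}) * indicator {0..1} s \<partial>lborel)"
    by (rule weight_layer_cake[OF X])
  also have "\<dots> \<le> (\<integral>\<^sup>+s. ennreal (K * exp (1 - real t * s)) * indicator {0..1} s \<partial>lborel)"
  proof (rule nn_integral_mono)
    fix s :: real
    show "of_nat (card {x \<in> X. N x < level t r s}) * indicator {0..1} s
      \<le> ennreal (K * exp (1 - real t * s)) * indicator {0..1} s"
    proof (cases "s \<in> {0..1}")
      case True
      then have "ennreal (real (card {x \<in> X. N x < level t r s})) \<le> ennreal (K * exp (1 - real t * s))"
        using count by (intro ennreal_leI) auto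
      with True show ?thesis by (simp add: ennreal_of_nat_eq_real_of_nat)
    qed simp
  qed
  also have "\<dots> = ennreal (K * P 1 - K * P 0)"
  proof (rule nn_integral_FTC_Icc)
    show "DERIV (\<lambda>s. K * P s) s :> K * exp (1 - real t * s)" for s
      unfolding P_def using t by (auto intro!: derivative_eq_intros simp: field_simps)
  qed (use K in auto)
  also have "K * P 1 - K * P 0 = K * (exp 1 * (1 - exp (- real t)) / t)"
    unfolding P_def using t by (simp add: field_simps flip: exp_add)
  finally have "ennreal (\<Sum>x\<in>X. weight t r (N x)) \<le> ennreal (K * (exp 1 * (1 - exp (- real t)) / t))" .
  moreover have "0 \<le> K * (exp 1 * (1 - exp (- real t)) / t)" using K by simp
  ultimately show ?thesis by (simp only: ennreal_le_iff)
qed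

section \<open>Quaternionic minima\<close>

lemma left_independent_nonzero:
  assumes "left_independent t j v" "k < j"
  shows "vec_norm t (v k) > 0"
proof (rule ccontr)
  assume "\<not> vec_norm t (v k) > 0"
  then have z: "vec_norm t (v k) = 0" using vec_norm_nonneg[of t "v k"] by linarith
  have v: "v k i = 0" if "i < t" for i
    using vec_norm_ge_coordinate[OF that, of "v k"] z by simp
  have "(\<Sum>l<j. (if l = k then 1 else 0) * v l i) = 0" if "i < t" for i
    using v[OF that] by (intro sum.neutral) auto
  from left_independentD[OF assms(1) this assms(2)] show False by simp
qed

lemma left_independent_mono:
  assumes "left_independent t j v" "l \<le> j"
  shows "left_independent t l v"
  unfolding left_independent_def
proof (intro allI impI)
  fix c k assume c: "\<forall>i<t. (\<Sum>k<l. c k * v k i) = 0" and k: "k < l"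
  have "(\<Sum>k<j. (if k < l then c k else 0) * v k i) = (\<Sum>k<l. c k * v k i)" for i
    using assms(2) by (intro sum.mono_neutral_cong_right) auto
  then show "c k = 0"
    using left_independentD[OF assms(1), of "\<lambda>k. if k < l then c k else 0" k] c k assms(2) by auto
qed

text \<open>The products of \<open>j\<close> independent vectors with the 24 units are distinct.\<close>

lemma unit_multiples_count:
  assumes v: "left_independent t j v" "\<And>k. k < j \<Longrightarrow> v k \<in> \<Lambda> \<and> vec_norm t (v k) < \<rho>"
    and unit: "\<And>u x. u \<in> hurwitz \<Longrightarrow> x \<in> \<Lambda> \<Longrightarrow> (\<lambda>i\<in>{..<t}. u * x i) \<in> \<Lambda>"
    and fin: "finite {x \<in> \<Lambda>. 0 < vec_norm t x \<and> vec_norm t x < \<rho>}"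
  shows "24 * j \<le> card {x \<in> \<Lambda>. 0 < vec_norm t x \<and> vec_norm t x < \<rho>}"
proof -
  obtain U where U: "U \<subseteq> hurwitz_units" "finite U" "card U = 24" using card_hurwitz_units_ge by blast
  have Uu: "u \<in> hurwitz" "norm u = 1" if "u \<in> U" for u using that U by (auto simp: hurwitz_units_def)
  define f where "f = (\<lambda>(u, k). \<lambda>i\<in>{..<t}. u * v k i)"
  have inj: "inj_on f (U \<times> {..<j})"
  proof (rule inj_onI, clarify)
    fix u k w l assume uw: "u \<in> U" "k < j" "w \<in> U" "l < j" and eq: "f (u, k) = f (w, l)"
    have eq': "u * v k i = w * v l i" if "i < t" for i
      using fun_cong[OF eq, of i] that by (simp add: f_def)
    \<comment> \<open>If two multiples agree, \<open>c\<close> is a dependence whose coefficient at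
      \<open>k\<close> is \<open>u\<close>, or \<open>u - w\<close> in case \<open>k = l\<close>. It
      must vanish while \<open>u\<close> does not, so both indices and units agree.\<close>
    define c where "c m = (if m = k then u else 0) - (if m = l then w else 0)" for m
    have "(\<Sum>m<j. c m * v m i) = 0" if "i < t" for i
    proof -
      have "(\<Sum>m<j. c m * v m i) = (\<Sum>m<j. if m = k then u * v m i else 0) - (\<Sum>m<j. if m = l then w * v m i else 0)"
        unfolding sum_subtractf[symmetric] by (intro sum.cong) (auto simp: c_def left_diff_distrib)
      then show ?thesis using uw eq'[OF that] by simp
    qed
    then have "c k = 0" using left_independentD[OF v(1) _ uw(2), of c] by blast
    moreover have "u \<noteq> 0" using Uu[OF uw(1)] by auto
    ultimately show "u = w \<and> k = l" by (auto simp: c_def split: if_splits)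
  qed
  have "f ` (U \<times> {..<j}) \<subseteq> {x \<in> \<Lambda>. 0 < vec_norm t x \<and> vec_norm t x < \<rho>}"
  proof (rule image_subsetI)
    fix z assume "z \<in> U \<times> {..<j}"
    then obtain u k where z: "z = (u, k)" "u \<in> U" "k < j" by blast
    then show "f z \<in> {x \<in> \<Lambda>. 0 < vec_norm t x \<and> vec_norm t x < \<rho>}"
      using unit[of u "v k"] v(2)[of k] Uu[of u] left_independent_nonzero[OF v(1), of k]
      by (simp add: f_def vec_norm_left_mult)
  qed
  then have "card (f ` (U \<times> {..<j})) \<le> card {x \<in> \<Lambda>. 0 < vec_norm t x \<and> vec_norm t x < \<rho>}"
    by (rule card_mono[OF fin])
  then show ?thesis using inj U by (simp add: card_image card_cartesian_product)
qed

locale hurwitz_lattice =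
  fixes t :: nat and b :: "nat \<Rightarrow> nat \<Rightarrow> quat" and \<Lambda> :: "(nat \<Rightarrow> quat) set"
  assumes indep: "left_independent t t b" and span: "\<Lambda> = hurwitz_span t b"
    and discrete: "finite {x \<in> \<Lambda>. vec_norm t x \<le> \<rho>}"
begin

text \<open>The largest norm in an independent family is the norm of a lattice vector, and up to the
  bound \<open>\<rho>0\<close> given by a basis only finitely many norms occur. The radii that
  matter thus form a finite set, whose minimum is the \<open>LEAST\<close> of the
  definition.\<close>

lemma minimum_attained:
  assumes j: "1 \<le> j" "j \<le> t"
  shows "\<exists>v. (\<forall>k<j. v k \<in> \<Lambda> \<inter> vec_cball t (quat_minimum t j \<Lambda>)) \<and> left_independent t j v"
proof -
  define P where "P \<rho> \<longleftrightarrow> (\<exists>v. (\<forall>k<j. v k \<in> \<Lambda> \<inter> vec_cball t \<rho>) \<and> left_independent t j v)" for \<rho>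
  have \<Lambda>_sub: "\<Lambda> \<subseteq> {..<t} \<rightarrow>\<^sub>E UNIV" using hurwitz_span_subset span by (simp add: quat_space_sel)
  define c where "c k = (\<lambda>i\<in>{..<t}. b k i)" for k
  have c: "c k \<in> \<Lambda>" if "k < t" for k unfolding c_def span using that by (rule hurwitz_span_basis)
  have c_ind: "left_independent t j c"
    using left_independent_mono[OF indep j(2)] unfolding left_independent_def c_def by simp
  define \<rho>0 where "\<rho>0 = Max (vec_norm t ` c ` {..<j})"
  have "vec_norm t (c k) \<le> \<rho>0" if "k < j" for k
    unfolding \<rho>0_def using that by (intro Max_ge) auto
  moreover have "c k \<in> {..<t} \<rightarrow>\<^sub>E UNIV" if "k < t" for k using c[OF that] \<Lambda>_sub by blast
  ultimately have "\<forall>k<j. c k \<in> \<Lambda> \<inter> vec_cball t \<rho>0" using c j by (simp add: vec_cball_iff)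
  with c_ind have P0: "P \<rho>0" unfolding P_def by blast
  define S where "S = {\<rho> \<in> vec_norm t ` {x \<in> \<Lambda>. vec_norm t x \<le> \<rho>0}. P \<rho>}"
  have S_fin: "finite S" unfolding S_def using discrete by simp
  have down: "\<exists>\<rho>'\<in>S. \<rho>' \<le> \<rho>" if "P \<rho>" "\<rho> \<le> \<rho>0" for \<rho>
  proof -
    from \<open>P \<rho>\<close> obtain v where v: "\<forall>k<j. v k \<in> \<Lambda> \<inter> vec_cball t \<rho>" "left_independent t j v"
      unfolding P_def by blast
    define \<rho>' where "\<rho>' = Max (vec_norm t ` v ` {..<j})"
    have "\<rho>' \<in> vec_norm t ` v ` {..<j}" unfolding \<rho>'_def using j by (intro Max_in) (auto simp: lessThan_empty_iff)
    then obtain k where k: "k < j" "\<rho>' = vec_norm t (v k)" by blast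
    have le: "vec_norm t (v l) \<le> \<rho>'" if "l < j" for l
      unfolding \<rho>'_def using that by (intro Max_ge) auto
    have vk: "v k \<in> \<Lambda>" "vec_norm t (v k) \<le> \<rho>" using v(1) k by (auto simp: vec_cball_iff)
    have "\<forall>l<j. v l \<in> \<Lambda> \<inter> vec_cball t \<rho>'" using v(1) le by (simp add: vec_cball_iff)
    with v(2) have "P \<rho>'" unfolding P_def by blast
    then have "\<rho>' \<in> S" unfolding S_def using k vk that by auto
    then show ?thesis using k vk by auto
  qed
  have S_ne: "S \<noteq> {}" using down[OF P0] by blast
  have min: "P (Min S)" using Min_in[OF S_fin S_ne] by (simp add: S_def)
  have "Min S \<le> \<rho>" if "P \<rho>" for \<rho>
  proof (cases "\<rho> \<le> \<rho>0")
    case True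
    then obtain \<rho>' where "\<rho>' \<in> S" "\<rho>' \<le> \<rho>" using down \<open>P \<rho>\<close> by blast
    then show ?thesis using Min_le[OF S_fin] by force
  next
    case False
    obtain \<rho>' where "\<rho>' \<in> S" "\<rho>' \<le> \<rho>0" using down P0 by blast
    then show ?thesis using Min_le[OF S_fin] False by force
  qed
  with min have "(LEAST \<rho>. P \<rho>) = Min S" by (rule Least_equality)
  then have "quat_minimum t j \<Lambda> = Min S" by (simp add: quat_minimum_def P_def)
  with min show ?thesis by (simp add: P_def)
qed

lemma minimum_pos:
  assumes "1 \<le> j" "j \<le> t"
  shows "quat_minimum t j \<Lambda> > 0"
proof -
  obtain v where v: "\<forall>k<j. v k \<in> \<Lambda> \<inter> vec_cball t (quat_minimum t j \<Lambda>)" "left_independent t j v"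
    using minimum_attained[OF assms] by blast
  then have "vec_norm t (v 0) \<le> quat_minimum t j \<Lambda>" using assms by (auto simp: vec_cball_iff)
  with left_independent_nonzero[OF v(2), of 0] assms show ?thesis by simp
qed

text \<open>Let \<open>j\<close> be the largest index whose minimum is below \<open>\<rho>\<close>.
  The \<open>j\<close> independent vectors for this one minimum already give \<open>24 * j\<close>
  lattice vectors, and at most \<open>j\<close> indices are counted on the left; one family per
  radius suffices.\<close>

lemma minima_count:
  "24 * card {j \<in> {1..t}. quat_minimum t j \<Lambda> < \<rho>} \<le> card {x \<in> \<Lambda>. 0 < vec_norm t x \<and> vec_norm t x < \<rho>}"
proof (cases "{j \<in> {1..t}. quat_minimum t j \<Lambda> < \<rho>} = {}")
  case True
  then show ?thesis by (simp only: card.empty)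
next
  case False
  let ?J = "{j \<in> {1..t}. quat_minimum t j \<Lambda> < \<rho>}"
  define j where "j = Max ?J"
  have fin: "finite ?J" by simp
  have "j \<in> ?J" unfolding j_def using Max_in[OF fin False] .
  then have j: "1 \<le> j" "j \<le> t" "quat_minimum t j \<Lambda> < \<rho>" by auto
  have "?J \<subseteq> {1..j}" unfolding j_def using Max_ge[OF fin] by auto
  then have "card ?J \<le> j" using card_mono[of "{1..j}" ?J] by simp
  moreover obtain v where v: "\<forall>k<j. v k \<in> \<Lambda> \<inter> vec_cball t (quat_minimum t j \<Lambda>)" "left_independent t j v"
    using minimum_attained[OF j(1,2)] by blast
  have "24 * j \<le> card {x \<in> \<Lambda>. 0 < vec_norm t x \<and> vec_norm t x < \<rho>}"
  proof (rule unit_multiples_count[OF v(2)])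
    show "v k \<in> \<Lambda> \<and> vec_norm t (v k) < \<rho>" if "k < j" for k
      using v(1) that j(3) by (auto simp: vec_cball_iff)
    show "(\<lambda>i\<in>{..<t}. u * x i) \<in> \<Lambda>" if "u \<in> hurwitz" "x \<in> \<Lambda>" for u x
      using hurwitz_span_smult that unfolding span by blast
    show "finite {x \<in> \<Lambda>. 0 < vec_norm t x \<and> vec_norm t x < \<rho>}"
      by (rule finite_subset[OF _ discrete[of \<rho>]]) auto
  qed
  ultimately show ?thesis by linarith
qed

lemma geometric_mean_of_minima:
  assumes t: "t \<ge> 1" and r: "r > 0"
    and sum: "(\<Sum>x\<in>{x \<in> \<Lambda>. 0 < vec_norm t x \<and> vec_norm t x \<le> level t r 0}. weight t r (vec_norm t x)) < 24"
  shows "(\<Prod>j=1..t. quat_minimum t j \<Lambda>) powr (1 / real t) > r"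
proof -
  define X where "X = {x \<in> \<Lambda>. 0 < vec_norm t x \<and> vec_norm t x \<le> level t r 0}"
  define \<mu> where "\<mu> j = quat_minimum t j \<Lambda>" for j
  have X_fin: "finite X" unfolding X_def by (rule finite_subset[OF _ discrete[of "level t r 0"]]) auto
  have \<mu>_pos: "\<mu> j > 0" if "j \<in> {1..t}" for j using minimum_pos that by (simp add: \<mu>_def)
  \<comment> \<open>Each minimum is repeated 24 times, so that the layer formula for
    \<open>Z\<close> produces the left side of \<open>minima_count\<close> at every level.\<close>
  define Z where "Z = {1..t} \<times> {..<24::nat}"
  have Z_sum: "(\<Sum>z\<in>Z. weight t r (\<mu> (fst z))) = 24 * (\<Sum>j\<in>{1..t}. weight t r (\<mu> j))"
  proof -
    have "(\<Sum>z\<in>Z. weight t r (\<mu> (fst z))) = (\<Sum>j\<in>{1..t}. \<Sum>c<24::nat. weight t r (\<mu> j))"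
      unfolding Z_def sum.cartesian_product by (simp add: case_prod_beta)
    then show ?thesis by (simp add: sum_distrib_left)
  qed
  have "ennreal (24 * (\<Sum>j\<in>{1..t}. weight t r (\<mu> j)))
    = (\<integral>\<^sup>+s. of_nat (card {z \<in> Z. \<mu> (fst z) < level t r s}) * indicator {0..1} s \<partial>lborel)"
    unfolding Z_sum[symmetric] using r \<mu>_pos by (intro weight_layer_cake) (auto simp: Z_def)
  also have "\<dots> \<le> (\<integral>\<^sup>+s. of_nat (card {x \<in> X. vec_norm t x < level t r s}) * indicator {0..1} s \<partial>lborel)"
  proof (rule nn_integral_mono)
    fix s :: real
    show "of_nat (card {z \<in> Z. \<mu> (fst z) < level t r s}) * indicator {0..1} s
      \<le> (of_nat (card {x \<in> X. vec_norm t x < level t r s}) * indicator {0..1} s :: ennreal)"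
    proof (cases "s \<in> {0..1}")
      case True
      have "level t r s \<le> level t r 0" using r True by (simp add: level_def)
      then have "{x \<in> X. vec_norm t x < level t r s} = {x \<in> \<Lambda>. 0 < vec_norm t x \<and> vec_norm t x < level t r s}"
        unfolding X_def by auto
      moreover have "{z \<in> Z. \<mu> (fst z) < level t r s} = {j \<in> {1..t}. \<mu> j < level t r s} \<times> {..<24}"
        unfolding Z_def by auto
      ultimately have "card {z \<in> Z. \<mu> (fst z) < level t r s} \<le> card {x \<in> X. vec_norm t x < level t r s}"
        using minima_count[of "level t r s"] by (simp add: \<mu>_def card_cartesian_product mult.commute)
      then have "(of_nat (card {z \<in> Z. \<mu> (fst z) < level t r s}) :: ennreal) \<le> of_nat (card {x \<in> X. vec_norm t x < level t r s})"
        by (rule of_nat_mono)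
      with True show ?thesis by simp
    qed simp
  qed
  also have "\<dots> = ennreal (\<Sum>x\<in>X. weight t r (vec_norm t x))"
    by (rule weight_layer_cake[symmetric, OF X_fin r]) (simp add: X_def)
  finally have "ennreal (24 * (\<Sum>j\<in>{1..t}. weight t r (\<mu> j))) \<le> ennreal (\<Sum>x\<in>X. weight t r (vec_norm t x))" .
  moreover have "0 \<le> (\<Sum>x\<in>X. weight t r (vec_norm t x))" by (intro sum_nonneg weight_nonneg)
  ultimately have "24 * (\<Sum>j\<in>{1..t}. weight t r (\<mu> j)) \<le> (\<Sum>x\<in>X. weight t r (vec_norm t x))"
    by (simp only: ennreal_le_iff)
  also have "\<dots> < 24" using sum unfolding X_def .
  finally have lt1: "(\<Sum>j\<in>{1..t}. weight t r (\<mu> j)) < 1" by simp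
  \<comment> \<open>The cut at 1 is not reached: every single weight is at most the sum, which is
    below 1. Hence the weight is at least its uncut value.\<close>
  have "1 / t - 4 * ln (\<mu> j / r) \<le> weight t r (\<mu> j)" if "j \<in> {1..t}" for j
  proof -
    have "weight t r (\<mu> j) \<le> (\<Sum>j\<in>{1..t}. weight t r (\<mu> j))"
      using that by (intro member_le_sum weight_nonneg) auto
    with lt1 show ?thesis unfolding weight_def by linarith
  qed
  then have "(\<Sum>j\<in>{1..t}. 1 / t - 4 * ln (\<mu> j / r)) \<le> (\<Sum>j\<in>{1..t}. weight t r (\<mu> j))"
    by (rule sum_mono)
  with lt1 have "(\<Sum>j\<in>{1..t}. 1 / t - 4 * ln (\<mu> j / r)) < 1" by linarith
  \<comment> \<open>The terms \<open>1 / t\<close> add up to 1, so a total below 1 forces the sum of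
    the logarithms to be positive.\<close>
  moreover have "(\<Sum>j\<in>{1..t}. 1 / t - 4 * ln (\<mu> j / r)) = 1 - 4 * (\<Sum>j\<in>{1..t}. ln (\<mu> j / r))"
    using t by (simp add: sum_subtractf sum_distrib_left)
  ultimately have pos: "(\<Sum>j\<in>{1..t}. ln (\<mu> j / r)) > 0" by linarith
  have "(\<Sum>j\<in>{1..t}. ln (\<mu> j / r)) = (\<Sum>j\<in>{1..t}. ln (\<mu> j) - ln r)"
  proof (rule sum.cong)
    show "ln (\<mu> j / r) = ln (\<mu> j) - ln r" if "j \<in> {1..t}" for j
      using \<mu>_pos[OF that] r by (simp add: ln_div)
  qed simp
  also have "\<dots> = ln (\<Prod>j\<in>{1..t}. \<mu> j) - t * ln r"
  proof -
    have "ln (\<Prod>j\<in>{1..t}. \<mu> j) = (\<Sum>j\<in>{1..t}. ln (\<mu> j))"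
      by (rule ln_prod) (use \<mu>_pos in force)+
    then show ?thesis by (simp add: sum_subtractf)
  qed
  finally have "ln r < (1 / t) * ln (\<Prod>j\<in>{1..t}. \<mu> j)" using pos t by (simp add: field_simps)
  moreover define M where "M = (\<Prod>j\<in>{1..t}. \<mu> j)"
  ultimately have "exp (ln r) < exp ((1 / t) * ln M)" by simp
  moreover have "M > 0" unfolding M_def using \<mu>_pos by (rule prod_pos)
  ultimately have "M powr (1 / t) > r" using r by (simp add: powr_def)
  then show ?thesis unfolding M_def \<mu>_def .
qed

end

section \<open>Averaging over codes\<close>

text \<open>Exchange the sums over codes and vectors. Among the
  \<open>(p ^ (t + 1)) ^ (t - 1)\<close> parameters, the fraction of codes containing a vector is at
  most p^(-2(t-1)) in rank 2 and p^(-(t-1)) in rank 1, where all weights are estimated by 1; some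
  code does not exceed the mean.\<close>

lemma (in hurwitz_reduction) average_over_codes:
  assumes t: "t \<ge> 1" and X: "finite X" "X \<subseteq> {..<t} \<rightarrow>\<^sub>E hurwitz"
    and w: "\<And>x. x \<in> X \<Longrightarrow> 0 \<le> w x \<and> w x \<le> (1 :: real)"
    and nz: "\<And>x. x \<in> X \<Longrightarrow> \<exists>i<t. \<exists>a b. \<phi> (x i) a b \<noteq> 0"
    and sing: "\<And>\<alpha> \<beta>. \<alpha> \<in> {0..<int p} \<Longrightarrow> \<beta> \<in> {0..<int p} \<Longrightarrow> \<alpha> \<noteq> 0 \<or> \<beta> \<noteq> 0 \<Longrightarrow>
      real (card (X \<inter> ({..<t} \<rightarrow>\<^sub>E singular_ideal \<alpha> \<beta>))) \<le> N"
  shows "\<exists>A\<in>code_params p t. (\<Sum>x\<in>X \<inter> code_lattice t A. w x)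
    \<le> (\<Sum>x\<in>X. w x) / (real p ^ 2) ^ (t - 1) + (real p ^ 2 * N) / real p ^ (t - 1)"
proof -
  let ?C = "code_params p t"
  define cnt where "cnt x = card {A \<in> ?C. x \<in> code_lattice t A}" for x
  \<comment> \<open>The rows that may annihilate a vector of rank 1. Proportional rows give the same
    ideal, which the crude count \<open>p ^ 2\<close> tolerates.\<close>
  define Q where "Q = {(\<alpha>, \<beta>). \<alpha> \<in> {0..<int p} \<and> \<beta> \<in> {0..<int p} \<and> (\<alpha> \<noteq> 0 \<or> \<beta> \<noteq> 0)}"
  define X1 where "X1 = (\<Union>(\<alpha>, \<beta>)\<in>Q. X \<inter> ({..<t} \<rightarrow>\<^sub>E singular_ideal \<alpha> \<beta>))"
  have Q_sub: "Q \<subseteq> {0..<int p} \<times> {0..<int p}" by (auto simp: Q_def)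
  then have Q_fin: "finite Q" by (rule finite_subset) simp
  have "card Q \<le> card ({0..<int p} \<times> {0..<int p})" using Q_sub by (intro card_mono) auto
  then have Q_card: "card Q \<le> p ^ 2" by (simp add: power2_eq_square)
  have N: "N \<ge> 0" using sing[of 1 0] p_gt_1
    by (simp add: order_trans[OF of_nat_0_le_iff])
  have X1_sub: "X1 \<subseteq> X" by (auto simp: X1_def)
  have "real (card X1) \<le> real (\<Sum>q\<in>Q. card (X \<inter> ({..<t} \<rightarrow>\<^sub>E singular_ideal (fst q) (snd q))))"
    unfolding X1_def case_prod_beta using card_UN_le[OF Q_fin] by (intro of_nat_mono)
  also have "\<dots> \<le> (\<Sum>q\<in>Q. N)" unfolding of_nat_sum
    by (intro sum_mono sing) (auto simp: Q_def)
  also have "\<dots> \<le> real (p ^ 2) * N" using Q_card N by (simp add: mult_right_mono del: of_nat_power)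
  finally have X1_card: "real (card X1) \<le> real p ^ 2 * N" by simp
  have red: "reduce t x \<in> carrier (mat2_space p t)" if "x \<in> X" for x
    using reduce_in_space[of x t] that X(2) by (auto simp: hurwitz_power_sel)
  have cnt_eq: "cnt x = card {A \<in> ?C. reduce t x \<in> code p t A}" if "x \<in> X" for x
    using that X(2) by (auto simp: cnt_def code_lattice_def hurwitz_power_sel intro!: arg_cong[of _ _ card])
  have cnt1: "cnt x \<le> (p ^ t) ^ (t - 1)" if x: "x \<in> X" for x
    unfolding cnt_eq[OF x]
  proof (rule card_codes_nonzero[OF prime_p t red[OF x]])
    obtain i a b where iab: "i < t" "\<phi> (x i) a b \<noteq> 0" using nz[OF x] by blast
    have "mat_column (reduce t x) (if b = 0 then 2 * i else 2 * i + 1) a = \<phi> (x i) a b"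
      using two_cases[of b] iab by (auto simp: mat_column_def reduce_def)
    then show "\<exists>n<2 * t. \<exists>a. mat_column (reduce t x) n a \<noteq> 0"
      using iab by (intro exI[of _ "if b = 0 then 2 * i else 2 * i + 1"] conjI exI[of _ a]) auto
  qed
  have cnt2: "cnt x \<le> (p ^ (t - 1)) ^ (t - 1)" if x: "x \<in> X - X1" for x
  proof -
    have xX: "x \<in> X" using x by blast
    show ?thesis
      unfolding cnt_eq[OF xX]
    proof (rule card_codes_nondegenerate[OF prime_p t red[OF xX]], rule ccontr)
      fix \<alpha> \<beta> assume ab: "\<alpha> \<in> {0..<int p}" "\<beta> \<in> {0..<int p}" "degenerate p t (reduce t x) \<alpha> \<beta>"
        and "\<not> (\<alpha> = 0 \<and> \<beta> = 0)"
      then have "(\<alpha>, \<beta>) \<in> Q" by (auto simp: Q_def)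
      moreover have "x \<in> {..<t} \<rightarrow>\<^sub>E singular_ideal \<alpha> \<beta>"
        unfolding PiE_iff
      proof (intro conjI ballI)
        have xH: "x \<in> {..<t} \<rightarrow>\<^sub>E hurwitz" using xX X(2) by blast
        then show "x \<in> extensional {..<t}" unfolding PiE_iff by blast
        fix i assume i: "i \<in> {..<t}"
        then show "x i \<in> singular_ideal \<alpha> \<beta>"
          using ab(3) PiE_mem[OF xH i] by (simp add: singular_ideal_def degenerate_def reduce_def)
      qed
      ultimately have "x \<in> X1" using xX unfolding X1_def by blast
      with x show False by blast
    qed
  qed
  have "(\<Sum>A\<in>?C. \<Sum>x\<in>X \<inter> code_lattice t A. w x) = (\<Sum>A\<in>?C. \<Sum>x\<in>X. if x \<in> code_lattice t A then w x else 0)"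
    using X(1) by (simp add: sum.inter_restrict)
  also have "\<dots> = (\<Sum>x\<in>X. \<Sum>A\<in>?C. if x \<in> code_lattice t A then w x else 0)"
    by (rule sum.swap)
  also have "\<dots> = (\<Sum>x\<in>X. real (cnt x) * w x)"
    using finite_code_params by (simp add: sum.If_cases cnt_def Int_def)
  also have "\<dots> = (\<Sum>x\<in>X - X1. real (cnt x) * w x) + (\<Sum>x\<in>X1. real (cnt x) * w x)"
    by (rule sum.subset_diff[OF X1_sub X(1)])
  also have "\<dots> \<le> (real p ^ (t - 1)) ^ (t - 1) * (\<Sum>x\<in>X. w x) + (real p ^ t) ^ (t - 1) * real (card X1)"
  proof (rule add_mono)
    have "(\<Sum>x\<in>X - X1. real (cnt x) * w x) \<le> (\<Sum>x\<in>X - X1. (real p ^ (t - 1)) ^ (t - 1) * w x)"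
    proof (rule sum_mono)
      fix x assume x: "x \<in> X - X1"
      have "real (cnt x) \<le> real ((p ^ (t - 1)) ^ (t - 1))" using cnt2[OF x] by (rule of_nat_mono)
      then show "real (cnt x) * w x \<le> (real p ^ (t - 1)) ^ (t - 1) * w x"
        using w x by (intro mult_right_mono) auto
    qed
    also have "\<dots> \<le> (\<Sum>x\<in>X. (real p ^ (t - 1)) ^ (t - 1) * w x)"
      using X(1) w by (intro sum_mono2) auto
    finally show "(\<Sum>x\<in>X - X1. real (cnt x) * w x) \<le> (real p ^ (t - 1)) ^ (t - 1) * (\<Sum>x\<in>X. w x)"
      by (simp add: sum_distrib_left)
    have "(\<Sum>x\<in>X1. real (cnt x) * w x) \<le> (\<Sum>x\<in>X1. (real p ^ t) ^ (t - 1))"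
    proof (rule sum_mono)
      fix x assume "x \<in> X1"
      then have x: "x \<in> X" using X1_sub by blast
      have "real (cnt x) \<le> real ((p ^ t) ^ (t - 1))" using cnt1[OF x] by (rule of_nat_mono)
      then have "real (cnt x) * w x \<le> (real p ^ t) ^ (t - 1) * 1"
        using w[OF x] by (intro mult_mono) auto
      then show "real (cnt x) * w x \<le> (real p ^ t) ^ (t - 1)" by simp
    qed
    then show "(\<Sum>x\<in>X1. real (cnt x) * w x) \<le> (real p ^ t) ^ (t - 1) * real (card X1)"
      by (simp add: mult.commute)
  qed
  also have "\<dots> \<le> (real p ^ (t - 1)) ^ (t - 1) * (\<Sum>x\<in>X. w x) + (real p ^ t) ^ (t - 1) * (real p ^ 2 * N)"
    using X1_card by (intro add_left_mono mult_left_mono) auto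
  also have "\<dots> = real (card ?C) * ((\<Sum>x\<in>X. w x) / (real p ^ 2) ^ (t - 1) + (real p ^ 2 * N) / real p ^ (t - 1))"
  proof -
    have e: "real (card ?C) = (real p ^ (t + 1)) ^ (t - 1)" by (simp add: card_code_params)
    have "t - 1 + 2 = t + 1" using t by simp
    then have "(real p ^ (t - 1)) ^ (t - 1) * (real p ^ 2) ^ (t - 1) = (real p ^ (t + 1)) ^ (t - 1)"
      by (simp only: power_mult_distrib[symmetric] power_add[symmetric])
    moreover have "(real p ^ t) ^ (t - 1) * real p ^ (t - 1) = (real p ^ (t + 1)) ^ (t - 1)"
      by (simp only: power_mult_distrib[symmetric] power_add power_one_right)
    moreover have "real p \<noteq> 0" using p_gt_1 by simp
    ultimately show ?thesis unfolding e by (simp add: field_simps)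
  qed
  finally have total: "(\<Sum>A\<in>?C. \<Sum>x\<in>X \<inter> code_lattice t A. w x)
    \<le> real (card ?C) * ((\<Sum>x\<in>X. w x) / (real p ^ 2) ^ (t - 1) + (real p ^ 2 * N) / real p ^ (t - 1))" .
  have C_ne: "?C \<noteq> {}" using card_code_params[of p t] p_gt_1 by auto
  show ?thesis
  proof (rule ccontr)
    assume "\<not> ?thesis"
    then have "(\<Sum>A\<in>?C. (\<Sum>x\<in>X. w x) / (real p ^ 2) ^ (t - 1) + (real p ^ 2 * N) / real p ^ (t - 1))
      < (\<Sum>A\<in>?C. \<Sum>x\<in>X \<inter> code_lattice t A. w x)"
      using C_ne finite_code_params by (intro sum_strict_mono) auto
    with total show False by simp
  qed
qed

lemma scaled_hurwitz_lattice:
  assumes s: "s > 0" and b: "left_independent t t b" and \<Lambda>: "\<Lambda> = hurwitz_span t b" "\<Lambda> \<subseteq> {..<t} \<rightarrow>\<^sub>E hurwitz"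
  shows "hurwitz_lattice t (\<lambda>k i. s *\<^sub>R b k i) ((\<lambda>x. \<lambda>i\<in>{..<t}. s *\<^sub>R x i) ` \<Lambda>)"
proof
  let ?S = "\<lambda>x. \<lambda>i\<in>{..<t}. s *\<^sub>R x i"
  show "left_independent t t (\<lambda>k i. s *\<^sub>R b k i)" using b s by (intro left_independent_scale) auto
  show "?S ` \<Lambda> = hurwitz_span t (\<lambda>k i. s *\<^sub>R b k i)" unfolding \<Lambda>(1) by (rule hurwitz_span_scale)
  fix \<rho>
  have "{y \<in> ?S ` \<Lambda>. vec_norm t y \<le> \<rho>} \<subseteq> ?S ` {x \<in> {..<t} \<rightarrow>\<^sub>E hurwitz. vec_norm t x \<le> \<rho> / s}"
  proof
    fix y assume "y \<in> {y \<in> ?S ` \<Lambda>. vec_norm t y \<le> \<rho>}"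
    then obtain x where x: "x \<in> \<Lambda>" "y = ?S x" "vec_norm t y \<le> \<rho>" by blast
    then have "vec_norm t x \<le> \<rho> / s" using s by (simp add: vec_norm_scaleR field_simps)
    with x \<Lambda>(2) show "y \<in> ?S ` {x \<in> {..<t} \<rightarrow>\<^sub>E hurwitz. vec_norm t x \<le> \<rho> / s}" by blast
  qed
  then show "finite {y \<in> ?S ` \<Lambda>. vec_norm t y \<le> \<rho>}"
    using hurwitz_count(1)[of t "\<rho> / s"] by (rule finite_subset[OF _ finite_imageI])
qed

lemma power_powr_inverse: "c > 0 \<Longrightarrow> t \<ge> 1 \<Longrightarrow> (c ^ t) powr (1 / real t) = c" for c :: real
  by (simp add: powr_powr flip: powr_realpow)

text \<open>The standard lattice scaled by \<open>r\<close> has all minima at least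
  \<open>2 * r\<close>, since the doubled norm of a nonzero Hurwitz vector is at least 2.\<close>

lemma ex_lattice_large_minima:
  assumes t: "t \<ge> 1" and r: "r > 0"
  shows "\<exists>\<Lambda>. is_lattice t \<Lambda> \<and> free_hurwitz_module t \<Lambda> \<and>
    (\<Prod>j=1..t. quat_minimum t j \<Lambda>) powr (1 / real t) > r"
proof -
  define b :: "nat \<Rightarrow> nat \<Rightarrow> quat" where "b k i = (if i = k then 1 else 0)" for k i
  have sum: "(\<Sum>k<t. c k * b k i) = c i" if "i < t" for c i
    using that by (simp add: b_def if_distrib[of "\<lambda>x. _ * x"] cong: if_cong)
  have b: "left_independent t t b"
    unfolding left_independent_def by (simp add: sum)
  have sub: "hurwitz_span t b \<subseteq> {..<t} \<rightarrow>\<^sub>E hurwitz"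
  proof
    fix x assume "x \<in> hurwitz_span t b"
    then obtain c where "\<forall>k<t. c k \<in> hurwitz" "x = (\<lambda>i\<in>{..<t}. \<Sum>k<t. c k * b k i)" by (rule hurwitz_spanE)
    then show "x \<in> {..<t} \<rightarrow>\<^sub>E hurwitz" by (simp add: restrict_PiE_iff sum)
  qed
  define \<Lambda> where "\<Lambda> = (\<lambda>x. \<lambda>i\<in>{..<t}. r *\<^sub>R x i) ` hurwitz_span t b"
  interpret hurwitz_lattice t "\<lambda>k i. r *\<^sub>R b k i" \<Lambda>
    unfolding \<Lambda>_def using r b sub by (intro scaled_hurwitz_lattice) auto
  have min: "2 * r \<le> quat_minimum t j \<Lambda>" if j: "j \<in> {1..t}" for j
  proof -
    obtain v where v: "\<forall>k<j. v k \<in> \<Lambda> \<inter> vec_cball t (quat_minimum t j \<Lambda>)" "left_independent t j v"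
      using minimum_attained[of j] j by auto
    have "v 0 \<in> \<Lambda>" "vec_norm t (v 0) \<le> quat_minimum t j \<Lambda>" using v j by (auto simp: vec_cball_iff)
    then obtain x where x: "x \<in> hurwitz_span t b" "v 0 = (\<lambda>i\<in>{..<t}. r *\<^sub>R x i)" unfolding \<Lambda>_def by blast
    have norm: "vec_norm t (v 0) = r * vec_norm t x" using r by (simp add: x vec_norm_scaleR)
    have "vec_norm t x \<noteq> 0" using left_independent_nonzero[OF v(2), of 0] j norm by auto
    then have "\<exists>i<t. x i \<noteq> 0"
      by (metis (no_types, lifting) L2_set_eq_0_iff finite_lessThan lessThan_iff mult_zero_right norm_zero vec_norm_eq)
    then obtain i where i: "i < t" "x i \<noteq> 0" by blast
    have "x i \<in> hurwitz" using x(1) sub i by blast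
    then have "norm (x i) \<ge> 1" using hurwitz_norm_ge_1 i by blast
    then have "2 \<le> vec_norm t x" using vec_norm_ge_coordinate[OF i(1), of x] by linarith
    then have "r * 2 \<le> r * vec_norm t x" using r by simp
    then show ?thesis using norm \<open>vec_norm t (v 0) \<le> _\<close> by simp
  qed
  have "(\<Prod>j=1..t. 2 * r) \<le> (\<Prod>j=1..t. quat_minimum t j \<Lambda>)"
    using min r by (intro prod_mono) auto
  then have "(2 * r) ^ t \<le> (\<Prod>j=1..t. quat_minimum t j \<Lambda>)" by simp
  then have "((2 * r) ^ t) powr (1 / t) \<le> (\<Prod>j=1..t. quat_minimum t j \<Lambda>) powr (1 / t)"
    using r by (intro powr_mono2) auto
  also have "((2 * r) ^ t) powr (1 / t) = 2 * r"
    using r t by (intro power_powr_inverse) auto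
  finally have "(\<Prod>j=1..t. quat_minimum t j \<Lambda>) powr (1 / t) > r" using r by simp
  then show ?thesis
    using hurwitz_span_lattice[OF indep] hurwitz_span_free[OF indep] unfolding span[symmetric] by blast
qed

text \<open>The hypotheses follow the ranks: \<open>nz\<close> keeps nonzero vectors of rank 0 out
  of reach of the weight, \<open>sing\<close> bounds the vectors of rank 1 by \<open>N\<close> for
  each ideal, \<open>K\<close> bounds the count below each level, and \<open>final\<close> brings
  the average below 24.\<close>

lemma (in hurwitz_reduction) ex_code_lattice:
  fixes t :: nat and r s :: real
  assumes t: "t \<ge> 1" and r: "r > 0" and s: "s > 0"
    and nz: "level t r 0 < 2 * s * p"
    and sing: "ball_volume t (level t r 0 / s + sqrt p * sqrt t) \<le> N * (unit_ball_vol 4 * (sqrt p / 2) ^ 4) ^ t"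
    and K: "K \<ge> 0" "\<And>u. 0 \<le> u \<Longrightarrow> u \<le> 1 \<Longrightarrow>
      2 ^ t * ball_volume t (level t r u / s + 4 * sqrt t) \<le> K * exp (1 - real t * u)"
    and final: "K * (exp 1 * (1 - exp (- real t)) / t) / (real p ^ 2) ^ (t - 1) + (real p ^ 2 * N) / real p ^ (t - 1) < 24"
  shows "\<exists>A. let \<Lambda> = (\<lambda>x. \<lambda>i\<in>{..<t}. s *\<^sub>R x i) ` code_lattice t A in
    is_lattice t \<Lambda> \<and> free_hurwitz_module t \<Lambda> \<and> (\<Prod>j=1..t. quat_minimum t j \<Lambda>) powr (1 / real t) > r"
proof -
  \<comment> \<open>From the norm \<open>R\<close> on the weight vanishes. Vectors are counted
    before scaling, hence the radius \<open>R / s\<close>.\<close>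
  define R where "R = level t r 0"
  define X where "X = {x \<in> {..<t} \<rightarrow>\<^sub>E hurwitz. 0 < vec_norm t x \<and> vec_norm t x \<le> R / s}"
  define w where "w x = weight t r (s * vec_norm t x)" for x
  have X_sub: "X \<subseteq> {x \<in> {..<t} \<rightarrow>\<^sub>E hurwitz. vec_norm t x \<le> R / s}" unfolding X_def by blast
  then have X_fin: "finite X" using hurwitz_count(1)[of t "R / s"] by (rule finite_subset)
  have w_sum: "(\<Sum>x\<in>X. w x) \<le> K * (exp 1 * (1 - exp (- real t)) / t)"
    unfolding w_def
  proof (rule weight_sum_upper[OF X_fin r _ t K(1)])
    show "0 < s * vec_norm t x" if "x \<in> X" for x using that s by (simp add: X_def)
    fix u :: real assume u: "0 \<le> u" "u \<le> 1"
    have "{x \<in> X. s * vec_norm t x < level t r u} \<subseteq> {x \<in> {..<t} \<rightarrow>\<^sub>E hurwitz. vec_norm t x \<le> level t r u / s}"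
    proof
      fix x assume "x \<in> {x \<in> X. s * vec_norm t x < level t r u}"
      then have "x \<in> {..<t} \<rightarrow>\<^sub>E hurwitz" "s * vec_norm t x < level t r u" unfolding X_def by blast+
      moreover from this(2) have "vec_norm t x \<le> level t r u / s" using s by (simp add: field_simps)
      ultimately show "x \<in> {x \<in> {..<t} \<rightarrow>\<^sub>E hurwitz. vec_norm t x \<le> level t r u / s}" by blast
    qed
    then have "card {x \<in> X. s * vec_norm t x < level t r u} \<le> card {x \<in> {..<t} \<rightarrow>\<^sub>E hurwitz. vec_norm t x \<le> level t r u / s}"
      by (rule card_mono[OF hurwitz_count(1)])
    then have "real (card {x \<in> X. s * vec_norm t x < level t r u}) \<le> 2 ^ t * ball_volume t (level t r u / s + 4 * sqrt t)"
      using hurwitz_count(2)[of t "level t r u / s"] by linarith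
    then show "real (card {x \<in> X. s * vec_norm t x < level t r u}) \<le> K * exp (1 - real t * u)"
      using K(2)[OF u] by linarith
  qed
  have "\<exists>A\<in>code_params p t. (\<Sum>x\<in>X \<inter> code_lattice t A. w x)
    \<le> (\<Sum>x\<in>X. w x) / (real p ^ 2) ^ (t - 1) + (real p ^ 2 * N) / real p ^ (t - 1)"
  proof (rule average_over_codes[OF t X_fin])
    show "X \<subseteq> {..<t} \<rightarrow>\<^sub>E hurwitz" unfolding X_def by blast
    show "0 \<le> w x \<and> w x \<le> 1" for x by (simp add: w_def weight_nonneg weight_le_1)
  next
    fix x assume x: "x \<in> X"
    then have xH: "x \<in> {..<t} \<rightarrow>\<^sub>E hurwitz" "vec_norm t x > 0" "vec_norm t x \<le> R / s" by (auto simp: X_def)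
    show "\<exists>i<t. \<exists>a b. \<phi> (x i) a b \<noteq> 0"
    proof (rule ccontr)
      assume "\<not> ?thesis"
      then have z: "\<phi> (x i) a b = 0" if "i < t" for i a b using that by blast
      have "\<exists>i<t. x i \<noteq> 0"
      proof (rule ccontr)
        assume "\<not> ?thesis"
        then have "vec_norm t x = vec_norm t (\<lambda>_. 0)" by (intro vec_norm_cong) auto
        with xH(2) show False by (simp add: vec_norm_eq L2_set_def)
      qed
      then obtain i where i: "i < t" "x i \<noteq> 0" by blast
      have "x i \<in> hurwitz" using PiE_mem[OF xH(1)] i by simp
      \<comment> \<open>A nonzero coordinate that reduces to zero is \<open>p\<close> times a
        nonzero Hurwitz integer, and this makes the vector longer than \<open>R / s\<close>.\<close>
      then obtain k where k: "k \<in> hurwitz" "x i = of_nat p * k" using ker[of "x i"] z[OF i(1)] by blast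
      have k': "x i = real p *\<^sub>R k" using k(2) by (metis of_real_of_nat_eq scaleR_conv_of_real)
      then have "k \<noteq> 0" using i(2) by auto
      then have "real p * 1 \<le> real p * norm k" using hurwitz_norm_ge_1[OF k(1)] by (intro mult_left_mono) auto
      then have "norm (x i) \<ge> real p" by (simp add: k')
      then have "2 * real p \<le> vec_norm t x" using vec_norm_ge_coordinate[OF i(1), of x] by linarith
      then have "2 * real p \<le> R / s" using xH(3) by linarith
      then have "2 * s * p \<le> R" using s by (simp add: field_simps)
      then show False using nz by (simp add: R_def)
    qed
  next
    fix \<alpha> \<beta> assume ab: "\<alpha> \<in> {0..<int p}" "\<beta> \<in> {0..<int p}" "\<alpha> \<noteq> 0 \<or> \<beta> \<noteq> 0"
    have p0: "sqrt (real p) > 0" using p_gt_1 by simp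
    have sep: "norm (h - k) \<ge> sqrt (real p)" if "h \<in> singular_ideal \<alpha> \<beta>" "k \<in> singular_ideal \<alpha> \<beta>" "h \<noteq> k" for h k
      using singular_ideal_norm_ge[OF singular_ideal_diff[OF that(1,2)] _ ab] that(3) by simp
    define Y where "Y = {x \<in> {..<t} \<rightarrow>\<^sub>E singular_ideal \<alpha> \<beta>. vec_norm t x \<le> R / s}"
    have Y: "finite Y" "real (card Y) * (unit_ball_vol 4 * (sqrt p / 2) ^ 4) ^ t \<le> ball_volume t (R / s + sqrt p * sqrt t)"
      unfolding Y_def
      by (rule separated_count[where D = "singular_ideal \<alpha> \<beta>" and s = "sqrt p"]; use sep p0 in blast)+
    have "X \<inter> ({..<t} \<rightarrow>\<^sub>E singular_ideal \<alpha> \<beta>) \<subseteq> Y" unfolding X_def Y_def by blast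
    then have "card (X \<inter> ({..<t} \<rightarrow>\<^sub>E singular_ideal \<alpha> \<beta>)) \<le> card Y" by (rule card_mono[OF Y(1)])
    moreover have "real (card Y) \<le> N"
    proof -
      have "real (card Y) * (unit_ball_vol 4 * (sqrt p / 2) ^ 4) ^ t \<le> N * (unit_ball_vol 4 * (sqrt p / 2) ^ 4) ^ t"
        using Y(2) sing unfolding R_def by linarith
      moreover have "(unit_ball_vol 4 * (sqrt p / 2) ^ 4) ^ t > 0" using p0 by simp
      ultimately show ?thesis by (rule mult_right_le_imp_le)
    qed
    ultimately show "real (card (X \<inter> ({..<t} \<rightarrow>\<^sub>E singular_ideal \<alpha> \<beta>))) \<le> N" by linarith
  qed
  then obtain A where A: "(\<Sum>x\<in>X \<inter> code_lattice t A. w x)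
    \<le> (\<Sum>x\<in>X. w x) / (real p ^ 2) ^ (t - 1) + (real p ^ 2 * N) / real p ^ (t - 1)" by blast
  also have "\<dots> \<le> K * (exp 1 * (1 - exp (- real t)) / t) / (real p ^ 2) ^ (t - 1) + (real p ^ 2 * N) / real p ^ (t - 1)"
    using w_sum by (intro add_right_mono divide_right_mono) auto
  also have "\<dots> < 24" by (rule final)
  finally have A24: "(\<Sum>x\<in>X \<inter> code_lattice t A. w x) < 24" .
  obtain b where b: "left_independent t t b" "code_lattice t A = hurwitz_span t b"
    using code_lattice_basis[OF t] by blast
  define S where "S = (\<lambda>x. \<lambda>i\<in>{..<t}. s *\<^sub>R (x i :: quat))"
  define \<Lambda> where "\<Lambda> = S ` code_lattice t A"
  have code_sub: "code_lattice t A \<subseteq> {..<t} \<rightarrow>\<^sub>E hurwitz" by (auto simp: code_lattice_def hurwitz_power_sel)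
  interpret hurwitz_lattice t "\<lambda>k i. s *\<^sub>R b k i" \<Lambda>
    unfolding \<Lambda>_def S_def using s b code_sub by (intro scaled_hurwitz_lattice) auto
  have norm_S: "vec_norm t (S x) = s * vec_norm t x" for x
    unfolding S_def using s by (simp add: vec_norm_scaleR)
  have inj: "inj_on S ({..<t} \<rightarrow>\<^sub>E hurwitz)"
  proof (rule inj_onI)
    fix x y assume xy: "x \<in> {..<t} \<rightarrow>\<^sub>E hurwitz" "y \<in> {..<t} \<rightarrow>\<^sub>E hurwitz" "S x = S y"
    have "x i = y i" if "i \<in> {..<t}" for i
      using fun_cong[OF xy(3), of i] that s by (simp add: S_def)
    with xy(1,2) show "x = y" by (rule PiE_ext)
  qed
  have "{y \<in> \<Lambda>. 0 < vec_norm t y \<and> vec_norm t y \<le> level t r 0} = S ` (X \<inter> code_lattice t A)"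
  proof (intro equalityI subsetI)
    fix y assume "y \<in> {y \<in> \<Lambda>. 0 < vec_norm t y \<and> vec_norm t y \<le> level t r 0}"
    then obtain x where x: "x \<in> code_lattice t A" "y = S x" "0 < vec_norm t y" "vec_norm t y \<le> R"
      unfolding \<Lambda>_def R_def by blast
    then have "0 < vec_norm t x" "vec_norm t x \<le> R / s"
      using s by (simp_all add: norm_S field_simps zero_less_mult_iff)
    then have "x \<in> X" unfolding X_def using x(1) code_sub by blast
    with x show "y \<in> S ` (X \<inter> code_lattice t A)" by blast
  next
    fix y assume "y \<in> S ` (X \<inter> code_lattice t A)"
    then obtain x where x: "x \<in> X" "x \<in> code_lattice t A" "y = S x" by blast
    then have "0 < vec_norm t y" "vec_norm t y \<le> R"
      using s by (simp_all add: norm_S X_def field_simps)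
    with x show "y \<in> {y \<in> \<Lambda>. 0 < vec_norm t y \<and> vec_norm t y \<le> level t r 0}"
      unfolding \<Lambda>_def R_def by blast
  qed
  moreover have "inj_on S (X \<inter> code_lattice t A)"
    using inj code_sub by (rule inj_on_subset[OF _ subset_trans[OF Int_lower2]])
  ultimately have "(\<Sum>y\<in>{y \<in> \<Lambda>. 0 < vec_norm t y \<and> vec_norm t y \<le> level t r 0}. weight t r (vec_norm t y))
    = (\<Sum>x\<in>X \<inter> code_lattice t A. w x)"
    by (simp add: sum.reindex norm_S w_def)
  with A24 have "(\<Prod>j=1..t. quat_minimum t j \<Lambda>) powr (1 / real t) > r"
    by (intro geometric_mean_of_minima[OF t r]) simp
  then show ?thesis
    using hurwitz_span_lattice[OF indep] hurwitz_span_free[OF indep]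
    unfolding span[symmetric] \<Lambda>_def S_def Let_def by blast
qed

section \<open>Asymptotic estimates\<close>

text \<open>For n at least 2, n^(-s) is at most 2^(-(s-2)) n^(-2), so the tail is compared with that
  of zeta(2).\<close>

lemma zeta_nat_bounds:
  defines "Z \<equiv> (\<Sum>n. 1 / real (n + 2) ^ 2)"
  assumes s: "s \<ge> 2"
  shows "1 \<le> zeta_nat s" "zeta_nat s \<le> 1 + (1/2) ^ (s - 2) * Z"
proof -
  have sm: "summable (\<lambda>n. 1 / real n ^ s)"
    using inverse_power_summable[OF s, where 'a = real] by (simp add: inverse_eq_divide)
  have sm2: "summable (\<lambda>n. 1 / real (n + 2) ^ 2)"
    using summable_ignore_initial_segment[OF inverse_power_summable[of 2, where 'a = real], of 2]
    by (simp add: inverse_eq_divide)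
  have sm1: "summable (\<lambda>n. 1 / real (Suc n) ^ s)"
    using summable_ignore_initial_segment[OF sm, of 1] by simp
  have sms: "summable (\<lambda>n. 1 / real (n + 2) ^ s)"
    using summable_ignore_initial_segment[OF sm, of 2] by simp
  have split: "zeta_nat s = 1 + (\<Sum>n. 1 / real (n + 2) ^ s)"
    unfolding zeta_nat_def using suminf_split_head[OF sm1] by simp
  then show "1 \<le> zeta_nat s" using suminf_nonneg[OF sms] by simp
  have "(\<Sum>n. 1 / real (n + 2) ^ s) \<le> (\<Sum>n. (1/2) ^ (s - 2) * (1 / real (n + 2) ^ 2))"
  proof (rule suminf_le[OF _ sms summable_mult[OF sm2]])
    fix n
    have "real (n + 2) ^ s = real (n + 2) ^ (s - 2) * real (n + 2) ^ 2"
      by (simp only: power_add[symmetric] le_add_diff_inverse2[OF s])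
    moreover have "(2::real) ^ (s - 2) \<le> real (n + 2) ^ (s - 2)" by (intro power_mono) auto
    ultimately have "2 ^ (s - 2) * real (n + 2) ^ 2 \<le> real (n + 2) ^ s"
      by (simp add: mult_right_mono)
    then have "1 / real (n + 2) ^ s \<le> 1 / (2 ^ (s - 2) * real (n + 2) ^ 2)"
      by (intro divide_left_mono) auto
    then show "1 / real (n + 2) ^ s \<le> (1/2) ^ (s - 2) * (1 / real (n + 2) ^ 2)"
      by (simp add: power_divide)
  qed
  also have "\<dots> = (1/2) ^ (s - 2) * Z" unfolding Z_def by (rule suminf_mult[OF sm2])
  finally show "zeta_nat s \<le> 1 + (1/2) ^ (s - 2) * Z" using split by simp
qed

lemma zeta_nat_tendsto: "(\<lambda>t. zeta_nat (4 * t)) \<longlonglongrightarrow> 1"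
proof -
  define Z where "Z = (\<Sum>n. 1 / real (n + 2) ^ 2)"
  show ?thesis
  proof (rule tendsto_sandwich[where f = "\<lambda>_. 1" and h = "\<lambda>t. 1 + (1/2) ^ (4 * t - 2) * Z"])
    have "filterlim (\<lambda>t :: nat. 4 * t - 2) at_top sequentially"
      by (rule filterlim_at_top_mono[OF filterlim_ident]) (auto intro: eventually_mono[OF eventually_ge_at_top[of 1]])
    then have "(\<lambda>t. (1/2 :: real) ^ (4 * t - 2)) \<longlonglongrightarrow> 0"
      by (rule filterlim_compose[OF LIMSEQ_power_zero, rotated]) simp
    then have "(\<lambda>t. 1 + (1/2) ^ (4 * t - 2) * Z) \<longlonglongrightarrow> 1 + 0 * Z"
      by (intro tendsto_intros)
    then show "(\<lambda>t. 1 + (1/2) ^ (4 * t - 2) * Z) \<longlonglongrightarrow> 1" by simp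
    show "\<forall>\<^sub>F t in sequentially. 1 \<le> zeta_nat (4 * t)"
      using zeta_nat_bounds(1)[of "4 * t" for t]
      by (intro eventually_mono[OF eventually_ge_at_top[of 1]]) simp
    show "\<forall>\<^sub>F t in sequentially. zeta_nat (4 * t) \<le> 1 + (1/2) ^ (4 * t - 2) * Z"
      unfolding Z_def using zeta_nat_bounds(2)[of "4 * t" for t]
      by (intro eventually_mono[OF eventually_ge_at_top[of 1]]) simp
  qed simp
qed

lemma ball_volume_mono: "\<rho> \<le> \<rho>' \<Longrightarrow> ball_volume t \<rho> \<le> ball_volume t \<rho>'"
proof -
  assume le: "\<rho> \<le> \<rho>'"
  have "vec_cball t \<rho> \<subseteq> vec_cball t \<rho>'" using le by (auto simp only: vec_cball_iff)
  then have "ennreal (ball_volume t \<rho>) \<le> ennreal (ball_volume t \<rho>')"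
    unfolding emeasure_vec_cball[symmetric] by (rule emeasure_mono) simp
  then show ?thesis by simp
qed

text \<open>Up to factors exponential in \<open>t\<close>, the volume of the ball is (r / sqrt
  t)^(4t), while the prescribed value on the right is linear in \<open>t\<close> up to bounded
  factors; taking roots pins \<open>r\<close> to the order of \<open>sqrt t\<close>. The hypothesis
  on \<open>(1 - \<epsilon>) * (8 * real t)\<close> makes the prescribed value at least 1.\<close>

lemma radius_bounds:
  assumes \<epsilon>: "0 < \<epsilon>" "\<epsilon> < (1::real)"
  shows "\<exists>a>0. \<exists>D\<ge>1. \<forall>t r. t \<ge> 1 \<longrightarrow> 1 \<le> (1 - \<epsilon>) * (8 * real t) \<longrightarrow> zeta_nat (4 * t) \<le> 2 \<longrightarrow> r > 0 \<longrightarrow>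
    2 ^ t * ball_volume t r = (1 - \<epsilon>) * (24 * real t * zeta_nat (4 * t)) / (exp 1 * (1 - exp (- real t))) \<longrightarrow>
    a * sqrt t \<le> r \<and> r \<le> D * sqrt t"
proof -
  obtain K where K: "K \<ge> 1" "\<And>t. ball_volume t (sqrt t) \<le> K ^ t" using ball_volume_upper by blast
  define k :: real where "k = unit_ball_vol 4 / 16"
  have k: "k > 0" "\<And>t. k ^ t \<le> ball_volume t (sqrt t)" using ball_volume_lower by (simp_all add: k_def)
  \<comment> \<open>This comes from 1 \<le> (2 K q^4)^t for q = r / sqrt t. As a lies below 1, the
    resulting bound a \<le> q^4 implies a \<le> q.\<close>
  define a where "a = 1 / (2 * K)"
  \<comment> \<open>This comes from (k q^4)^t \<le> 48 \<le> 48^t, with the same q; again q^4 \<le>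
    D implies q \<le> D, now because D is at least 1.\<close>
  define D where "D = max 1 (48 / k)"
  have a: "a > 0" "a \<le> 1" using K(1) by (simp_all add: a_def field_simps)
  have D: "D \<ge> 1" by (simp add: D_def)
  have "a * sqrt t \<le> r \<and> r \<le> D * sqrt t"
    if t: "t \<ge> 1" and te: "1 \<le> (1 - \<epsilon>) * (8 * real t)" and z2: "zeta_nat (4 * t) \<le> 2" and r: "r > 0"
      and V: "2 ^ t * ball_volume t r = (1 - \<epsilon>) * (24 * real t * zeta_nat (4 * t)) / (exp 1 * (1 - exp (- real t)))"
    for t :: nat and r :: real
  proof -
    define E where "E = exp 1 * (1 - exp (- real t))"
    have E_eq: "E = exp 1 - exp (1 - real t)" by (simp add: E_def right_diff_distrib flip: exp_add)
    have "exp (1 - real t) \<le> 1" using t by simp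
    moreover have "(2::real) \<le> exp 1" using exp_ge_add_one_self[of 1] by simp
    ultimately have E1: "E \<ge> 1" using E_eq by linarith
    have E3: "E \<le> 3" using E_eq exp_le exp_gt_zero[of "1 - real t"] by linarith
    have z1: "zeta_nat (4 * t) \<ge> 1" using t by (intro zeta_nat_bounds) simp
    define q where "q = r / sqrt t"
    have q: "q > 0" using r t by (simp add: q_def)
    have Vq: "ball_volume t r = q ^ (4 * t) * ball_volume t (sqrt t)"
      unfolding q_def using r t by (intro ball_volume_power) auto
    have "1 \<le> 2 ^ t * ball_volume t r"
    proof -
      \<comment> \<open>The factor 3 makes room for the denominator, as
        \<open>E \<le> 3\<close>.\<close>
      have "3 * 1 \<le> 3 * ((1 - \<epsilon>) * (8 * real t))" by (rule mult_left_mono[OF te]) simp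
      also have "\<dots> \<le> (1 - \<epsilon>) * (24 * real t) * zeta_nat (4 * t)"
        using z1 \<epsilon> by (simp add: mult_le_cancel_left1)
      finally have "3 \<le> (1 - \<epsilon>) * (24 * real t * zeta_nat (4 * t))" by (simp only: mult.assoc mult_1_right)
      then have "E \<le> (1 - \<epsilon>) * (24 * real t * zeta_nat (4 * t))" using E3 by linarith
      then show ?thesis unfolding V E_def[symmetric] using E1 by simp
    qed
    also have "\<dots> \<le> 2 ^ t * (q ^ (4 * t) * K ^ t)"
      unfolding Vq using K(2) q by (intro mult_left_mono) auto
    also have "\<dots> = (2 * K * q ^ 4) ^ t" by (simp add: power_mult power_mult_distrib)
    finally have "1 ^ t \<le> (2 * K * q ^ 4) ^ t" by simp
    then have "1 \<le> 2 * K * q ^ 4" using power_mono_iff[of 1 "2 * K * q ^ 4" t] t K(1) by simp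
    then have "a \<le> q ^ 4" using K(1) by (simp add: a_def field_simps)
    moreover have "a ^ 4 \<le> a" using power_decreasing[of 1 4 a] a by simp
    ultimately have "a ^ 4 \<le> q ^ 4" by linarith
    then have "a \<le> q" using power_mono_iff[of a q 4] a q by simp
    have "(k * q ^ 4) ^ t = k ^ t * q ^ (4 * t)" by (simp add: power_mult power_mult_distrib)
    also have "\<dots> \<le> ball_volume t (sqrt t) * q ^ (4 * t)" using k(2) q by (intro mult_right_mono) auto
    also have "\<dots> = ball_volume t r" using Vq by simp
    also have "\<dots> \<le> 48"
    proof -
      have "2 ^ t * ball_volume t r \<le> (1 - \<epsilon>) * (24 * real t * zeta_nat (4 * t)) / 1"
        unfolding V E_def[symmetric] using E1 \<epsilon> z1 by (intro divide_left_mono) auto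
      also have "\<dots> \<le> 1 * (24 * real t * 2)"
        using \<epsilon> z1 z2 by (simp only: div_by_1) (intro mult_mono; simp)
      \<comment> \<open>The linear factor \<open>t\<close> is absorbed by \<open>2 ^ t\<close>,
        which cancels against the density on the left.\<close>
      also have "\<dots> \<le> 48 * 2 ^ t" using of_nat_mono[OF less_imp_le[OF less_exp[of t]], where 'a = real] by simp
      finally show ?thesis by simp
    qed
    also have "(48::real) \<le> 48 ^ t" using power_increasing[of 1 t "48::real"] t by simp
    finally have "k * q ^ 4 \<le> 48" using power_mono_iff[of "k * q ^ 4" 48 t] t k(1) by simp
    then have "q ^ 4 \<le> 48 / k" using k(1) by (simp add: field_simps)
    also have "\<dots> \<le> D" by (simp add: D_def)
    also have "D \<le> D ^ 4" using power_increasing[of 1 4 D] D by simp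
    finally have "q \<le> D" using power_mono_iff[of q D 4] D q by simp
    with \<open>a \<le> q\<close> show ?thesis using t by (simp add: q_def field_simps)
  qed
  then show ?thesis using a(1) D by blast
qed

section \<open>The scaling factor of the lifts\<close>

definition lift_scale :: "nat \<Rightarrow> nat \<Rightarrow> real" where
  "lift_scale p t = real p powr ((1 - real t) / (2 * real t))"

text \<open>The exponent -1/2 + 1/(2t) is at most -1/4 for \<open>t \<ge> 2\<close>. Therefore
  \<open>exp M\<close> contributes at most exp(-M/4), and t^2 contributes t^(1/t) / t, where t^(1/t)
  is at most e.\<close>

lemma lift_scale_small:
  assumes t: "t \<ge> 2" and M: "M \<ge> 0" and p: "exp M * (real t)\<^sup>2 \<le> real p"
  shows "real t * lift_scale p t \<le> exp (1 - M / 4)"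
proof -
  define e where "e = (1 - real t) / (2 * real t)"
  have e: "e \<le> - (1/4)" "2 * e = 1 / real t - 1" using t by (simp_all add: e_def field_simps)
  have t0: "real t > 0" using t by simp
  have "lift_scale p t \<le> (exp M * (real t)\<^sup>2) powr e"
    unfolding lift_scale_def e_def[symmetric] using p e t0 by (intro powr_mono2') auto
  also have "\<dots> = exp (M * e) * real t powr (2 * e)"
  proof -
    have "ln (exp M * (real t)\<^sup>2) = M + 2 * ln (real t)" using t0 by (simp add: ln_mult ln_realpow)
    then show ?thesis using t0 by (simp add: powr_def algebra_simps flip: exp_add)
  qed
  also have "real t powr (2 * e) = exp (ln t / t) / t"
    unfolding e(2) using t0 by (simp add: powr_diff) (simp add: powr_def)
  finally have "real t * lift_scale p t \<le> real t * (exp (M * e) * (exp (ln t / t) / t))"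
    using t0 by (intro mult_left_mono) auto
  also have "\<dots> = exp (M * e) * exp (ln t / t)" using t0 by simp
  also have "\<dots> \<le> exp (- M / 4) * exp 1"
  proof (intro mult_mono)
    have "M * e \<le> M * (- (1/4))" using e(1) M by (rule mult_left_mono)
    then show "exp (M * e) \<le> exp (- M / 4)" by simp
    have "ln (real t) \<le> real t" using ln_le_minus_one[of "real t"] t0 by linarith
    then show "exp (ln t / t) \<le> exp 1" using t0 by simp
  qed auto
  also have "\<dots> = exp (1 - M / 4)" by (simp flip: exp_add)
  finally show ?thesis .
qed

text \<open>The form in which the growth of \<open>p\<close> controls the counting error, whose
  exponent is a multiple of t times the scale.\<close>

lemma lift_scale_tendsto:
  assumes "(\<lambda>t. (real t)\<^sup>2) \<in> o(\<lambda>t. real (p t))"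
  shows "(\<lambda>t. real t * lift_scale (p t) t) \<longlonglongrightarrow> 0"
proof (rule tendstoI)
  fix \<eta> :: real assume \<eta>: "\<eta> > 0"
  \<comment> \<open>Chosen so that 1 - M / 4 is at most ln \<eta> - 1.\<close>
  define M where "M = max 0 (8 - 4 * ln \<eta>)"
  have M: "M \<ge> 0" "exp (1 - M / 4) < \<eta>"
  proof -
    have "8 - 4 * ln \<eta> \<le> M" by (simp add: M_def)
    then have "1 - M / 4 < ln \<eta>" by simp
    then have "exp (1 - M / 4) < exp (ln \<eta>)" by simp
    then show "exp (1 - M / 4) < \<eta>" using \<eta> by simp
  qed (simp add: M_def)
  have "\<forall>\<^sub>F t in sequentially. norm ((real t)\<^sup>2) \<le> exp (- M) * norm (real (p t))"
    by (rule landau_o.smallD[OF assms]) simp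
  then show "\<forall>\<^sub>F t in sequentially. dist (real t * lift_scale (p t) t) 0 < \<eta>"
    using eventually_ge_at_top[of 2]
  proof eventually_elim
    case (elim t)
    have "exp M * (real t)\<^sup>2 \<le> exp M * (exp (- M) * real (p t))"
      using elim(1) by (intro mult_left_mono) auto
    also have "\<dots> = real (p t)" by (simp flip: exp_add mult.assoc)
    finally have "real t * lift_scale (p t) t \<le> exp (1 - M / 4)"
      using elim(2) M(1) by (intro lift_scale_small)
    then show ?case using M(2) by (simp add: lift_scale_def)
  qed
qed

text \<open>The last equation is the normalisation of the lifts: a code has p^(2(t+1)) of the p^(4t)
  elements, so its preimage has index p^(2(t-1)) in the standard lattice, and scaling divides the
  covolume by exactly this. The two bounds before it both say that the scale is at least
  p^(-1/2).\<close>

lemma lift_scale_bounds: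
  assumes p: "p \<ge> 1" and t: "t \<ge> 1"
  shows "lift_scale p t > 0" "sqrt p \<le> lift_scale p t * p" "1 / lift_scale p t \<le> sqrt p"
    "(1 / lift_scale p t) ^ (4 * t) = (real p ^ 2) ^ (t - 1)"
proof -
  define e where "e = (1 - real t) / (2 * real t)"
  have p1: "real p \<ge> 1" using p by simp
  have sqrt: "sqrt p = real p powr (1/2)" using p1 by (simp add: powr_half_sqrt)
  have inv: "1 / lift_scale p t = real p powr (- e)"
    by (simp add: lift_scale_def e_def powr_minus_divide)
  show "lift_scale p t > 0" using p by (simp add: lift_scale_def)
  have "sqrt p \<le> real p powr (e + 1)"
    unfolding sqrt using p1 t by (intro powr_mono) (simp_all add: e_def field_simps)
  also have "\<dots> = lift_scale p t * p" using p1 by (simp add: powr_add lift_scale_def e_def)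
  finally show "sqrt p \<le> lift_scale p t * p" .
  show "1 / lift_scale p t \<le> sqrt p"
    unfolding inv sqrt using p1 t by (intro powr_mono) (simp_all add: e_def field_simps)
  have "(1 / lift_scale p t) ^ (4 * t) = (real p powr (- e)) powr real (4 * t)"
    unfolding inv using p1 by (subst powr_realpow) auto
  also have "\<dots> = real p powr real (2 * (t - 1))"
    unfolding powr_powr using t by (intro arg_cong2[of _ _ _ _ "(powr)"]) (simp_all add: e_def field_simps of_nat_diff)
  also have "\<dots> = real p ^ (2 * (t - 1))" using p1 by (subst powr_realpow) auto
  finally show "(1 / lift_scale p t) ^ (4 * t) = (real p ^ 2) ^ (t - 1)" by (simp add: power_mult)
qed

lemma level_bounds:
  assumes "r > 0" "t \<ge> 1" "0 \<le> u" "u \<le> 1"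
  shows "r / 2 \<le> level t r u" "level t r u \<le> 3 * r"
proof -
  have x: "- (1/4) \<le> (1 / real t - u) / 4" "(1 / real t - u) / 4 \<le> 1"
  proof -
    have "0 \<le> 1 / real t" "1 / real t \<le> 1" using assms(2) by (simp_all add: field_simps)
    with assms(3,4) have "- 1 \<le> 1 / real t - u" "1 / real t - u \<le> 4" by linarith+
    then show "- (1/4) \<le> (1 / real t - u) / 4" "(1 / real t - u) / 4 \<le> 1" by simp_all
  qed
  have "1/2 \<le> exp ((1 / real t - u) / 4)"
    using exp_ge_add_one_self[of "(1 / real t - u) / 4"] x(1) by linarith
  then have "r * (1/2) \<le> r * exp ((1 / real t - u) / 4)" using assms(1) by (intro mult_left_mono) auto
  then show "r / 2 \<le> level t r u" by (simp add: level_def)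
  have "exp ((1 / real t - u) / 4) \<le> exp 1" using x(2) by simp
  then have "exp ((1 / real t - u) / 4) \<le> 3" using exp_le by linarith
  then have "r * exp ((1 / real t - u) / 4) \<le> r * 3" using assms(1) by (intro mult_left_mono) auto
  then show "level t r u \<le> 3 * r" by (simp add: level_def)
qed

text \<open>Here \<open>c\<close> stands for 24 (1 - \<epsilon>) times the zeta value. The
  hypothesis \<open>final\<close> displays the whole error: the exponential factor from counting
  with enlarged balls, and \<open>(1/2) ^ t\<close> from the vectors of rank 1.\<close>

lemma (in hurwitz_reduction) ex_lift:
  assumes t: "t \<ge> 6" and r: "r > 0"
    and a: "a > 0" "a * sqrt t \<le> r" and D: "D \<ge> 1" "r \<le> D * sqrt t"
    and K1: "K1 \<ge> 1" "ball_volume t (sqrt t) \<le> K1 ^ t"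
    and L: "L \<ge> 1" "L * unit_ball_vol 4 \<ge> 16 * K1 * (3 * D + 1) ^ 4"
    and pt: "9 * D ^ 2 * (real t)\<^sup>2 \<le> real p" "(2 * L) ^ 2 \<le> real p"
    and V: "2 ^ t * ball_volume t r = c * real t / (exp 1 * (1 - exp (- real t)))"
    and final: "c * exp (32 * (real t * lift_scale p t) / a) + (1/2) ^ t < 24"
  shows "\<exists>A. let \<Lambda> = (\<lambda>x. \<lambda>i\<in>{..<t}. lift_scale p t *\<^sub>R x i) ` code_lattice t A in
    is_lattice t \<Lambda> \<and> free_hurwitz_module t \<Lambda> \<and> (\<Prod>j=1..t. quat_minimum t j \<Lambda>) powr (1 / real t) > r"
proof -
  define s where "s = lift_scale p t"
  define P where "P = real p"
  define v where "v = unit_ball_vol 4"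
  define E where "E = exp 1 * (1 - exp (- real t))"
  have t1: "t \<ge> 1" "real t > 0" using t by simp_all
  have P1: "P > 1" using p_gt_1 by (simp add: P_def)
  have v: "v > 0" by (simp add: v_def)
  have E: "E > 0" using t1 by (simp add: E_def)
  have s: "s > 0" "sqrt P \<le> s * P" "1 / s \<le> sqrt P" "(1 / s) ^ (4 * t) = (P ^ 2) ^ (t - 1)"
    using lift_scale_bounds[of p t] p_gt_1 t1 by (simp_all add: s_def P_def)
  \<comment> \<open>The normalised volume of the ball of radius \<open>r\<close>, times the index of
    the lifts, times the loss from counting with enlarged balls.\<close>
  define K where "K = 2 ^ t * ball_volume t r * (P ^ 2) ^ (t - 1) * exp (32 * (real t * s) / a)"
  have lev0: "level t r 0 \<le> 3 * D * sqrt t"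
    using level_bounds(2)[OF r t1(1), of 0] D(2) by simp
  show ?thesis
    unfolding s_def[symmetric]
  proof (rule ex_code_lattice[OF t1(1) r s(1), where K = K and N = "L ^ t"])
    have "(3 * D * sqrt t)\<^sup>2 = 9 * D ^ 2 * real t" by (simp add: power_mult_distrib)
    also have "\<dots> \<le> 9 * D ^ 2 * (real t)\<^sup>2"
      using t1 by (intro mult_left_mono) (auto simp: power2_eq_square)
    also have "\<dots> \<le> (sqrt P)\<^sup>2" using pt(1) P1 by (simp add: P_def)
    finally have "3 * D * sqrt t \<le> sqrt P" by (rule power2_le_imp_le) (use P1 in simp)
    moreover have "sqrt P > 0" using P1 by simp
    ultimately show "level t r 0 < 2 * s * real p"
      using lev0 s(2) unfolding P_def by linarith
  next
    \<comment> \<open>Rank 1: by \<open>1 / s \<le> sqrt P\<close> the radius before scaling is at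
      most \<open>sqrt P\<close> times a multiple of \<open>sqrt t\<close>, and the separation is
      \<open>sqrt P\<close> as well. The powers of \<open>P\<close> cancel and leave
      \<open>L ^ t\<close>.\<close>
    have "level t r 0 / s \<le> (3 * D * sqrt t) * sqrt P"
    proof -
      have "level t r 0 * (1 / s) \<le> (3 * D * sqrt t) * sqrt P"
        using lev0 s(1,3) D(1) r by (intro mult_mono) (auto simp: level_def)
      then show ?thesis by simp
    qed
    then have "level t r 0 / s + sqrt P * sqrt t \<le> ((3 * D + 1) * sqrt P) * sqrt t"
      by (simp add: algebra_simps)
    then have "ball_volume t (level t r 0 / s + sqrt P * sqrt t) \<le> ball_volume t (((3 * D + 1) * sqrt P) * sqrt t)"
      by (rule ball_volume_mono)
    also have "\<dots> = ((3 * D + 1) * sqrt P) ^ (4 * t) * ball_volume t (sqrt t)"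
      using D(1) P1 by (intro ball_volume_scale) auto
    also have "\<dots> \<le> ((3 * D + 1) * sqrt P) ^ (4 * t) * K1 ^ t"
      using K1(2) D(1) P1 by (intro mult_left_mono) auto
    also have "\<dots> = (K1 * (3 * D + 1) ^ 4 * P ^ 2) ^ t"
    proof -
      have "sqrt P ^ 4 = P ^ 2"
        using P1 power_mult[of "sqrt P" 2 2] by simp
      then show ?thesis by (simp add: power_mult power_mult_distrib)
    qed
    also have "\<dots> \<le> (L * (v * (sqrt P / 2) ^ 4)) ^ t"
    proof (rule power_mono)
      have q4: "(sqrt P / 2) ^ 4 = P ^ 2 / 16"
        using P1 power_mult[of "sqrt P" 2 2] by (simp add: power_divide)
      have "16 * K1 * (3 * D + 1) ^ 4 * P ^ 2 \<le> L * v * P ^ 2"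
        using L(2) unfolding v_def by (intro mult_right_mono) auto
      then show "K1 * (3 * D + 1) ^ 4 * P ^ 2 \<le> L * (v * (sqrt P / 2) ^ 4)"
        unfolding q4 by linarith
    qed (use K1 D in simp)
    finally show "ball_volume t (level t r 0 / s + sqrt (real p) * sqrt t) \<le> L ^ t * (unit_ball_vol 4 * (sqrt (real p) / 2) ^ 4) ^ t"
      by (simp only: power_mult_distrib v_def P_def)
  next
    show "K \<ge> 0" by (simp add: K_def)
  next
    fix u :: real assume u: "0 \<le> u" "u \<le> 1"
    define l where "l = level t r u"
    have l: "r / 2 \<le> l" using level_bounds(1)[OF r t1(1) u] by (simp add: l_def)
    then have l0: "l > 0" using r by simp
    \<comment> \<open>A bound for the enlargement of the radius \<open>l / s\<close> by
      \<open>4 * sqrt t\<close>, relative to \<open>l / s\<close>, since \<open>l\<close> is at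
      least \<open>r / 2\<close> and \<open>r\<close> at least \<open>a * sqrt t\<close>.\<close>
    define x where "x = 8 * s / a"
    have x: "x > 0" using s a by (simp add: x_def)
    have "4 * sqrt t \<le> (l / s) * x"
    proof -
      have "4 * (a * sqrt t) \<le> 4 * r" using a(2) by simp
      also have "\<dots> \<le> 8 * l" using l by simp
      finally show ?thesis using a(1) s(1) by (simp add: x_def field_simps)
    qed
    moreover have "(l / s * (1 + x) / r) * r = l / s + (l / s) * x" using r by (simp add: distrib_left)
    ultimately have "l / s + 4 * sqrt t \<le> (l / s * (1 + x) / r) * r" by linarith
    then have "ball_volume t (l / s + 4 * sqrt t) \<le> ball_volume t ((l / s * (1 + x) / r) * r)"
      by (rule ball_volume_mono)
    also have "\<dots> = (l / s * (1 + x) / r) ^ (4 * t) * ball_volume t r"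
      using l0 s r x by (intro ball_volume_scale) auto
    also have "l / s * (1 + x) / r = (exp ((1 / t - u) / 4) * (1 / s)) * (1 + x)"
      using r by (simp add: l_def level_def)
    also have "((exp ((1 / t - u) / 4) * (1 / s)) * (1 + x)) ^ (4 * t)
      = exp (1 - real t * u) * (P ^ 2) ^ (t - 1) * (1 + x) ^ (4 * t)"
    proof -
      have "exp ((1 / t - u) / 4) ^ (4 * t) = exp (real (4 * t) * ((1 / t - u) / 4))"
        by (rule exp_of_nat_mult[symmetric])
      also have "real (4 * t) * ((1 / t - u) / 4) = 1 - real t * u" using t1 by (simp add: field_simps)
      finally show ?thesis by (simp only: power_mult_distrib s(4))
    qed
    finally have "2 ^ t * ball_volume t (l / s + 4 * sqrt t)
      \<le> 2 ^ t * (exp (1 - real t * u) * (P ^ 2) ^ (t - 1) * (1 + x) ^ (4 * t) * ball_volume t r)"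
      by (rule mult_left_mono) simp
    also have "\<dots> \<le> 2 ^ t * (exp (1 - real t * u) * (P ^ 2) ^ (t - 1) * exp (32 * (real t * s) / a) * ball_volume t r)"
    proof -
      \<comment> \<open>The relative enlargement is raised to the dimension, and 4 t x = 32 t s /
        a.\<close>
      have "(1 + x) ^ (4 * t) \<le> exp x ^ (4 * t)" using x by (intro power_mono exp_ge_add_one_self) auto
      also have "\<dots> = exp (real (4 * t) * x)" by (rule exp_of_nat_mult[symmetric])
      also have "real (4 * t) * x = 32 * (real t * s) / a" by (simp add: x_def)
      finally show ?thesis by (intro mult_left_mono mult_right_mono) auto
    qed
    also have "\<dots> = K * exp (1 - real t * u)" by (simp add: K_def)
    finally show "2 ^ t * ball_volume t (level t r u / s + 4 * sqrt t) \<le> K * exp (1 - real t * u)"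
      by (simp add: l_def)
  next
    have "K * (E / t) / (P ^ 2) ^ (t - 1) = (2 ^ t * ball_volume t r) * (E / t) * exp (32 * (real t * s) / a)"
      using P1 by (simp add: K_def)
    also have "\<dots> = c * exp (32 * (real t * s) / a)"
      unfolding V E_def[symmetric] using E t1 by simp
    finally have first: "K * (E / t) / (P ^ 2) ^ (t - 1) = c * exp (32 * (real t * s) / a)" .
    \<comment> \<open>From \<open>t \<ge> 6\<close> follows t \<le> 2 (t - 3). After
      \<open>P ^ 2\<close> has been split off \<open>P ^ (t - 1)\<close>, the remaining
      \<open>P ^ (t - 3)\<close> therefore absorbs \<open>L ^ t\<close> with \<open>2 ^ t\<close> to
      spare.\<close>
    have "(2 * L) ^ t \<le> (2 * L) ^ (2 * (t - 3))" using L(1) t by (intro power_increasing) auto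
    also have "\<dots> = ((2 * L) ^ 2) ^ (t - 3)" by (rule power_mult)
    also have "\<dots> \<le> P ^ (t - 3)" using pt(2) by (intro power_mono) (auto simp: P_def)
    finally have PL: "(2 * L) ^ t \<le> P ^ (t - 3)" .
    have "t - 1 = 2 + (t - 3)" using t by simp
    then have "P ^ (t - 1) = P ^ 2 * P ^ (t - 3)" by (simp only: power_add)
    then have "P ^ 2 * L ^ t / P ^ (t - 1) = L ^ t / P ^ (t - 3)" using P1 by simp
    also have "\<dots> \<le> L ^ t / (2 * L) ^ t" using PL L(1) P1 by (intro divide_left_mono) auto
    also have "\<dots> = (1/2) ^ t" using L(1) by (simp add: power_mult_distrib power_divide)
    finally have "P ^ 2 * L ^ t / P ^ (t - 1) \<le> (1/2) ^ t" .
    with first final show "K * (exp 1 * (1 - exp (- real t)) / t) / (real p ^ 2) ^ (t - 1) + real p ^ 2 * L ^ t / real p ^ (t - 1) < 24"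
      unfolding E_def P_def s_def by linarith
  qed
qed

theorem proposition5p6:
  fixes \<epsilon> :: real
    and r :: "nat \<Rightarrow> real"
    and p :: "nat \<Rightarrow> nat"
    and \<sigma> :: "nat \<Rightarrow> quat set \<Rightarrow> 2 \<Rightarrow> 2 \<Rightarrow> int"
  assumes "0 < \<epsilon>" and "\<epsilon> < 1"
    and "\<And>t. t \<ge> 1 \<Longrightarrow> r t > 0 \<and>
      vec_vol t (vec_cball t (r t)) =
        (1 - \<epsilon>) * (24 * real t * covolume t (carrier (hurwitz_power t)) * zeta_nat (4 * t))
          / (exp 1 * (1 - exp (- real t)))"
    and "\<And>t. t \<ge> 1 \<Longrightarrow> prime (p t) \<and> odd (p t)"
    and "\<And>t. t \<ge> 1 \<Longrightarrow> \<sigma> t \<in> ring_iso (hurwitz_ring Quot p_ideal (p t)) (mat2_mod (p t))"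
  shows "\<exists>T. \<forall>t\<ge>1. \<exists>\<Lambda>.
    is_lattice t \<Lambda> \<and> free_hurwitz_module t \<Lambda> \<and>
    (\<Prod>j=1..t. quat_minimum t j \<Lambda>) powr (1 / real t) > r t \<and>
    ((\<lambda>t. (real t)\<^sup>2) \<in> o(\<lambda>t. real (p t)) \<and> t \<ge> T \<longrightarrow> \<Lambda> \<in> lifts (\<sigma> t) (p t) t)"
proof (cases "(\<lambda>t. (real t)\<^sup>2) \<in> o(\<lambda>t. real (p t))")
  case False
  then show ?thesis using ex_lattice_large_minima assms(3) by blast
next
  case True
  have r_pos: "r t > 0" if "t \<ge> 1" for t using assms(3) that by blast
  have V: "2 ^ t * ball_volume t (r t) = (1 - \<epsilon>) * (24 * real t * zeta_nat (4 * t)) / (exp 1 * (1 - exp (- real t)))"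
    if "t \<ge> 1" for t
  proof -
    have "16 ^ t * ball_volume t (r t) =
      (1 - \<epsilon>) * (24 * real t * 8 ^ t * zeta_nat (4 * t)) / (exp 1 * (1 - exp (- real t)))"
      using assms(3)[OF that] by (simp add: vec_vol_def ball_volume_def covolume_hurwitz)
    moreover have "(16 :: real) ^ t = 8 ^ t * 2 ^ t" by (simp flip: power_mult_distrib)
    ultimately have "8 ^ t * (2 ^ t * ball_volume t (r t)) =
      8 ^ t * ((1 - \<epsilon>) * (24 * real t * zeta_nat (4 * t)) / (exp 1 * (1 - exp (- real t))))"
      by (simp add: mult_ac)
    then show ?thesis by (simp only: mult_cancel_left) simp
  qed
  obtain a D where a: "a > 0" and D: "D \<ge> 1" and radius: "\<And>t r. t \<ge> 1 \<Longrightarrow> 1 \<le> (1 - \<epsilon>) * (8 * real t) \<Longrightarrow>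
      zeta_nat (4 * t) \<le> 2 \<Longrightarrow> r > 0 \<Longrightarrow>
      2 ^ t * ball_volume t r = (1 - \<epsilon>) * (24 * real t * zeta_nat (4 * t)) / (exp 1 * (1 - exp (- real t))) \<Longrightarrow>
      a * sqrt t \<le> r \<and> r \<le> D * sqrt t"
    using radius_bounds[OF assms(1,2)] by blast
  obtain K1 where K1: "K1 \<ge> 1" "\<And>t. ball_volume t (sqrt t) \<le> K1 ^ t" using ball_volume_upper by blast
  define L where "L = max 1 (16 * K1 * (3 * D + 1) ^ 4 / unit_ball_vol 4)"
  have v: "unit_ball_vol 4 > 0" by simp
  have L: "L \<ge> 1" "L * unit_ball_vol 4 \<ge> 16 * K1 * (3 * D + 1) ^ 4"
  proof -
    have "16 * K1 * (3 * D + 1) ^ 4 / unit_ball_vol 4 \<le> L" by (simp add: L_def)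
    then show "L * unit_ball_vol 4 \<ge> 16 * K1 * (3 * D + 1) ^ 4" using v by (simp only: pos_divide_le_eq)
  qed (simp add: L_def)
  \<comment> \<open>Both lower bounds on \<open>p\<close> in \<open>ex_lift\<close> follow from p
    \<ge> B t^2.\<close>
  define B where "B = max (9 * D ^ 2) ((2 * L) ^ 2)"
  have B: "9 * D ^ 2 \<le> B" "(2 * L) ^ 2 \<le> B" "B > 0"
    using D by (auto simp: B_def less_max_iff_disj)
  \<comment> \<open>An upper bound for the mean weight of a lift. Its limit 24 (1 - \<epsilon>) is
    below 24, and this gap makes all error terms affordable for large \<open>t\<close>.\<close>
  define F where "F t = (1 - \<epsilon>) * (24 * zeta_nat (4 * t)) * exp (32 * (real t * lift_scale (p t) t) / a) + (1/2) ^ t" for t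
  have "F \<longlonglongrightarrow> (1 - \<epsilon>) * (24 * 1) * exp (32 * 0 / a) + 0"
    unfolding F_def using a
    by (intro tendsto_intros zeta_nat_tendsto lift_scale_tendsto[OF True] LIMSEQ_power_zero) auto
  moreover have "(1 - \<epsilon>) * (24 * 1) * exp (32 * 0 / a) + 0 < 24" using assms(1) by simp
  ultimately have F: "\<forall>\<^sub>F t in sequentially. F t < 24" by (rule order_tendstoD(2))
  have zeta: "\<forall>\<^sub>F t in sequentially. zeta_nat (4 * t) < 2"
    using zeta_nat_tendsto by (rule order_tendstoD(2)) simp
  have "\<forall>\<^sub>F t in sequentially. norm ((real t)\<^sup>2) \<le> (1 / B) * norm (real (p t))"
    using B(3) by (intro landau_o.smallD[OF True]) simp
  \<comment> \<open>This threshold supplies the lower bound on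
    \<open>(1 - \<epsilon>) * (8 * real t)\<close> in \<open>radius_bounds\<close>.\<close>
  moreover have "\<forall>\<^sub>F t in sequentially. 1 / (8 * (1 - \<epsilon>)) \<le> real t"
    by (rule eventually_ge_at_top[THEN eventually_compose_filterlim, OF filterlim_real_sequentially])
  ultimately have "\<forall>\<^sub>F t in sequentially. \<exists>\<Lambda>\<in>lifts (\<sigma> t) (p t) t.
    is_lattice t \<Lambda> \<and> free_hurwitz_module t \<Lambda> \<and> (\<Prod>j=1..t. quat_minimum t j \<Lambda>) powr (1 / real t) > r t"
    using F zeta eventually_ge_at_top[of 6]
  proof eventually_elim
    case (elim t)
    have t: "t \<ge> 1" using elim(5) by simp
    define \<phi> where "\<phi> h = \<sigma> t (p_ideal (p t) +>\<^bsub>hurwitz_ring\<^esub> h)" for h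
    interpret hurwitz_reduction "p t" \<phi>
      using hurwitz_reductionI[of "p t" "\<sigma> t"] assms(4,5)[OF t] by (simp add: \<phi>_def[abs_def])
    have rad: "a * sqrt t \<le> r t \<and> r t \<le> D * sqrt t"
    proof (rule radius[OF t _ _ r_pos[OF t] V[OF t]])
      show "1 \<le> (1 - \<epsilon>) * (8 * real t)" using elim(2) assms(2) by (simp add: field_simps)
    qed (use elim(4) in simp)
    have Bp: "B * (real t)\<^sup>2 \<le> real (p t)" using elim(1) B(3) by (simp add: field_simps)
    have pt: "9 * D ^ 2 * (real t)\<^sup>2 \<le> real (p t)" "(2 * L) ^ 2 \<le> real (p t)"
    proof -
      have "9 * D ^ 2 * (real t)\<^sup>2 \<le> B * (real t)\<^sup>2" using B(1) by (intro mult_right_mono) auto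
      with Bp show "9 * D ^ 2 * (real t)\<^sup>2 \<le> real (p t)" by linarith
      have "1 \<le> (real t)\<^sup>2" using t by (simp add: one_le_power)
      then have "B * 1 \<le> B * (real t)\<^sup>2" using B(3) by (intro mult_left_mono) auto
      with Bp B(2) show "(2 * L) ^ 2 \<le> real (p t)" by linarith
    qed
    have Vc: "2 ^ t * ball_volume t (r t) = ((1 - \<epsilon>) * (24 * zeta_nat (4 * t))) * real t / (exp 1 * (1 - exp (- real t)))"
      unfolding V[OF t] by (simp add: mult_ac)
    have fin: "(1 - \<epsilon>) * (24 * zeta_nat (4 * t)) * exp (32 * (real t * lift_scale (p t) t) / a) + (1/2) ^ t < 24"
      using elim(3) by (simp add: F_def)
    obtain A where A: "let \<Lambda> = (\<lambda>x. \<lambda>i\<in>{..<t}. lift_scale (p t) t *\<^sub>R x i) ` code_lattice t A in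
      is_lattice t \<Lambda> \<and> free_hurwitz_module t \<Lambda> \<and> (\<Prod>j=1..t. quat_minimum t j \<Lambda>) powr (1 / real t) > r t"
      using ex_lift[OF elim(5) r_pos[OF t] a conjunct1[OF rad] D conjunct2[OF rad] K1(1) K1(2) L pt Vc fin] by blast
    have "code_lattice t A = {x \<in> carrier (hurwitz_power t). reduction (\<sigma> t) (p t) t x \<in> code (p t) t A}"
      by (simp add: code_lattice_def reduce_def reduction_def \<phi>_def)
    moreover have "code (p t) t A \<in> codes (p t) t (t + 1)" using p_gt_1 t by (intro code_in_codes)
    ultimately have "(\<lambda>x. \<lambda>i\<in>{..<t}. lift_scale (p t) t *\<^sub>R x i) ` code_lattice t A \<in> lifts (\<sigma> t) (p t) t"
      unfolding lifts_def lift_scale_def by blast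
    with A show ?case unfolding Let_def by blast
  qed
  then obtain T where T: "\<And>t. t \<ge> T \<Longrightarrow> \<exists>\<Lambda>\<in>lifts (\<sigma> t) (p t) t.
    is_lattice t \<Lambda> \<and> free_hurwitz_module t \<Lambda> \<and> (\<Prod>j=1..t. quat_minimum t j \<Lambda>) powr (1 / real t) > r t"
    unfolding eventually_sequentially by blast
  show ?thesis
  proof (intro exI[of _ T] allI impI)
    fix t :: nat assume t: "t \<ge> 1"
    show "\<exists>\<Lambda>. is_lattice t \<Lambda> \<and> free_hurwitz_module t \<Lambda> \<and>
      (\<Prod>j=1..t. quat_minimum t j \<Lambda>) powr (1 / real t) > r t \<and>
      ((\<lambda>t. (real t)\<^sup>2) \<in> o(\<lambda>t. real (p t)) \<and> t \<ge> T \<longrightarrow> \<Lambda> \<in> lifts (\<sigma> t) (p t) t)"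
    proof (cases "t \<ge> T")
      case True
      then show ?thesis using T[of t] by blast
    next
      case False
      then show ?thesis using ex_lattice_large_minima[OF t r_pos[OF t]] by blast
    qed
  qed
qed

end
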